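(* Let $G$ be a $3$-lateration graph on at least $5$ vertices. Then $G$ is globally rigid in any (non-Euclidean) analytic normed plane $X$.
   Context: Graphs are finite and simple. A normed plane is a $2$-dimensional real normed space. It is analytic if the restriction of its norm to $X\setminus\{0\}$ is a real analytic function (in linear coordinates), and non-Euclidean if its norm does not come from an inner product. For a graph $G=(V,E)$, a placement is an element $p=(p_v)_{v\in V}\in X^V$, and the pair $(G,p)$ is called a framework in $X$. Two frameworks $(G,p),(G,q)$ are equivalent if $\|p_v-p_w\|=\|q_v-q_w\|$ for all $vw\in E$. They are congruent if there is an isometry $g$ of $X$ with $q_v=g(p_v)$ for all $v\in V$. The framework $(G,p)$ is globally rigid in $X$ if every framework $(G,q)$ in $X$ equivalent to $(G,p)$ is congruent to $(G,p)$. The graph $G$ is globally rigid in $X$ if the set $\{p\in X^V:(G,p)\text{ is globally rigid in }X\}$ has non-empty interior in $X^V$. A graph is a $k$-lateration graph if it is obtained from the complete graph $K_k$ by sequentially adding vertices of degree $k$, i.e. each new vertex is joined, when added, to exactly $k$ distinct existing vertices (with no assumption on adjacencies between those $k$ vertices). *)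

theory Defs
  imports "HOL-Analysis.Analysis"
begin

definition normed_plane :: "'x::real_normed_vector itself \<Rightarrow> bool" where
  "normed_plane _ \<longleftrightarrow> dim (UNIV :: 'x set) = 2"

text \<open>Real analyticity in two real variables, meant for open \<open>S\<close>: around each point of \<open>S\<close> the
  function is given by a convergent double power series. Convergence is unconditional, equivalently
  absolute, as usual for power series in several variables.\<close>

definition real_analytic_on :: "(real \<times> real \<Rightarrow> real) \<Rightarrow> (real \<times> real) set \<Rightarrow> bool" where
  "real_analytic_on f S \<longleftrightarrow>
     (\<forall>a b. (a, b) \<in> S \<longrightarrow>
       (\<exists>(c :: nat \<Rightarrow> nat \<Rightarrow> real) r. r > 0 \<and>
         (\<forall>x y. \<bar>x - a\<bar> < r \<and> \<bar>y - b\<bar> < r \<longrightarrow>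
           ((\<lambda>(i, j). c i j * (x - a) ^ i * (y - b) ^ j) has_sum f (x, y)) UNIV)))"

text \<open>The map \<open>L\<close> is a choice of linear coordinates on the plane. Since a linear change of
  coordinates preserves real analyticity, the property does not depend on this choice.\<close>

definition analytic_normed_plane :: "'x::real_normed_vector itself \<Rightarrow> bool" where
  "analytic_normed_plane T \<longleftrightarrow> normed_plane T \<and>
     (\<exists>L :: real \<times> real \<Rightarrow> 'x. linear L \<and> bij L \<and>
        real_analytic_on (\<lambda>z. norm (L z)) (UNIV - {0}))"

definition inner_product :: "('x::real_vector \<Rightarrow> 'x \<Rightarrow> real) \<Rightarrow> bool" where
  "inner_product B \<longleftrightarrow>
     bilinear B \<and> (\<forall>x y. B x y = B y x) \<and> (\<forall>x. x \<noteq> 0 \<longrightarrow> B x x > 0)"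

definition euclidean_norm :: "'x::real_normed_vector itself \<Rightarrow> bool" where
  "euclidean_norm _ \<longleftrightarrow>
     (\<exists>B :: 'x \<Rightarrow> 'x \<Rightarrow> real. inner_product B \<and> (\<forall>x. norm x = sqrt (B x x)))"

text \<open>A finite simple graph is given by its finite vertex set \<open>V\<close> and its set \<open>E\<close> of two-element
  subsets of \<open>V\<close>. The space of placements (with values in the normed space) is the set
  \<open>V \<rightarrow>\<^sub>E UNIV\<close> of extensional functions, with the product topology.\<close>

definition equivalent_frameworks ::
  "'v set set \<Rightarrow> ('v \<Rightarrow> 'x::real_normed_vector) \<Rightarrow> ('v \<Rightarrow> 'x) \<Rightarrow> bool" where
  "equivalent_frameworks E p q \<longleftrightarrow>
     (\<forall>v w. {v, w} \<in> E \<longrightarrow> norm (p v - p w) = norm (q v - q w))"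

definition isometry :: "('x::real_normed_vector \<Rightarrow> 'x) \<Rightarrow> bool" where
  "isometry g \<longleftrightarrow> surj g \<and> (\<forall>x y. dist (g x) (g y) = dist x y)"

definition congruent_frameworks ::
  "'v set \<Rightarrow> ('v \<Rightarrow> 'x::real_normed_vector) \<Rightarrow> ('v \<Rightarrow> 'x) \<Rightarrow> bool" where
  "congruent_frameworks V p q \<longleftrightarrow> (\<exists>g. isometry g \<and> (\<forall>v\<in>V. q v = g (p v)))"

definition globally_rigid_framework ::
  "'v set \<Rightarrow> 'v set set \<Rightarrow> ('v \<Rightarrow> 'x::real_normed_vector) \<Rightarrow> bool" where
  "globally_rigid_framework V E p \<longleftrightarrow>
     (\<forall>q \<in> V \<rightarrow>\<^sub>E UNIV. equivalent_frameworks E p q \<longrightarrow> congruent_frameworks V p q)"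

definition globally_rigid_in ::
  "'x::real_normed_vector itself \<Rightarrow> 'v set \<Rightarrow> 'v set set \<Rightarrow> bool" where
  "globally_rigid_in _ V E \<longleftrightarrow>
     product_topology (\<lambda>_. euclidean :: 'x topology) V interior_of
       {p \<in> V \<rightarrow>\<^sub>E UNIV. globally_rigid_framework V E p} \<noteq> {}"

inductive lateration_graph :: "nat \<Rightarrow> 'v set \<Rightarrow> 'v set set \<Rightarrow> bool" for k :: nat where
  complete: "finite V \<Longrightarrow> card V = k \<Longrightarrow> lateration_graph k V {e. e \<subseteq> V \<and> card e = 2}"
| add_vertex: "lateration_graph k V E \<Longrightarrow> v \<notin> V \<Longrightarrow> S \<subseteq> V \<Longrightarrow> card S = k \<Longrightarrow>
    lateration_graph k (insert v V) (E \<union> {{v, w} | w. w \<in> S})"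

lemma lateration_graph_finite_simple:
  assumes "lateration_graph k V E"
  shows "finite V" and "\<forall>e\<in>E. e \<subseteq> V \<and> card e = 2"
proof -
  have "finite V \<and> (\<forall>e\<in>E. e \<subseteq> V \<and> card e = 2)"
    using assms by induction (auto simp: card_insert_if)
  then show "finite V" and "\<forall>e\<in>E. e \<subseteq> V \<and> card e = 2" by auto
qed

end

theory Submission
  imports Defs "HOL-Complex_Analysis.Conformal_Mappings"
begin

text \<open>
  The vertices of a 3-lateration graph are placed one after the other, and along the way a
  \<^emph>\<open>box\<close> of placements is maintained: a product of nonempty open sets all of whose members are
  globally rigid frameworks.

  \<^emph>\<open>Adding a vertex.\<close> Put the new vertex at a point \<open>x\<close> very close to one of its three neighbours,
  \<open>a\<close>. In an equivalent framework that already agrees with the given one on the old vertices, the new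
  vertex sits at some \<open>y\<close> with \<open>\<parallel>y - a\<parallel> = \<parallel>x - a\<parallel>\<close>, so \<open>y\<close> is close to \<open>a\<close> as well. If \<open>b\<close> and \<open>c\<close>
  are not collinear with \<open>a\<close>, the distances to \<open>b\<close> and \<open>c\<close> are local coordinates near \<open>a\<close>, whence
  \<open>y = x\<close> (\<open>trilateration_unique\<close>). Thus a new vertex only shrinks the box
  (\<open>box_globally_rigid_add_vertex\<close>), and it remains to treat five vertices, where the graph is
  \<open>K\<^sub>5\<close> minus an edge: a triangle \<open>a, b, c\<close> and two vertices \<open>d, e\<close> joined to all of it.

  \<^emph>\<open>The limit of separated scales.\<close> Choose linear coordinates, let \<open>N\<close> be the norm in them, and put
  the five points at \<open>0, \<epsilon>b, c, \<epsilon>\<^sup>2d, \<epsilon>\<^sup>2e\<close>. As \<open>\<epsilon>\<close> tends to \<open>0\<close>, the nine lengths amount, after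
  rescaling, to \<open>N c, N b, N d, N e\<close> and to the numbers \<open>grad c \<bullet> b\<close>, \<open>grad b \<bullet> d\<close>, \<open>grad b \<bullet> e\<close>,
  \<open>grad c \<bullet> d\<close>, \<open>grad c \<bullet> e\<close>, where \<open>grad\<close> is the gradient of \<open>N\<close>. Choose \<open>b\<close> with
  \<open>grad c \<bullet> b = 0\<close>. Up to a sign of \<open>b\<close>, all pairs \<open>(c, b)\<close> with the same data are then given by the
  direction \<open>t\<close> of \<open>c\<close> alone, and \<open>d\<close> and \<open>e\<close> are the solutions \<open>B\<^sub>t\<^sup>-\<^sup>1 \<xi>\<close> and \<open>B\<^sub>t\<^sup>-\<^sup>1 \<eta>\<close> of linear
  systems whose matrix \<open>B\<^sub>t\<close> has the rows \<open>grad c\<close> and \<open>grad b\<close>. What is left is one unknown, \<open>t\<close>,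
  and two equations: \<open>N (B\<^sub>t\<^sup>-\<^sup>1 \<xi>)\<close> and \<open>N (B\<^sub>t\<^sup>-\<^sup>1 \<eta>)\<close> are prescribed.

  \<^emph>\<open>Solving the limit problem\<close> (\<open>exists_rigid_frame_point\<close>). If \<open>t \<mapsto> N (B\<^sub>t\<^sup>-\<^sup>1 \<xi>)\<close> were constant for
  every \<open>\<xi>\<close>, the maps \<open>B\<^sub>t\<^sup>-\<^sup>1 B\<^sub>0\<close> would be linear isometries that carry one direction to all others,
  and the norm would be Euclidean (\<open>transitive_isometries_imp_quadratic\<close>). So it is not constant for
  a suitable \<open>\<xi>\<close>, and since it is analytic, its derivative is nonzero at some \<open>t\<^sub>0\<close> and its value at
  \<open>t\<^sub>0\<close> is attained at finitely many \<open>t\<close> only. For each of these, either \<open>B\<^sub>t\<^sup>-\<^sup>1\<close> and the inverse of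
  \<open>B\<close> at \<open>t\<^sub>0\<close> differ by an isometry, or, again by analyticity, a general \<open>\<eta>\<close> rules \<open>t\<close> out. Hence
  the limit data determine the limit configuration up to a linear isometry (\<open>limit_rigid\<close>), and the
  nonzero derivative makes it infinitesimally rigid (\<open>infinitesimally_rigid\<close>).

  \<^emph>\<open>Back to positive \<open>\<epsilon>\<close>\<close> (\<open>near_rigid\<close>). If rigidity failed for configurations arbitrarily near the
  limit, there would be non-congruent pairs \<open>P\<^sub>n, Q\<^sub>n\<close> with equal lengths and \<open>P\<^sub>n\<close> tending to the limit
  configuration. By compactness and limit rigidity, \<open>Q\<^sub>n\<close> may be assumed to have the same limit. The
  direction of \<open>Q\<^sub>n - P\<^sub>n\<close> then subconverges to a nontrivial infinitesimal motion, which does not exist.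
\<close>

section \<open>Real analytic functions of one and two variables\<close>

text \<open>Convergence at the corner \<open>(a + \<rho>, b + \<rho>)\<close> of a smaller box is absolute, since the terms are
  real, and bounds all the terms on the corresponding complex bidisc.\<close>

lemma double_series_majorant:
  fixes f :: "real \<times> real \<Rightarrow> real"
  assumes "\<And>x y. \<bar>x - a\<bar> < r \<Longrightarrow> \<bar>y - b\<bar> < r \<Longrightarrow>
      ((\<lambda>(i, j). c i j * (x - a) ^ i * (y - b) ^ j) has_sum f (x, y)) UNIV"
    and "0 \<le> \<rho>" "\<rho> < r"
  shows "(\<lambda>(i, j). \<bar>c i j\<bar> * \<rho> ^ i * \<rho> ^ j) summable_on (UNIV :: (nat \<times> nat) set)"
proof -
  have "((\<lambda>(i, j). c i j * \<rho> ^ i * \<rho> ^ j) has_sum f (a + \<rho>, b + \<rho>)) UNIV"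
    using assms(1)[of "a + \<rho>" "b + \<rho>"] assms(2,3) by (simp add: abs_of_nonneg)
  then have "(\<lambda>(i, j). c i j * \<rho> ^ i * \<rho> ^ j) summable_on UNIV"
    by (rule has_sum_imp_summable)
  then have "(\<lambda>x. norm (case x of (i, j) \<Rightarrow> c i j * \<rho> ^ i * \<rho> ^ j)) summable_on UNIV"
    using summable_on_iff_abs_summable_on_real by blast
  then show ?thesis
    by (rule back_subst[of "\<lambda>g. g summable_on UNIV"])
      (use assms(2) in \<open>auto simp: abs_mult power_abs fun_eq_iff\<close>)
qed

lemma double_series_term_bound:
  fixes u v :: "'a::real_normed_field"
  assumes "norm u \<le> \<rho>" "norm v \<le> \<rho>"
  shows "norm (of_real c * u ^ i * v ^ j) \<le> \<bar>c\<bar> * \<rho> ^ i * \<rho> ^ j"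
proof -
  have "0 \<le> \<rho>" using assms(1) norm_ge_zero order_trans by blast
  then show ?thesis
    using assms by (auto simp: norm_mult norm_power intro!: mult_mono power_mono)
qed

text \<open>The series may be evaluated along any pair of functions with values in the bidisc of radius
  \<open>\<rho>\<close>; the majorant makes the convergence uniform (Weierstrass).\<close>

lemma double_series_uniform_limit:
  fixes X Y :: "'b \<Rightarrow> 'a::{real_normed_field, banach}"
  assumes "(\<lambda>(i, j). \<bar>c i j\<bar> * \<rho> ^ i * \<rho> ^ j) summable_on (UNIV :: (nat \<times> nat) set)"
    and "\<And>z. z \<in> S \<Longrightarrow> norm (X z) \<le> \<rho>" "\<And>z. z \<in> S \<Longrightarrow> norm (Y z) \<le> \<rho>"
  shows "uniform_limit S (\<lambda>F z. \<Sum>(i, j)\<in>F. of_real (c i j) * X z ^ i * Y z ^ j)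
      (\<lambda>z. \<Sum>\<^sub>\<infinity>(i, j). of_real (c i j) * X z ^ i * Y z ^ j) (finite_subsets_at_top UNIV)"
proof -
  have "uniform_limit S (\<lambda>F z. \<Sum>x\<in>F. (\<lambda>x z. case x of (i, j) \<Rightarrow> of_real (c i j) * X z ^ i * Y z ^ j) x z)
      (\<lambda>z. \<Sum>\<^sub>\<infinity>x. (\<lambda>x z. case x of (i, j) \<Rightarrow> of_real (c i j) * X z ^ i * Y z ^ j) x z) (finite_subsets_at_top UNIV)"
    by (rule Weierstrass_m_test_general[OF _ assms(1)])
      (use assms(2,3) in \<open>auto split: prod.splits intro!: double_series_term_bound\<close>)
  then show ?thesis by simp
qed

lemma holomorphic_double_series:
  fixes X Y :: "complex \<Rightarrow> complex"
  assumes "(\<lambda>(i, j). \<bar>c i j\<bar> * \<rho> ^ i * \<rho> ^ j) summable_on (UNIV :: (nat \<times> nat) set)"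
    and "X holomorphic_on cball z0 s" "Y holomorphic_on cball z0 s"
    and "\<And>z. z \<in> cball z0 s \<Longrightarrow> norm (X z) \<le> \<rho>" "\<And>z. z \<in> cball z0 s \<Longrightarrow> norm (Y z) \<le> \<rho>"
  shows "(\<lambda>z. \<Sum>\<^sub>\<infinity>(i, j). of_real (c i j) * X z ^ i * Y z ^ j) holomorphic_on ball z0 s"
proof -
  have hol: "(\<lambda>z. \<Sum>(i, j)\<in>F. of_real (c i j) * X z ^ i * Y z ^ j) holomorphic_on cball z0 s" for F
    by (auto simp: case_prod_unfold intro!: holomorphic_intros assms)
  have cont: "\<forall>\<^sub>F F in finite_subsets_at_top UNIV.
      continuous_on (cball z0 s) (\<lambda>z. \<Sum>(i, j)\<in>F. of_real (c i j) * X z ^ i * Y z ^ j) \<and>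
      (\<lambda>z. \<Sum>(i, j)\<in>F. of_real (c i j) * X z ^ i * Y z ^ j) holomorphic_on ball z0 s"
    using holomorphic_on_imp_continuous_on[OF hol] holomorphic_on_subset[OF hol ball_subset_cball]
    by (intro always_eventually) auto
  show ?thesis
    by (rule holomorphic_uniform_limit[OF cont double_series_uniform_limit[OF assms(1,4,5)]]) auto
qed

text \<open>Analyticity on the whole real line is expressed by local holomorphic extensions rather than by
  power series, so that closure under composition and the identity theorem are inherited from
  complex analysis.\<close>

definition real_analytic1 :: "(real \<Rightarrow> real) \<Rightarrow> bool" where
  "real_analytic1 h \<longleftrightarrow> (\<forall>t. \<exists>H r. r > 0 \<and> H holomorphic_on ball (of_real t) r \<and>
     (\<forall>s. \<bar>s - t\<bar> < r \<longrightarrow> H (of_real s) = complex_of_real (h s)))"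

lemma real_analytic1_restrict:
  assumes "H holomorphic_on UNIV" "\<And>s. H (of_real s) = complex_of_real (h s)"
  shows "real_analytic1 h"
  unfolding real_analytic1_def
proof
  fix t
  show "\<exists>H r. r > 0 \<and> H holomorphic_on ball (of_real t) r \<and>
     (\<forall>s. \<bar>s - t\<bar> < r \<longrightarrow> H (of_real s) = complex_of_real (h s))"
    by (rule exI[of _ H], rule exI[of _ 1]) (use assms holomorphic_on_subset[OF assms(1)] in simp)
qed

lemma real_analytic1_const: "real_analytic1 (\<lambda>_. k)"
  by (rule real_analytic1_restrict[of "\<lambda>_. of_real k"]) auto

lemma real_analytic1_ident: "real_analytic1 (\<lambda>t. t)"
  by (rule real_analytic1_restrict[of "\<lambda>z. z"]) auto

lemma real_analytic1_sin: "real_analytic1 sin"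
  by (rule real_analytic1_restrict[of sin]) (auto simp: sin_of_real intro!: holomorphic_intros)

lemma real_analytic1_cos: "real_analytic1 cos"
  by (rule real_analytic1_restrict[of cos]) (auto simp: cos_of_real intro!: holomorphic_intros)

lemma real_analytic1_pair:
  assumes "real_analytic1 f" "real_analytic1 g"
  obtains F G r where "r > 0" "F holomorphic_on ball (of_real t) r" "G holomorphic_on ball (of_real t) r"
    "\<And>s. \<bar>s - t\<bar> < r \<Longrightarrow> F (of_real s) = complex_of_real (f s)"
    "\<And>s. \<bar>s - t\<bar> < r \<Longrightarrow> G (of_real s) = complex_of_real (g s)"
proof -
  from assms(1) obtain F r1 where F: "r1 > 0" "F holomorphic_on ball (of_real t) r1"
    "\<And>s. \<bar>s - t\<bar> < r1 \<Longrightarrow> F (of_real s) = complex_of_real (f s)"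
    unfolding real_analytic1_def by blast
  from assms(2) obtain G r2 where G: "r2 > 0" "G holomorphic_on ball (of_real t) r2"
    "\<And>s. \<bar>s - t\<bar> < r2 \<Longrightarrow> G (of_real s) = complex_of_real (g s)"
    unfolding real_analytic1_def by blast
  show ?thesis
    by (rule that[of "min r1 r2" F G], use F(1) G(1) in simp,
        rule holomorphic_on_subset[OF F(2)], force, rule holomorphic_on_subset[OF G(2)], force)
      (use F(3) G(3) in auto)
qed

lemma
  assumes "real_analytic1 f" "real_analytic1 g"
  shows real_analytic1_add: "real_analytic1 (\<lambda>t. f t + g t)"
    and real_analytic1_mult: "real_analytic1 (\<lambda>t. f t * g t)"
proof -
  have "(\<exists>H r. r > 0 \<and> H holomorphic_on ball (of_real t) r \<and>
     (\<forall>s. \<bar>s - t\<bar> < r \<longrightarrow> H (of_real s) = complex_of_real (f s + g s))) \<and>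
    (\<exists>H r. r > 0 \<and> H holomorphic_on ball (of_real t) r \<and>
     (\<forall>s. \<bar>s - t\<bar> < r \<longrightarrow> H (of_real s) = complex_of_real (f s * g s)))" for t
  proof -
    obtain F G r where
      FG: "r > 0" "F holomorphic_on ball (of_real t) r" "G holomorphic_on ball (of_real t) r"
      "\<And>s. \<bar>s - t\<bar> < r \<Longrightarrow> F (of_real s) = complex_of_real (f s)"
      "\<And>s. \<bar>s - t\<bar> < r \<Longrightarrow> G (of_real s) = complex_of_real (g s)"
      by (rule real_analytic1_pair[OF assms, of t]) blast
    show ?thesis
      by (rule conjI, rule exI[of _ "\<lambda>z. F z + G z"], rule exI[of _ r], use FG in \<open>simp add: holomorphic_on_add\<close>,
          rule exI[of _ "\<lambda>z. F z * G z"], rule exI[of _ r], use FG in \<open>simp add: holomorphic_on_mult\<close>)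
  qed
  then show "real_analytic1 (\<lambda>t. f t + g t)" "real_analytic1 (\<lambda>t. f t * g t)"
    unfolding real_analytic1_def by blast+
qed

lemma real_analytic1_minus:
  assumes "real_analytic1 f" shows "real_analytic1 (\<lambda>t. - f t)"
  using real_analytic1_mult[OF real_analytic1_const[of "-1"] assms] by simp

lemma real_analytic1_diff:
  assumes "real_analytic1 f" "real_analytic1 g"
  shows "real_analytic1 (\<lambda>t. f t - g t)"
  using real_analytic1_add[OF assms(1) real_analytic1_minus[OF assms(2)]] by simp

lemma real_analytic1_inverse:
  assumes "real_analytic1 f" "\<And>t. f t \<noteq> 0"
  shows "real_analytic1 (\<lambda>t. inverse (f t))"
  unfolding real_analytic1_def
proof
  fix t
  from assms(1) obtain F r where F: "r > 0" "F holomorphic_on ball (of_real t) r"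
    "\<And>s. \<bar>s - t\<bar> < r \<Longrightarrow> F (of_real s) = complex_of_real (f s)"
    unfolding real_analytic1_def by blast
  have ne: "F (of_real t) \<noteq> 0" using F(3)[of t] F(1) assms(2) by simp
  have "isCont F (of_real t)"
    using F(1,2) by (metis centre_in_ball continuous_on_eq_continuous_at holomorphic_on_imp_continuous_on open_ball)
  then obtain d where d: "d > 0" "\<And>z. dist z (of_real t) < d \<Longrightarrow> F z \<noteq> 0"
    using continuous_at_avoid[where f = F and x = "of_real t" and a = 0] ne by (metis dist_commute)
  have "F holomorphic_on ball (of_real t) (min r d)"
    by (rule holomorphic_on_subset[OF F(2)]) force
  then have "(\<lambda>z. inverse (F z)) holomorphic_on ball (of_real t) (min r d)"
    by (rule holomorphic_on_inverse) (use d(2) in \<open>auto simp: dist_commute\<close>)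
  note inv = this
  show "\<exists>H r. r > 0 \<and> H holomorphic_on ball (of_real t) r \<and>
     (\<forall>s. \<bar>s - t\<bar> < r \<longrightarrow> H (of_real s) = complex_of_real (inverse (f s)))"
    by (rule exI[of _ "\<lambda>z. inverse (F z)"], rule exI[of _ "min r d"]) (use inv F(1,3) d(1) in auto)
qed

lemma real_analytic1_divide:
  assumes "real_analytic1 f" "real_analytic1 g" "\<And>t. g t \<noteq> 0"
  shows "real_analytic1 (\<lambda>t. f t / g t)"
  using real_analytic1_mult[OF assms(1) real_analytic1_inverse[OF assms(2,3)]]
  by (simp add: divide_inverse)

text \<open>The double series is absolutely convergent on a complex bidisc, so it can be evaluated at the
  holomorphic extensions of the two inner functions. The result is a locally uniform limit of
  holomorphic functions.\<close>

lemma real_analytic1_compose: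
  assumes f: "real_analytic_on f S"
    and x: "real_analytic1 x" and y: "real_analytic1 y" and S: "\<And>t. (x t, y t) \<in> S"
  shows "real_analytic1 (\<lambda>t. f (x t, y t))"
  unfolding real_analytic1_def
proof
  fix t
  from f S[of t] obtain c r where r: "r > 0" and ser: "\<And>u v. \<bar>u - x t\<bar> < r \<Longrightarrow> \<bar>v - y t\<bar> < r \<Longrightarrow>
      ((\<lambda>(i, j). c i j * (u - x t) ^ i * (v - y t) ^ j) has_sum f (u, v)) UNIV"
    unfolding real_analytic_on_def by blast
  obtain X Y d where d: "d > 0"
    and hol: "X holomorphic_on ball (of_real t) d" "Y holomorphic_on ball (of_real t) d"
    and X: "\<And>s. \<bar>s - t\<bar> < d \<Longrightarrow> X (of_real s) = complex_of_real (x s)"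
    and Y: "\<And>s. \<bar>s - t\<bar> < d \<Longrightarrow> Y (of_real s) = complex_of_real (y s)"
    by (rule real_analytic1_pair[OF x y, of t]) blast
  have "isCont X (of_real t)" "isCont Y (of_real t)"
    using d hol by (metis centre_in_ball continuous_on_eq_continuous_at holomorphic_on_imp_continuous_on open_ball)+
  then obtain d1 d2 where d1: "d1 > 0" "\<And>z. dist z (of_real t) < d1 \<Longrightarrow> dist (X z) (X (of_real t)) < r/2"
    and d2: "d2 > 0" "\<And>z. dist z (of_real t) < d2 \<Longrightarrow> dist (Y z) (Y (of_real t)) < r/2"
    using r unfolding continuous_at_eps_delta by (metis half_gt_zero)
  define e where "e = min d (min d1 d2) / 2"
  have e: "e > 0" "e < d" "e < d1" "e < d2" using d d1(1) d2(1) by (auto simp: e_def)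
  define U where "U = (\<lambda>z. X z - of_real (x t))"
  define W where "W = (\<lambda>z. Y z - of_real (y t))"
  define H where "H = (\<lambda>z. \<Sum>\<^sub>\<infinity>(i, j). of_real (c i j) * U z ^ i * W z ^ j)"
  have maj: "(\<lambda>(i, j). \<bar>c i j\<bar> * (r/2) ^ i * (r/2) ^ j) summable_on UNIV"
    by (rule double_series_majorant[OF ser]) (use r in auto)
  have UW: "norm (U z) \<le> r/2" "norm (W z) \<le> r/2" if "z \<in> cball (of_real t) e" for z
  proof -
    have "dist z (of_real t) \<le> e" using that by (simp add: dist_commute)
    then show "norm (U z) \<le> r/2" "norm (W z) \<le> r/2"
      using d1(2)[of z] d2(2)[of z] e X[of t] Y[of t] d by (auto simp: U_def W_def dist_norm)
  qed
  have "cball (of_real t) e \<subseteq> ball (complex_of_real t) d" using e(2) by auto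
  then have "X holomorphic_on cball (of_real t) e" "Y holomorphic_on cball (of_real t) e"
    using hol holomorphic_on_subset by blast+
  then have "H holomorphic_on ball (of_real t) e"
    unfolding H_def
    by (intro holomorphic_double_series[OF maj _ _ UW]) (auto simp: U_def W_def intro!: holomorphic_intros)
  moreover have "H (of_real s) = of_real (f (x s, y s))" if s: "\<bar>s - t\<bar> < e" for s
  proof -
    have "complex_of_real s \<in> cball (of_real t) e"
      using s by (simp add: dist_of_real dist_real_def)
    from UW[OF this] have "\<bar>x s - x t\<bar> < r" "\<bar>y s - y t\<bar> < r"
      using X[of s] Y[of s] s e r unfolding U_def W_def by (auto simp flip: of_real_diff)
    from ser[OF this] have "((\<lambda>p. of_real (case p of (i, j) \<Rightarrow> c i j * (x s - x t) ^ i * (y s - y t) ^ j))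
        has_sum complex_of_real (f (x s, y s))) UNIV"
      by (simp add: has_sum_of_real_iff)
    moreover have "(\<lambda>p. of_real (case p of (i, j) \<Rightarrow> c i j * (x s - x t) ^ i * (y s - y t) ^ j)) =
      (\<lambda>(i, j). of_real (c i j) * U (of_real s) ^ i * W (of_real s) ^ j)"
      using X[of s] Y[of s] s e by (auto simp: U_def W_def fun_eq_iff)
    ultimately show ?thesis unfolding H_def by (simp add: infsumI)
  qed
  ultimately show "\<exists>H r. r > 0 \<and> H holomorphic_on ball (of_real t) r \<and>
     (\<forall>s. \<bar>s - t\<bar> < r \<longrightarrow> H (of_real s) = complex_of_real (f (x s, y s)))"
    using e(1) by blast
qed

text \<open>The points at which the zeros of \<open>h\<close> accumulate form a closed set. By the complex identity
  theorem \<open>h\<close> vanishes near each such point, so the set is open too, and the line is connected.\<close>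

lemma real_analytic1_identity:
  assumes h: "real_analytic1 h" and lim: "t0 islimpt {t. h t = 0}"
  shows "h t = 0"
proof -
  have near: "\<exists>r>0. \<forall>s. \<bar>s - t\<bar> < r \<longrightarrow> h s = 0" if t: "t islimpt {t. h t = 0}" for t
  proof -
    obtain H r where r: "r > 0" "H holomorphic_on ball (of_real t) r"
      and H: "\<And>s. \<bar>s - t\<bar> < r \<Longrightarrow> H (of_real s) = complex_of_real (h s)"
      using h unfolding real_analytic1_def by blast
    define U where "U = complex_of_real ` ({t. h t = 0} \<inter> ball t r)"
    have "t islimpt ({t. h t = 0} \<inter> ball t r)"
      using t r(1) by (intro islimpt_Int_eventually eventually_at_in_open') auto
    then have lp: "complex_of_real t islimpt U"
      unfolding U_def islimpt_approachable
      by (auto simp: dist_of_real) 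
    have "H z = 0" if "z \<in> ball (of_real t) r" for z
      by (rule analytic_continuation[OF r(2) _ _ _ _ lp _ that])
        (use r H in \<open>auto simp: U_def dist_of_real dist_real_def abs_minus_commute\<close>)
    then have "h s = 0" if "\<bar>s - t\<bar> < r" for s
      using H[OF that] that by (metis abs_minus_commute dist_of_real dist_real_def mem_ball of_real_eq_0_iff)
    then show ?thesis using r(1) by blast
  qed
  define W where "W = {t. t islimpt {t. h t = 0}}"
  have "open W"
    unfolding open_dist
  proof
    fix t assume "t \<in> W"
    then obtain r where r: "r > 0" "\<forall>s. \<bar>s - t\<bar> < r \<longrightarrow> h s = 0" using near unfolding W_def by blast
    have "s \<in> W" if "dist s t < r" for s
    proof -
      have "s islimpt ball t r"
        using that by (intro interior_limit_point) (auto simp: dist_commute)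
      then show ?thesis unfolding W_def mem_Collect_eq
        by (rule islimpt_subset) (use r in \<open>auto simp: dist_real_def abs_minus_commute\<close>)
    qed
    then show "\<exists>e>0. \<forall>y. dist y t < e \<longrightarrow> y \<in> W" using r(1) by blast
  qed
  moreover have "closed W" unfolding W_def by (rule closed_limpts)
  ultimately have "W = {} \<or> W = UNIV" using connected_UNIV clopen by blast
  then have "t \<in> W" using lim by (auto simp: W_def)
  then obtain r where "r > 0" "\<forall>s. \<bar>s - t\<bar> < r \<longrightarrow> h s = 0" using near unfolding W_def by blast
  then show ?thesis by simp
qed

lemma real_analytic1_eq_on_interval:
  assumes "real_analytic1 f" "real_analytic1 g" "a < b" "\<And>t. a < t \<Longrightarrow> t < b \<Longrightarrow> f t = g t"
  shows "f t = g t"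
proof -
  have "((a + b) / 2) islimpt {a<..<b}"
    using assms(3) by (intro interior_limit_point) (auto simp: interior_open)
  then have "((a + b) / 2) islimpt {t. f t - g t = 0}"
    by (rule islimpt_subset) (use assms(4) in auto)
  from real_analytic1_identity[OF real_analytic1_diff[OF assms(1,2)] this] show ?thesis by simp
qed

lemma real_analytic1_finite_zeros:
  assumes "real_analytic1 h" "h t1 \<noteq> 0"
  shows "finite {t \<in> {a..b}. h t = 0}"
proof (rule ccontr)
  assume "infinite {t \<in> {a..b}. h t = 0}"
  then obtain t0 where "t0 islimpt {t \<in> {a..b}. h t = 0}"
    using Heine_Borel_imp_Bolzano_Weierstrass[OF compact_Icc, of "{t \<in> {a..b}. h t = 0}" a b]
    by (metis (no_types, lifting) mem_Collect_eq subsetI)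
  then have "t0 islimpt {t. h t = 0}" by (rule islimpt_subset) auto
  from real_analytic1_identity[OF assms(1) this] assms(2) show False by blast
qed

lemma real_analytic1_differentiable:
  assumes "real_analytic1 h"
  obtains D where "(h has_real_derivative D) (at t)"
proof -
  obtain H r where r: "r > 0" "H holomorphic_on ball (of_real t) r"
    and H: "\<And>s. \<bar>s - t\<bar> < r \<Longrightarrow> H (of_real s) = complex_of_real (h s)"
    using assms unfolding real_analytic1_def by blast
  from r have "H field_differentiable at (of_real t)"
    by (simp add: holomorphic_on_imp_differentiable_at)
  then obtain D where "(H has_field_derivative D) (at (of_real t))"
    unfolding field_differentiable_def by blast
  then have "((\<lambda>x. H (of_real x)) has_vector_derivative D) (at t)"
    by (rule has_vector_derivative_real_field)
  then have "((\<lambda>x. Re (H (of_real x))) has_real_derivative Re D) (at t)"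
    by (rule has_field_derivative_Re)
  then have "(h has_real_derivative Re D) (at t)"
    by (rule has_field_derivative_transform_within[of _ _ _ _ r]) (use r H in \<open>auto simp: dist_real_def\<close>)
  then show ?thesis by (rule that)
qed

text \<open>For fixed second variable the series is a uniform limit, over the finite sets of indices, of
  polynomials in a complex first variable. The derivatives of these polynomials converge to the
  derivative of the limit, and convergence along finite sets of indices is precisely unconditional
  summability. So the partial derivative is again the sum of a double power series.\<close>

lemma real_analytic_on_partial1:
  assumes "real_analytic_on f S"
  obtains g where "real_analytic_on g S"
    "\<And>a b. (a, b) \<in> S \<Longrightarrow> \<exists>r>0. \<forall>x y. \<bar>x - a\<bar> < r \<longrightarrow> \<bar>y - b\<bar> < r \<longrightarrow>
       ((\<lambda>x. f (x, y)) has_real_derivative g (x, y)) (at x)"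
proof -
  define g where "g = (\<lambda>(x, y). deriv (\<lambda>x. f (x, y)) x)"
  have main: "\<exists>c' r. r > 0 \<and> (\<forall>x y. \<bar>x - a\<bar> < r \<and> \<bar>y - b\<bar> < r \<longrightarrow>
           ((\<lambda>x. f (x, y)) has_real_derivative g (x, y)) (at x) \<and>
           ((\<lambda>(i, j). c' i j * (x - a) ^ i * (y - b) ^ j) has_sum g (x, y)) UNIV)"
    if ab: "(a, b) \<in> S" for a b
  proof -
    from assms ab obtain c r where r: "r > 0" and ser: "\<And>x y. \<bar>x - a\<bar> < r \<Longrightarrow> \<bar>y - b\<bar> < r \<Longrightarrow>
      ((\<lambda>(i, j). c i j * (x - a) ^ i * (y - b) ^ j) has_sum f (x, y)) UNIV"
      unfolding real_analytic_on_def by blast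
    define c' where "c' = (\<lambda>i j. real (Suc i) * c (Suc i) j)"
    have "((\<lambda>x. f (x, y)) has_real_derivative g (x, y)) (at x) \<and>
           ((\<lambda>(i, j). c' i j * (x - a) ^ i * (y - b) ^ j) has_sum g (x, y)) UNIV"
      if x: "\<bar>x - a\<bar> < r" and y: "\<bar>y - b\<bar> < r" for x y
    proof -
      obtain \<rho> where \<rho>: "max \<bar>x - a\<bar> \<bar>y - b\<bar> < \<rho>" "\<rho> < r"
        using x y dense[of "max \<bar>x - a\<bar> \<bar>y - b\<bar>" r] by auto
      then have \<rho>0: "0 < \<rho>" by linarith
      have maj: "(\<lambda>(i, j). \<bar>c i j\<bar> * \<rho> ^ i * \<rho> ^ j) summable_on UNIV"
        by (rule double_series_majorant[OF ser]) (use \<rho> \<rho>0 in auto)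
      define w where "w = complex_of_real (y - b)"
      have w: "norm w \<le> \<rho>" using \<rho> unfolding w_def norm_of_real by simp
      define G where "G = (\<lambda>z. \<Sum>\<^sub>\<infinity>(i, j). of_real (c i j) * z ^ i * w ^ j)"
      have ul: "uniform_limit (cball 0 \<rho>) (\<lambda>F z. \<Sum>(i, j)\<in>F. of_real (c i j) * z ^ i * w ^ j) G
          (finite_subsets_at_top UNIV)"
        unfolding G_def by (rule double_series_uniform_limit[OF maj]) (use w in auto)
      have der: "\<forall>\<^sub>F F in finite_subsets_at_top UNIV.
          continuous_on (cball 0 \<rho>) (\<lambda>z. \<Sum>(i, j)\<in>F. of_real (c i j) * z ^ i * w ^ j) \<and>
          (\<forall>z\<in>ball 0 \<rho>. ((\<lambda>z. \<Sum>(i, j)\<in>F. of_real (c i j) * z ^ i * w ^ j) has_field_derivative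
              (\<Sum>(i, j)\<in>F. of_real (c i j) * (of_nat i * z ^ (i - 1)) * w ^ j)) (at z))"
        by (intro always_eventually allI conjI ballI)
          (auto simp: case_prod_unfold intro!: continuous_intros derivative_eq_intros sum.cong)
      obtain g' where g': "\<And>z. z \<in> ball 0 \<rho> \<Longrightarrow> (G has_field_derivative g' z) (at z) \<and>
          ((\<lambda>F. \<Sum>(i, j)\<in>F. of_real (c i j) * (of_nat i * z ^ (i - 1)) * w ^ j) \<longlongrightarrow> g' z)
          (finite_subsets_at_top UNIV)"
        by (rule has_complex_derivative_uniform_limit[OF der ul _ \<rho>0]) auto
      define z where "z = complex_of_real (x - a)"
      have z: "z \<in> ball 0 \<rho>" using \<rho> unfolding z_def mem_ball dist_0_norm norm_of_real by simp
      have hs: "((\<lambda>(i, j). of_real (c i j) * (of_nat i * z ^ (i - 1)) * w ^ j) has_sum g' z) UNIV"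
        using g'[OF z] unfolding has_sum_def by simp
      have hs2: "((\<lambda>(i, j). of_real (c i j) * (of_nat i * z ^ (i - 1)) * w ^ j) has_sum g' z)
          ((\<lambda>(i, j). (Suc i, j)) ` UNIV)"
      proof (rule has_sum_cong_neutral[THEN iffD1, OF _ _ _ hs])
        fix p :: "nat \<times> nat" assume "p \<in> UNIV - (\<lambda>(i, j). (Suc i, j)) ` UNIV"
        then have "fst p = 0" by (cases p; cases "fst p") (auto simp: image_iff)
        then show "(case p of (i, j) \<Rightarrow> of_real (c i j) * (of_nat i * z ^ (i - 1)) * w ^ j) = 0"
          by (cases p) simp
      qed auto
      have "((\<lambda>p. case (case p of (i, j) \<Rightarrow> (Suc i, j)) of (i, j) \<Rightarrow>
          of_real (c i j) * (of_nat i * z ^ (i - 1)) * w ^ j) has_sum g' z) UNIV"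
        using hs2 by (subst (asm) has_sum_reindex) (auto simp: inj_on_def o_def)
      moreover have "(\<lambda>p. case (case p of (i, j) \<Rightarrow> (Suc i, j)) of (i, j) \<Rightarrow>
          of_real (c i j) * (of_nat i * z ^ (i - 1)) * w ^ j) =
          (\<lambda>p. of_real (case p of (i, j) \<Rightarrow> c' i j * (x - a) ^ i * (y - b) ^ j))"
        by (auto simp: fun_eq_iff c'_def z_def w_def)
      ultimately have "((\<lambda>p. complex_of_real (case p of (i, j) \<Rightarrow> c' i j * (x - a) ^ i * (y - b) ^ j))
          has_sum g' z) UNIV" by simp
      from has_sum_Re[OF this]
      have hsr: "((\<lambda>(i, j). c' i j * (x - a) ^ i * (y - b) ^ j) has_sum Re (g' z)) UNIV" by simp
      have "(G has_field_derivative g' z) (at (of_real (x - a)))" using g'[OF z] z_def by simp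
      then have "((\<lambda>u. G (of_real u)) has_vector_derivative g' z) (at (x - a))"
        by (rule has_vector_derivative_real_field)
      then have "((\<lambda>u. Re (G (of_real u))) has_real_derivative Re (g' z)) (at (x - a))"
        by (rule has_field_derivative_Re)
      then have d: "((\<lambda>u. Re (G (of_real (u - a)))) has_real_derivative Re (g' z)) (at x)"
        using DERIV_shift[of "\<lambda>u. Re (G (of_real u))" "Re (g' z)" x "- a"] by simp
      have "((\<lambda>x. f (x, y)) has_real_derivative Re (g' z)) (at x)"
      proof (rule has_field_derivative_transform_within[OF d])
        show "0 < r - \<bar>x - a\<bar>" using x by simp
        fix u assume "dist u x < r - \<bar>x - a\<bar>"
        then have "\<bar>u - a\<bar> < r" by (auto simp: dist_real_def)
        from ser[OF this y] have "((\<lambda>p. of_real (case p of (i, j) \<Rightarrow> c i j * (u - a) ^ i * (y - b) ^ j))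
            has_sum complex_of_real (f (u, y))) UNIV"
          by (simp add: has_sum_of_real_iff)
        moreover have "(\<lambda>p. of_real (case p of (i, j) \<Rightarrow> c i j * (u - a) ^ i * (y - b) ^ j)) =
          (\<lambda>(i, j). of_real (c i j) * complex_of_real (u - a) ^ i * w ^ j)"
          by (auto simp: w_def fun_eq_iff)
        ultimately have "G (of_real (u - a)) = of_real (f (u, y))"
          unfolding G_def by (simp add: infsumI)
        then show "Re (G (of_real (u - a))) = f (u, y)" by simp
      qed simp
      moreover from this have "g (x, y) = Re (g' z)" by (simp add: g_def DERIV_imp_deriv)
      ultimately show ?thesis using hsr by simp
    qed
    then show ?thesis using r by blast
  qed
  show ?thesis
  proof
    show "real_analytic_on g S" unfolding real_analytic_on_def using main by blast
    show "\<exists>r>0. \<forall>x y. \<bar>x - a\<bar> < r \<longrightarrow> \<bar>y - b\<bar> < r \<longrightarrow>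
       ((\<lambda>x. f (x, y)) has_real_derivative g (x, y)) (at x)" if "(a, b) \<in> S" for a b
      using main[OF that] by blast
  qed
qed

lemma real_analytic_on_swap:
  assumes "real_analytic_on f S"
  shows "real_analytic_on (f \<circ> prod.swap) (prod.swap ` S)"
  unfolding real_analytic_on_def
proof (intro allI impI)
  fix a b assume "(a, b) \<in> prod.swap ` S"
  then have "(b, a) \<in> S" by auto
  with assms obtain c r where r: "r > 0" and ser: "\<And>x y. \<bar>x - b\<bar> < r \<Longrightarrow> \<bar>y - a\<bar> < r \<Longrightarrow>
      ((\<lambda>(i, j). c i j * (x - b) ^ i * (y - a) ^ j) has_sum f (x, y)) UNIV"
    unfolding real_analytic_on_def by blast
  have "((\<lambda>(i, j). c j i * (x - a) ^ i * (y - b) ^ j) has_sum (f \<circ> prod.swap) (x, y)) UNIV"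
    if "\<bar>x - a\<bar> < r" "\<bar>y - b\<bar> < r" for x y
  proof -
    have "((\<lambda>(i, j). c i j * (y - b) ^ i * (x - a) ^ j) has_sum f (y, x)) (prod.swap ` UNIV)"
      using ser[OF that(2,1)] by simp
    then have "(((\<lambda>(i, j). c i j * (y - b) ^ i * (x - a) ^ j) \<circ> prod.swap) has_sum f (y, x)) UNIV"
      by (subst (asm) has_sum_reindex) (auto simp: inj_on_def)
    moreover have "((\<lambda>(i, j). c i j * (y - b) ^ i * (x - a) ^ j) \<circ> prod.swap) =
        (\<lambda>(i, j). c j i * (x - a) ^ i * (y - b) ^ j)" by (auto simp: fun_eq_iff)
    ultimately show ?thesis by simp
  qed
  then show "\<exists>c r. r > 0 \<and> (\<forall>x y. \<bar>x - a\<bar> < r \<and> \<bar>y - b\<bar> < r \<longrightarrow>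
      ((\<lambda>(i, j). c i j * (x - a) ^ i * (y - b) ^ j) has_sum (f \<circ> prod.swap) (x, y)) UNIV)"
    using r by (intro exI[of _ "\<lambda>i j. c j i"]) blast
qed

lemma real_analytic_on_partial2:
  assumes "real_analytic_on f S"
  obtains g where "real_analytic_on g S"
    "\<And>a b. (a, b) \<in> S \<Longrightarrow> \<exists>r>0. \<forall>x y. \<bar>x - a\<bar> < r \<longrightarrow> \<bar>y - b\<bar> < r \<longrightarrow>
       ((\<lambda>y. f (x, y)) has_real_derivative g (x, y)) (at y)"
proof -
  from real_analytic_on_partial1[OF real_analytic_on_swap[OF assms]] obtain g where
    g: "real_analytic_on g (prod.swap ` S)" 
    "\<And>a b. (a, b) \<in> prod.swap ` S \<Longrightarrow> \<exists>r>0. \<forall>x y. \<bar>x - a\<bar> < r \<longrightarrow> \<bar>y - b\<bar> < r \<longrightarrow>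
       ((\<lambda>x. (f \<circ> prod.swap) (x, y)) has_real_derivative g (x, y)) (at x)" by blast
  show ?thesis
  proof
    have "prod.swap ` prod.swap ` S = S" by (auto simp: image_iff)
    then show "real_analytic_on (g \<circ> prod.swap) S"
      using real_analytic_on_swap[OF g(1)] by simp
    show "\<exists>r>0. \<forall>x y. \<bar>x - a\<bar> < r \<longrightarrow> \<bar>y - b\<bar> < r \<longrightarrow>
       ((\<lambda>y. f (x, y)) has_real_derivative (g \<circ> prod.swap) (x, y)) (at y)" if "(a, b) \<in> S" for a b
    proof -
      from that have "(b, a) \<in> prod.swap ` S" by auto
      from g(2)[OF this] show ?thesis by auto
    qed
  qed
qed

lemma real_analytic_on_isCont:
  assumes "real_analytic_on f S" "(a, b) \<in> S"
  shows "isCont f (a, b)"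
proof -
  from assms obtain c r where r: "r > 0" and ser: "\<And>x y. \<bar>x - a\<bar> < r \<Longrightarrow> \<bar>y - b\<bar> < r \<Longrightarrow>
    ((\<lambda>(i, j). c i j * (x - a) ^ i * (y - b) ^ j) has_sum f (x, y)) UNIV"
    unfolding real_analytic_on_def by blast
  have maj: "(\<lambda>(i, j). \<bar>c i j\<bar> * (r/2) ^ i * (r/2) ^ j) summable_on UNIV"
    by (rule double_series_majorant[OF ser]) (use r in auto)
  have bd: "\<bar>fst z - a\<bar> \<le> r/2" "\<bar>snd z - b\<bar> \<le> r/2" if "z \<in> ball (a, b) (r/2)" for z
    using that norm_fst_le[of "fst z - a" "snd z - b"] norm_snd_le[of "snd z - b" "fst z - a"]
    by (cases z; auto simp: dist_commute dist_norm)+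
  have "uniform_limit (ball (a, b) (r/2))
      (\<lambda>F z. \<Sum>(i, j)\<in>F. of_real (c i j) * (fst z - a) ^ i * (snd z - b) ^ j)
      (\<lambda>z. \<Sum>\<^sub>\<infinity>(i, j). of_real (c i j) * (fst z - a) ^ i * (snd z - b) ^ j) (finite_subsets_at_top UNIV)"
    by (rule double_series_uniform_limit[OF maj]) (use bd in auto)
  then have "continuous_on (ball (a, b) (r/2))
      (\<lambda>z. \<Sum>\<^sub>\<infinity>(i, j). of_real (c i j) * (fst z - a) ^ i * (snd z - b) ^ j)"
    by (rule uniform_limit_theorem[rotated])
      (auto simp: case_prod_unfold intro!: continuous_intros always_eventually)
  then have "continuous_on (ball (a, b) (r/2)) f"
  proof (rule continuous_on_eq)
    fix z assume "z \<in> ball (a, b) (r/2)"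
    from bd[OF this] ser[of "fst z" "snd z"] r 
    show "(\<Sum>\<^sub>\<infinity>(i, j). of_real (c i j) * (fst z - a) ^ i * (snd z - b) ^ j) = f z"
      by (auto intro!: infsumI)
  qed
  then show ?thesis using r by (simp add: continuous_on_eq_continuous_at)
qed

text \<open>The partial derivatives are analytic, hence continuous, so they make up the total derivative.\<close>

lemma real_analytic_on_gradient:
  assumes f: "real_analytic_on f S"
  obtains g1 g2 where "real_analytic_on g1 S" "real_analytic_on g2 S"
    "\<And>z. z \<in> S \<Longrightarrow> (f has_derivative (\<lambda>w. g1 z * fst w + g2 z * snd w)) (at z)"
proof -
  obtain g1 where g1: "real_analytic_on g1 S"
    "\<And>a b. (a, b) \<in> S \<Longrightarrow> \<exists>r>0. \<forall>x y. \<bar>x - a\<bar> < r \<longrightarrow> \<bar>y - b\<bar> < r \<longrightarrow>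
       ((\<lambda>x. f (x, y)) has_real_derivative g1 (x, y)) (at x)"
    using real_analytic_on_partial1[OF f] by blast
  obtain g2 where g2: "real_analytic_on g2 S"
    "\<And>a b. (a, b) \<in> S \<Longrightarrow> \<exists>r>0. \<forall>x y. \<bar>x - a\<bar> < r \<longrightarrow> \<bar>y - b\<bar> < r \<longrightarrow>
       ((\<lambda>y. f (x, y)) has_real_derivative g2 (x, y)) (at y)"
    using real_analytic_on_partial2[OF f] by blast
  show ?thesis
  proof (rule that[OF g1(1) g2(1)])
    fix z assume "z \<in> S"
    obtain a b where z: "z = (a, b)" by (cases z)
    with \<open>z \<in> S\<close> have ab: "(a, b) \<in> S" by simp
    have r: "((\<lambda>x. f (x, b)) has_real_derivative g1 (a, b)) (at a)"
      using g1(2)[OF ab] by (metis abs_zero cancel_comm_monoid_add_class.diff_cancel)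
    from g2(2)[OF ab] obtain s where s: "s > 0"
      "\<And>x y. \<bar>x - a\<bar> < s \<Longrightarrow> \<bar>y - b\<bar> < s \<Longrightarrow> ((\<lambda>y. f (x, y)) has_real_derivative g2 (x, y)) (at y)"
      by blast
    have "((\<lambda>(x, y). f (x, y)) has_derivative
        (\<lambda>(tx, ty). g1 (a, b) * tx + blinfun_apply (blinfun_scaleR_left (g2 (a, b))) ty)) 
        (at (a, b) within ball a s \<times> ball b s)"
    proof (rule has_derivative_partialsI)
      show "((\<lambda>x. f (x, b)) has_derivative (*) (g1 (a, b))) (at a within ball a s)"
        using has_derivative_at_withinI[OF r[unfolded has_field_derivative_def]] .
      show "((\<lambda>y. f (x, y)) has_derivative
          blinfun_apply (blinfun_scaleR_left (g2 (x, y)))) (at y within ball b s)"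
        if "x \<in> ball a s" "y \<in> ball b s" for x y
      proof -
        have "((\<lambda>y. f (x, y)) has_real_derivative g2 (x, y)) (at y within ball b s)"
          by (rule has_field_derivative_at_within)
            (use s(2)[of x y] that in \<open>simp add: dist_real_def abs_minus_commute\<close>)
        moreover have "blinfun_apply (blinfun_scaleR_left (g2 (x, y))) = (*) (g2 (x, y))"
          by (auto simp: fun_eq_iff)
        ultimately show ?thesis by (simp add: has_field_derivative_def)
      qed
      have "isCont g2 (a, b)" by (rule real_analytic_on_isCont[OF g2(1) ab])
      then have "isCont (\<lambda>z. blinfun_scaleR_left (g2 z) :: real \<Rightarrow>\<^sub>L real) (a, b)"
        by (intro continuous_intros)
      from continuous_at_imp_continuous_at_within[OF this] show "continuous (at (a, b) within ball a s \<times> ball b s) (\<lambda>(x, y). blinfun_scaleR_left (g2 (x, y)))"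
        by (simp add: case_prod_unfold)
    qed (use s in auto)
    moreover have "at (a, b) within ball a s \<times> ball b s = at (a, b)"
      using s(1) by (intro at_within_open) (auto intro: open_Times)
    ultimately show "(f has_derivative (\<lambda>w. g1 z * fst w + g2 z * snd w)) (at z)"
      unfolding z by (simp add: case_prod_unfold mult.commute)
  qed
qed

section \<open>Plane geometry and limits\<close>

definition rot :: "real \<times> real \<Rightarrow> real \<times> real" where "rot z = (- snd z, fst z)"

lemma rot_inner: "rot z \<bullet> z = 0" "z \<bullet> rot z = 0"
  by (auto simp: rot_def inner_prod_def)

lemma rot_eq_0: "rot z = 0 \<longleftrightarrow> z = 0"
  by (cases z) (auto simp: rot_def zero_prod_def)

lemma inner_left_ext: "(\<And>w. u \<bullet> w = v \<bullet> w) \<Longrightarrow> u = (v :: 'a::real_inner)"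
  by (metis inner_diff_left inner_eq_zero_iff right_minus_eq)

lemma open_not_subset_line:
  fixes v :: "real \<times> real"
  assumes "open U" "U \<noteq> {}"
  shows "\<not> U \<subseteq> span {v}"
proof
  assume "U \<subseteq> span {v}"
  moreover have d: "dim (span {v}) \<le> 1"
    using dim_le_card[of "{v}" "{v}"] span_base[of v "{v}"] by (simp add: dim_span)
  have "interior (span {v}) = {}" using empty_interior_lowdim[of "span {v}"] d by simp
  ultimately show False using assms interior_maximal by blast
qed

lemma inner_rot_swap: "u \<bullet> rot v = - (v \<bullet> rot u)"
  by (simp add: rot_def inner_prod_def)

lemma orthogonal_imp_rot:
  fixes g u :: "real \<times> real"
  assumes "g \<noteq> 0" "g \<bullet> u = 0"
  obtains \<nu> where "u = \<nu> *\<^sub>R rot g"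
proof -
  obtain a b where g: "g = (a, b)" by (cases g)
  obtain x y where u: "u = (x, y)" by (cases u)
  have e: "a * x + b * y = 0" using assms(2) by (simp add: g u)
  have p: "a\<^sup>2 + b\<^sup>2 \<noteq> 0" using assms(1) by (simp add: g zero_prod_def sum_power2_eq_zero_iff)
  have "(a\<^sup>2 + b\<^sup>2) * x = (a * y - b * x) * (- b) + a * (a * x + b * y)"
    "(a\<^sup>2 + b\<^sup>2) * y = (a * y - b * x) * a + b * (a * x + b * y)"
    by (simp_all add: power2_eq_square algebra_simps)
  then have "(a\<^sup>2 + b\<^sup>2) * x = (a * y - b * x) * (- b)" "(a\<^sup>2 + b\<^sup>2) * y = (a * y - b * x) * a"
    unfolding e by simp_all
  then have e: "x * (a\<^sup>2 + b\<^sup>2) = (a * y - b * x) * (- b)" "y * (a\<^sup>2 + b\<^sup>2) = (a * y - b * x) * a"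
    by (simp_all only: mult.commute)
  have "x = ((a * y - b * x) / (a\<^sup>2 + b\<^sup>2)) * (- b)" "y = ((a * y - b * x) / (a\<^sup>2 + b\<^sup>2)) * a"
    unfolding times_divide_eq_left by (rule eq_divide_imp[OF p e(1)], rule eq_divide_imp[OF p e(2)])
  then show ?thesis by (intro that[of "(a * y - b * x) / (a\<^sup>2 + b\<^sup>2)"]) (simp add: u g rot_def)
qed

definition circ :: "real \<Rightarrow> real \<times> real" where "circ t = (cos t, sin t)"

lemma circ_nonzero [simp]: "circ t \<noteq> 0"
  by (auto simp: circ_def zero_prod_def) (metis sin_zero_norm_cos_one norm_zero zero_neq_one)

lemma circ_polar:
  assumes "v \<noteq> 0"
  obtains t where "0 \<le> t" "t < 2 * pi" "v = norm v *\<^sub>R circ t"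
proof -
  have "(fst v / norm v)\<^sup>2 + (snd v / norm v)\<^sup>2 = 1"
  proof -
    have "(norm v)\<^sup>2 = (fst v)\<^sup>2 + (snd v)\<^sup>2" by (cases v) (simp add: norm_Pair)
    moreover have "(norm v)\<^sup>2 \<noteq> 0" using assms by simp
    ultimately show ?thesis by (simp add: power_divide add_divide_distrib[symmetric])
  qed
  then obtain t where t: "0 \<le> t" "t < 2 * pi" "fst v / norm v = cos t" "snd v / norm v = sin t"
    by (rule sincos_total_2pi)
  have "norm v \<noteq> 0" using assms by simp
  then have "norm v * cos t = fst v" "norm v * sin t = snd v"
    unfolding t(3,4)[symmetric] by simp_all
  then have "v = norm v *\<^sub>R circ t" by (simp add: circ_def)
  with t(1,2) show ?thesis by (rule that)
qed

definition flip :: "real \<Rightarrow> real \<times> real \<Rightarrow> real \<times> real" where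
  "flip \<sigma> \<xi> = (fst \<xi>, \<sigma> * snd \<xi>)"

lemma linear_flip: "linear (flip \<sigma>)"
  by (rule linearI) (auto simp: flip_def algebra_simps)

lemma flip_flip: "\<bar>\<sigma>\<bar> = 1 \<Longrightarrow> flip \<sigma> (flip \<sigma> \<xi>) = \<xi>"
  by (cases \<xi>) (auto simp: flip_def abs_if split: if_splits)

lemma inj_flip: "\<bar>\<sigma>\<bar> = 1 \<Longrightarrow> inj (flip \<sigma>)"
  by (metis flip_flip injI)

lemma flip_1 [simp]: "flip 1 \<xi> = \<xi>"
  by (simp add: flip_def)

lemma interior_finite_Union_closed_empty:
  fixes F :: "'a::topological_space set set"
  assumes "finite F" "\<And>S. S \<in> F \<Longrightarrow> closed S" "\<And>S. S \<in> F \<Longrightarrow> interior S = {}"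
  shows "interior (\<Union>F) = {}"
  using assms
proof (induction F)
  case (insert S F)
  then have "interior (\<Union>F) = {}" "closed S" "interior S = {}" by auto
  then show ?case using interior_closed_Un_empty_interior[of S "\<Union>F"] by simp
qed simp

lemma segment_avoids_zero:
  fixes z w :: "'a::real_normed_vector"
  assumes "norm w < norm z" "0 \<le> s" "s \<le> 1"
  shows "z + s *\<^sub>R w \<noteq> 0"
proof
  assume "z + s *\<^sub>R w = 0"
  then have "norm z = s * norm w" using assms(2) by (simp add: eq_neg_iff_add_eq_0[symmetric])
  also have "\<dots> \<le> norm w" using assms(3) by (simp add: mult_left_le_one_le assms(2))
  finally show False using assms(1) by simp
qed

text \<open>The intermediate points supplied by mean value theorems come without any continuity in \<open>n\<close>;
  this is how their limits are found.\<close>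

lemma segment_point_tendsto:
  fixes z w :: "nat \<Rightarrow> 'a::real_normed_vector"
  assumes "z \<longlonglongrightarrow> z0" "w \<longlonglongrightarrow> 0" "\<And>n. 0 \<le> s n \<and> s n \<le> (1 :: real)"
  shows "(\<lambda>n. z n + s n *\<^sub>R w n) \<longlonglongrightarrow> z0"
proof -
  have "(\<lambda>n. s n *\<^sub>R w n) \<longlonglongrightarrow> 0"
  proof (rule Lim_null_comparison)
    show "\<forall>\<^sub>F n in sequentially. norm (s n *\<^sub>R w n) \<le> norm (w n)"
      using assms(3) by (intro always_eventually) (auto simp: mult_left_le_one_le)
    show "(\<lambda>n. norm (w n)) \<longlonglongrightarrow> 0" using tendsto_norm_zero[OF assms(2)] .
  qed
  from tendsto_add[OF assms(1) this] show ?thesis by simp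
qed

lemma eventually_norm_less:
  fixes z w :: "nat \<Rightarrow> 'a::real_normed_vector"
  assumes "z \<longlonglongrightarrow> z0" "w \<longlonglongrightarrow> 0" "z0 \<noteq> 0"
  shows "\<forall>\<^sub>F n in sequentially. norm (w n) < norm (z n)"
proof -
  have "(\<lambda>n. norm (z n) - norm (w n)) \<longlonglongrightarrow> norm z0 - 0"
    by (intro tendsto_diff tendsto_norm assms(1) tendsto_norm_zero assms(2))
  then have "\<forall>\<^sub>F n in sequentially. 0 < norm (z n) - norm (w n)"
    by (rule order_tendstoD) (use assms(3) in simp)
  then show ?thesis by (rule eventually_mono) simp
qed

section \<open>Analytic norms on the coordinate plane\<close>

text \<open>A norm on the coordinate plane that is analytic away from the origin, together with its gradient
  and its second derivative. The latter two are parameters, since their values at the origin are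
  arbitrary.\<close>

locale analytic_plane_norm =
  fixes N :: "real \<times> real \<Rightarrow> real" and grad :: "real \<times> real \<Rightarrow> real \<times> real"
    and hess :: "real \<times> real \<Rightarrow> real \<times> real \<Rightarrow> real \<times> real"
  assumes triangle: "N (x + y) \<le> N x + N y"
    and scale: "N (r *\<^sub>R x) = \<bar>r\<bar> * N x"
    and definite: "N x = 0 \<Longrightarrow> x = 0"
    and analytic: "real_analytic_on N (UNIV - {0})"
    and grad_analytic: "real_analytic_on (\<lambda>z. fst (grad z)) (UNIV - {0})"
      "real_analytic_on (\<lambda>z. snd (grad z)) (UNIV - {0})"
    and grad: "z \<noteq> 0 \<Longrightarrow> (N has_derivative (\<lambda>w. grad z \<bullet> w)) (at z)"
    and hess: "z \<noteq> 0 \<Longrightarrow> (grad has_derivative hess z) (at z)"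
    and hess_cont: "z \<noteq> 0 \<Longrightarrow> isCont (\<lambda>p. hess (fst p) (snd p)) (z, w)"

lemma analytic_plane_norm_exists:
  fixes N :: "real \<times> real \<Rightarrow> real"
  assumes "\<And>x y. N (x + y) \<le> N x + N y" "\<And>r x. N (r *\<^sub>R x) = \<bar>r\<bar> * N x" "\<And>x. N x = 0 \<Longrightarrow> x = 0"
    and an: "real_analytic_on N (UNIV - {0})"
  obtains grad hess where "analytic_plane_norm N grad hess"
proof -
  define S where "S = UNIV - {0 :: real \<times> real}"
  obtain g1 g2 where g: "real_analytic_on g1 S" "real_analytic_on g2 S"
    "\<And>z. z \<in> S \<Longrightarrow> (N has_derivative (\<lambda>w. g1 z * fst w + g2 z * snd w)) (at z)"
    using real_analytic_on_gradient[OF an] unfolding S_def by blast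
  obtain h11 h12 where h1: "real_analytic_on h11 S" "real_analytic_on h12 S"
    "\<And>z. z \<in> S \<Longrightarrow> (g1 has_derivative (\<lambda>w. h11 z * fst w + h12 z * snd w)) (at z)"
    using real_analytic_on_gradient[OF g(1)] by blast
  obtain h21 h22 where h2: "real_analytic_on h21 S" "real_analytic_on h22 S"
    "\<And>z. z \<in> S \<Longrightarrow> (g2 has_derivative (\<lambda>w. h21 z * fst w + h22 z * snd w)) (at z)"
    using real_analytic_on_gradient[OF g(2)] by blast
  have cont: "isCont h z" if "real_analytic_on h S" "z \<in> S" for h :: "real \<times> real \<Rightarrow> real" and z
    using real_analytic_on_isCont[OF that(1), of "fst z" "snd z"] that(2) by simp
  define grad where "grad = (\<lambda>z. (g1 z, g2 z))"
  define hess where "hess = (\<lambda>z w. (h11 z * fst w + h12 z * snd w, h21 z * fst w + h22 z * snd w))"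
  have "analytic_plane_norm N grad hess"
  proof
    fix z w :: "real \<times> real" assume z: "z \<noteq> 0"
    then have zS: "z \<in> S" by (simp add: S_def)
    show "(N has_derivative (\<lambda>w. grad z \<bullet> w)) (at z)"
      using g(3)[OF zS] by (simp add: grad_def inner_prod_def)
    show "(grad has_derivative hess z) (at z)"
      unfolding grad_def hess_def by (intro has_derivative_Pair h1(3) h2(3) zS)
    have "isCont (\<lambda>p. h (fst p)) (z, w)" if "real_analytic_on h S" for h :: "real \<times> real \<Rightarrow> real"
      using cont[OF that zS] by (intro isCont_o2[of _ fst h]) auto
    then show "isCont (\<lambda>p. hess (fst p) (snd p)) (z, w)"
      unfolding hess_def using h1(1,2) h2(1,2) by (intro continuous_intros) auto
  qed (use assms g(1,2) in \<open>simp_all add: grad_def S_def\<close>)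
  then show ?thesis by (rule that)
qed

context analytic_plane_norm
begin

lemma N_zero [simp]: "N 0 = 0"
  using scale[of 0 0] by simp

lemma N_eq_0_iff [simp]: "N x = 0 \<longleftrightarrow> x = 0"
  by (metis N_zero definite)

lemma N_minus [simp]: "N (- x) = N x"
  using scale[of "-1" x] by simp

lemma N_minus_commute: "N (x - y) = N (y - x)"
  using N_minus[of "x - y"] by simp

lemma N_nonneg [simp]: "0 \<le> N x"
  using triangle[of x "- x"] by simp

lemma N_pos: "x \<noteq> 0 \<Longrightarrow> 0 < N x"
  using N_nonneg[of x] definite[of x] by linarith

lemma N_triangle_diff: "N x - N y \<le> N (x - y)"
  using triangle[of "x - y" y] by simp

lemma N_bound:
  obtains K where "K > 0" "\<And>z. N z \<le> K * norm z"
proof -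
  define K where "K = N (1, 0) + N (0, 1)"
  have "N z \<le> K * norm z" for z
  proof -
    have "z = fst z *\<^sub>R (1, 0) + snd z *\<^sub>R (0, 1)" by (cases z) simp
    then have "N z \<le> \<bar>fst z\<bar> * N (1, 0) + \<bar>snd z\<bar> * N (0, 1)"
      using triangle[of "fst z *\<^sub>R (1, 0)" "snd z *\<^sub>R (0, 1)"] scale by metis
    also have "\<dots> \<le> norm z * N (1, 0) + norm z * N (0, 1)"
      using norm_fst_le[of "fst z" "snd z"] norm_snd_le[of "snd z" "fst z"]
      by (intro add_mono mult_right_mono) auto
    finally show ?thesis by (simp add: K_def algebra_simps)
  qed
  moreover have "K > 0" unfolding K_def by (intro add_pos_pos N_pos) (auto simp: zero_prod_def)
  ultimately show ?thesis by (rule that[rotated])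
qed

lemma N_continuous_on: "continuous_on A N"
proof -
  obtain K where K: "K > 0" "\<And>z. N z \<le> K * norm z" by (rule N_bound) blast
  have "K-lipschitz_on A N"
  proof (rule lipschitz_onI)
    fix x y
    show "dist (N x) (N y) \<le> K * dist x y"
      using N_triangle_diff[of x y] N_triangle_diff[of y x] K(2)[of "x - y"] N_minus_commute[of x y]
      by (simp add: dist_real_def dist_norm abs_le_iff)
  qed (use K in simp)
  then show ?thesis by (rule lipschitz_on_continuous_on)
qed

lemma N_lower_bound:
  obtains M where "M > 0" "\<And>z. norm z \<le> M * N z"
proof -
  have "compact (sphere (0 :: real \<times> real) 1)" "sphere (0 :: real \<times> real) 1 \<noteq> {}"
    by (auto simp: intro!: exI[of _ "(1, 0)"])
  then obtain z0 where z0: "z0 \<in> sphere 0 1" "\<And>z. z \<in> sphere 0 1 \<Longrightarrow> N z0 \<le> N z"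
    using continuous_attains_inf[OF _ _ N_continuous_on] by metis
  have m: "N z0 > 0" using z0(1) by (intro N_pos) auto
  have "norm z \<le> (1 / N z0) * N z" for z
  proof (cases "z = 0")
    case False
    then have "(1 / norm z) *\<^sub>R z \<in> sphere 0 1" by simp
    from z0(2)[OF this] scale have "N z0 \<le> N z / norm z" by simp
    then show ?thesis using m False by (simp add: field_simps)
  qed simp
  then show ?thesis using m by (intro that[of "1 / N z0"]) auto
qed

lemma grad_chain:
  assumes "(f has_derivative f') (at x within A)" "f x \<noteq> 0"
  shows "((\<lambda>x. N (f x)) has_derivative (\<lambda>h. grad (f x) \<bullet> f' h)) (at x within A)"
  using has_derivative_compose[OF assms(1) grad[OF assms(2)]] .

lemma hess_chain:
  assumes "(f has_derivative f') (at x within A)" "f x \<noteq> 0"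
  shows "((\<lambda>x. grad (f x)) has_derivative (\<lambda>h. hess (f x) (f' h))) (at x within A)"
  using has_derivative_compose[OF assms(1) hess[OF assms(2)]] .

lemma isCont_grad: "z \<noteq> 0 \<Longrightarrow> isCont grad z"
  using hess has_derivative_continuous by blast

lemma linear_hess: "z \<noteq> 0 \<Longrightarrow> linear (hess z)"
  using hess[of z] has_derivative_linear by blast

lemma N_along_line:
  assumes "z + t *\<^sub>R w \<noteq> 0"
  shows "((\<lambda>t. N (z + t *\<^sub>R w)) has_real_derivative grad (z + t *\<^sub>R w) \<bullet> w) (at t)"
proof -
  have "((\<lambda>t. z + t *\<^sub>R w) has_derivative (\<lambda>h. h *\<^sub>R w)) (at t)"
    by (auto intro!: derivative_eq_intros)
  from grad_chain[OF this assms] show ?thesis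
    unfolding has_field_derivative_def by (rule has_derivative_eq_rhs) (auto simp: fun_eq_iff)
qed

lemma grad_scale:
  assumes "z \<noteq> 0" "c > 0"
  shows "grad (c *\<^sub>R z) = grad z"
proof -
  have "((\<lambda>z. c *\<^sub>R z) has_derivative (\<lambda>w. c *\<^sub>R w)) (at z)"
    by (auto intro!: derivative_eq_intros)
  from grad_chain[OF this] assms
  have "((\<lambda>z. N (c *\<^sub>R z)) has_derivative (\<lambda>w. grad (c *\<^sub>R z) \<bullet> (c *\<^sub>R w))) (at z)" by auto
  moreover have "((\<lambda>z. N (c *\<^sub>R z)) has_derivative (\<lambda>w. c * (grad z \<bullet> w))) (at z)"
    using assms unfolding scale by (auto intro!: derivative_eq_intros grad)
  ultimately have "(\<lambda>w. grad (c *\<^sub>R z) \<bullet> (c *\<^sub>R w)) = (\<lambda>w. c * (grad z \<bullet> w))"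
    by (rule has_derivative_unique)
  then have "grad (c *\<^sub>R z) \<bullet> w = grad z \<bullet> w" for w
    using assms(2) by (metis inner_scaleR_right mult_cancel_left less_irrefl)
  then show ?thesis by (rule inner_left_ext)
qed

lemma grad_minus:
  assumes "z \<noteq> 0"
  shows "grad (- z) = - grad z"
proof -
  have "((\<lambda>z. - z) has_derivative (\<lambda>w. - w)) (at z)"
    by (auto intro!: derivative_eq_intros)
  from grad_chain[OF this] assms
  have "(N has_derivative (\<lambda>w. grad (- z) \<bullet> (- w))) (at z)" by simp
  from has_derivative_unique[OF this grad[OF assms]]
  have "grad (- z) \<bullet> w = (- grad z) \<bullet> w" for w
    by (metis add.inverse_inverse inner_minus_left inner_minus_right)
  then show ?thesis by (rule inner_left_ext)
qed

lemma grad_self: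
  assumes "z \<noteq> 0"
  shows "grad z \<bullet> z = N z"
proof -
  have "((\<lambda>t. N (0 + t *\<^sub>R z)) has_real_derivative grad (0 + 1 *\<^sub>R z) \<bullet> z) (at 1)"
    by (rule N_along_line) (use assms in simp)
  moreover have "((\<lambda>t. N (0 + t *\<^sub>R z)) has_real_derivative N z) (at 1)"
  proof (rule has_field_derivative_transform_within[of "\<lambda>t. t * N z" _ _ _ 1])
    show "((\<lambda>t. t * N z) has_real_derivative N z) (at 1)"
      by (auto intro!: derivative_eq_intros)
  qed (auto simp: scale dist_real_def)
  ultimately show ?thesis using DERIV_unique by force
qed

text \<open>The triangle inequality bounds the difference quotients of \<open>N\<close> by \<open>N w\<close>.\<close>

lemma grad_le:
  assumes "z \<noteq> 0"
  shows "grad z \<bullet> w \<le> N w"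
proof (rule ccontr)
  assume "\<not> ?thesis"
  then have pos: "grad z \<bullet> w - N w > 0" by simp
  have "((\<lambda>t. N (z + t *\<^sub>R w)) has_real_derivative grad (z + 0 *\<^sub>R w) \<bullet> w) (at 0)"
    by (rule N_along_line) (use assms in simp)
  then have "((\<lambda>t. N (z + t *\<^sub>R w) - t * N w) has_real_derivative grad z \<bullet> w - N w) (at 0)"
    by (auto intro!: derivative_eq_intros)
  from DERIV_pos_inc_right[OF this pos] obtain d where "d > 0"
    "\<And>h. h > 0 \<Longrightarrow> h < d \<Longrightarrow> N z < N (z + h *\<^sub>R w) - h * N w" by auto
  from this(2)[of "d / 2"] \<open>d > 0\<close> triangle[of z "(d / 2) *\<^sub>R w"] show False by (simp add: scale)
qed

lemma grad_nonzero: "z \<noteq> 0 \<Longrightarrow> grad z \<noteq> 0"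
  using grad_self[of z] N_pos[of z] by auto

lemma N_analytic_along_line:
  assumes "\<And>t. z + t *\<^sub>R w \<noteq> 0"
  shows "real_analytic1 (\<lambda>t. N (z + t *\<^sub>R w))"
proof -
  have "real_analytic1 (\<lambda>t. N (fst z + t * fst w, snd z + t * snd w))"
  proof (rule real_analytic1_compose[OF analytic])
    show "(fst z + t * fst w, snd z + t * snd w) \<in> UNIV - {0}" for t
      using assms[of t] by (cases z; cases w) auto
  qed (intro real_analytic1_add real_analytic1_mult real_analytic1_const real_analytic1_ident)+
  moreover have "(fst z + t * fst w, snd z + t * snd w) = z + t *\<^sub>R w" for t
    by (cases z; cases w) auto
  ultimately show ?thesis by simp
qed

text \<open>Strict convexity. If \<open>grad z \<bullet> w = N w\<close> for independent \<open>z\<close> and \<open>w\<close>, the unit sphere contains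
  the segment between their normalisations. The norm is then constant on a segment of a line that
  misses the origin, hence, being analytic along the line, constant on the whole line; but a norm is
  unbounded on a line.\<close>

lemma grad_eq_N_imp_parallel:
  assumes "z \<noteq> 0" "w \<noteq> 0" "grad z \<bullet> w = N w"
  obtains c where "c > 0" "w = c *\<^sub>R z"
proof -
  have "\<exists>c. w = c *\<^sub>R z"
  proof (rule ccontr)
    assume np: "\<nexists>c. w = c *\<^sub>R z"
    define x where "x = (1 / N z) *\<^sub>R z"
    define y where "y = (1 / N w) *\<^sub>R w"
    have Npos: "N z > 0" "N w > 0" using assms N_pos by auto
    have xy: "N x = 1" "N y = 1" "grad z \<bullet> x = 1" "grad z \<bullet> y = 1"
      using Npos assms grad_self by (auto simp: x_def y_def scale)
    have line: "x + s *\<^sub>R (y - x) \<noteq> 0" for s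
    proof
      assume *: "x + s *\<^sub>R (y - x) = 0"
      then have "s *\<^sub>R y = (s - 1) *\<^sub>R x" by (simp add: algebra_simps add_eq_0_iff)
      moreover have "s \<noteq> 0" using * xy(1) by auto
      moreover have "w = N w *\<^sub>R ((1 / s) *\<^sub>R (s *\<^sub>R y))"
        using Npos \<open>s \<noteq> 0\<close> by (simp add: y_def)
      ultimately have "w = (N w * (1 / s) * (s - 1) * (1 / N z)) *\<^sub>R z"
        by (simp add: x_def)
      then show False using np by blast
    qed
    \<comment> \<open>The segment lies on the unit sphere: at most one by convexity, at least one by \<open>grad_le\<close>.\<close>
    have "N (x + s *\<^sub>R (y - x)) = 1" for s
    proof (rule real_analytic1_eq_on_interval[OF N_analytic_along_line[OF line] real_analytic1_const, of 0 1])
      fix t :: real assume t: "0 < t" "t < 1"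
      have "x + t *\<^sub>R (y - x) = (1 - t) *\<^sub>R x + t *\<^sub>R y" by (simp add: algebra_simps)
      then have "N (x + t *\<^sub>R (y - x)) \<le> 1"
        using triangle[of "(1 - t) *\<^sub>R x" "t *\<^sub>R y"] t xy by (simp add: scale)
      moreover have "1 \<le> N (x + t *\<^sub>R (y - x))"
        using grad_le[OF assms(1), of "x + t *\<^sub>R (y - x)"] xy by (simp add: inner_simps)
      ultimately show "N (x + t *\<^sub>R (y - x)) = 1" by simp
    qed simp
    moreover have "y - x \<noteq> 0"
    proof
      assume "y - x = 0"
      then have "N w *\<^sub>R y = N w *\<^sub>R x" by simp
      moreover have "N w *\<^sub>R y = w" using Npos by (simp add: y_def)
      ultimately have "w = (N w / N z) *\<^sub>R z" by (simp add: x_def)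
      then show False using np by blast
    qed
    then have "N (y - x) > 0" by (rule N_pos)
    moreover have "N ((3 / N (y - x)) *\<^sub>R (y - x)) \<le> N (x + (3 / N (y - x)) *\<^sub>R (y - x)) + N (- x)"
      using triangle[of "x + (3 / N (y - x)) *\<^sub>R (y - x)" "- x"] by simp
    ultimately show False using xy by (auto simp: scale split: if_splits)
  qed
  then obtain c where c: "w = c *\<^sub>R z" ..
  have "\<bar>c\<bar> * N z = c * N z" using assms(3) grad_self[OF assms(1)] unfolding c scale inner_scaleR_right by metis
  then have "\<bar>c\<bar> = c" using N_pos[OF assms(1)] by (metis less_irrefl mult_right_cancel)
  moreover have "c \<noteq> 0" using c assms(2) by auto
  ultimately show ?thesis using c by (intro that[of c]) auto
qed

text \<open>Any point can be joined to the open set \<open>U\<close> by a line that misses the origin, and along such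
  a line both sides are analytic.\<close>

lemma N_comp_linear_eq_everywhere:
  fixes f g :: "real \<times> real \<Rightarrow> real \<times> real"
  assumes f: "linear f" "inj f" and g: "linear g" "inj g"
    and U: "open U" "U \<noteq> {}" "\<And>u. u \<in> U \<Longrightarrow> N (f u) = N (g u)"
  shows "N (f v) = N (g v)"
proof (cases "v = 0")
  case True
  then show ?thesis using f(1) g(1) by (simp add: linear_0)
next
  case False
  have "\<not> U \<subseteq> span {v}" by (rule open_not_subset_line[OF U(1,2)])
  then obtain u where u: "u \<in> U" "u \<notin> span {v}" by blast
  obtain e where e: "e > 0" "ball u e \<subseteq> U" using U(1) u(1) open_contains_ball by blast
  have ne: "u + t *\<^sub>R (v - u) \<noteq> 0" for t
  proof
    assume *: "u + t *\<^sub>R (v - u) = 0"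
    then have eq: "(1 - t) *\<^sub>R u = (- t) *\<^sub>R v" by (simp add: algebra_simps add_eq_0_iff)
    show False
    proof (cases "t = 1")
      case True
      then show False using * False by simp
    next
      case False
      then have "u = ((- t) / (1 - t)) *\<^sub>R v"
        using arg_cong[OF eq, of "\<lambda>x. (1 / (1 - t)) *\<^sub>R x"] by simp
      then show False using u(2) by (metis span_base span_scale singletonI)
    qed
  qed
  have an: "real_analytic1 (\<lambda>t. N (h u + t *\<^sub>R h (v - u)))" if h: "linear h" "inj h" for h
  proof (rule N_analytic_along_line)
    fix t
    have "h u + t *\<^sub>R h (v - u) = h (u + t *\<^sub>R (v - u))"
      using h(1) by (simp add: linear_add linear_scale)
    moreover have "h (u + t *\<^sub>R (v - u)) \<noteq> h 0" using ne[of t] h(2) by (auto dest: injD)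
    ultimately show "h u + t *\<^sub>R h (v - u) \<noteq> 0" using linear_0[OF h(1)] by simp
  qed
  define \<delta> where "\<delta> = e / (1 + norm (v - u))"
  have \<delta>: "\<delta> > 0" using e(1) by (simp add: \<delta>_def add_pos_nonneg)
  have "N (f u + 1 *\<^sub>R f (v - u)) = N (g u + 1 *\<^sub>R g (v - u))"
  proof (rule real_analytic1_eq_on_interval[OF an[OF f] an[OF g] \<delta>])
    fix t assume t: "0 < t" "t < \<delta>"
    have "norm (t *\<^sub>R (v - u)) \<le> t * (1 + norm (v - u))" using t by (simp add: mult_left_mono)
    also have "\<dots> < e" using t(2) unfolding \<delta>_def
      by (metis add_pos_nonneg norm_ge_zero pos_less_divide_eq zero_less_one)
    finally have "u + t *\<^sub>R (v - u) \<in> ball u e" by (simp add: dist_norm)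
    then have "u + t *\<^sub>R (v - u) \<in> U" using e(2) by blast
    from U(3)[OF this] show "N (f u + t *\<^sub>R f (v - u)) = N (g u + t *\<^sub>R g (v - u))"
      using f(1) g(1) by (simp add: linear_add linear_scale)
  qed
  then show ?thesis using f(1) g(1) by (simp add: linear_diff)
qed

section \<open>Frames of conjugate directions\<close>

text \<open>The direction conjugate (Birkhoff orthogonal) to \<open>circ t\<close>: it spans the kernel of the
  derivative of \<open>N\<close> at \<open>circ t\<close>. Neither vector is scaled to \<open>N\<close>-norm one, because the gradient
  depends only on the direction.\<close>

definition conj_dir :: "real \<Rightarrow> real \<times> real" where "conj_dir t = rot (grad (circ t))"

text \<open>The inverse of the linear map with rows \<open>grad (circ t)\<close> and \<open>grad (conj_dir t)\<close>, by Cramer's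
  rule. The determinant of that map is \<open>grad (conj_dir t) \<bullet> conj_dir t = N (conj_dir t) > 0\<close>.\<close>

definition frame_inv :: "real \<Rightarrow> real \<times> real \<Rightarrow> real \<times> real" where
  "frame_inv t \<xi> = (1 / N (conj_dir t)) *\<^sub>R
     (snd \<xi> *\<^sub>R conj_dir t - fst \<xi> *\<^sub>R rot (grad (conj_dir t)))"

lemma conj_dir_nonzero [simp]: "conj_dir t \<noteq> 0"
  by (simp add: conj_dir_def rot_eq_0 grad_nonzero)

lemma frame_inv_inner:
  "grad (circ t) \<bullet> frame_inv t \<xi> = fst \<xi>" "grad (conj_dir t) \<bullet> frame_inv t \<xi> = snd \<xi>"
proof -
  have 1: "grad (conj_dir t) \<bullet> conj_dir t = N (conj_dir t)" by (rule grad_self) simp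
  have 2: "grad (circ t) \<bullet> conj_dir t = 0" by (simp add: conj_dir_def rot_inner)
  have 3: "grad (circ t) \<bullet> rot (grad (conj_dir t)) = - N (conj_dir t)"
    using 1 by (subst inner_rot_swap) (simp add: conj_dir_def)
  have N: "N (conj_dir t) \<noteq> 0" by simp
  show "grad (circ t) \<bullet> frame_inv t \<xi> = fst \<xi>"
    unfolding frame_inv_def inner_scaleR_right inner_diff_right 2 3 using N by (simp del: N_eq_0_iff)
  show "grad (conj_dir t) \<bullet> frame_inv t \<xi> = snd \<xi>"
    unfolding frame_inv_def inner_scaleR_right inner_diff_right 1 rot_inner using N by (simp del: N_eq_0_iff)
qed

lemma frame_unique:
  assumes "grad (circ t) \<bullet> u = grad (circ t) \<bullet> v" "grad (conj_dir t) \<bullet> u = grad (conj_dir t) \<bullet> v"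
  shows "u = v"
proof -
  define w where "w = u - v"
  have w: "grad (circ t) \<bullet> w = 0" "grad (conj_dir t) \<bullet> w = 0"
    using assms by (auto simp: w_def inner_diff_right)
  obtain a b where ab: "grad (circ t) = (a, b)" by (cases "grad (circ t)")
  obtain c d where cd: "grad (conj_dir t) = (c, d)" by (cases "grad (conj_dir t)")
  have "N (conj_dir t) = grad (conj_dir t) \<bullet> conj_dir t" by (simp add: grad_self)
  also have "\<dots> = (c, d) \<bullet> rot (a, b)" unfolding cd unfolding conj_dir_def ab ..
  also have "\<dots> = a * d - b * c" by (simp add: rot_def)
  finally have det: "a * d - b * c \<noteq> 0" by (metis N_eq_0_iff conj_dir_nonzero)
  obtain x y where xy: "w = (x, y)" by (cases w)
  have e: "a * x + b * y = 0" "c * x + d * y = 0" using w by (auto simp: ab cd xy)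
  have "(a * d - b * c) * x = d * (a * x + b * y) - b * (c * x + d * y)"
    "(a * d - b * c) * y = a * (c * x + d * y) - c * (a * x + b * y)" by (simp_all add: algebra_simps)
  then have "(a * d - b * c) * x = 0" "(a * d - b * c) * y = 0" unfolding e by simp_all
  then have "w = 0" using det xy by (simp add: zero_prod_def)
  then show ?thesis by (simp add: w_def)
qed

lemma frame_inv_unique:
  assumes "grad (circ t) \<bullet> u = fst \<xi>" "grad (conj_dir t) \<bullet> u = snd \<xi>"
  shows "u = frame_inv t \<xi>"
  by (rule frame_unique[of t]) (use assms in \<open>simp_all add: frame_inv_inner\<close>)

lemma linear_frame_inv: "linear (frame_inv t)"
  by (rule linearI; rule frame_inv_unique[symmetric]) (simp_all add: frame_inv_inner inner_add_right)

lemma inj_frame_inv: "inj (frame_inv t)"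
proof (rule injI)
  fix x y assume "frame_inv t x = frame_inv t y"
  then show "x = y" using frame_inv_inner[of t x] frame_inv_inner[of t y] by (metis prod_eqI)
qed

lemma frame_inv_eq_0 [simp]: "frame_inv t \<xi> = 0 \<longleftrightarrow> \<xi> = 0"
  by (metis inj_frame_inv injD linear_0 linear_frame_inv)

lemma real_analytic1_circ_grad:
  "real_analytic1 (\<lambda>t. fst (grad (circ t)))" "real_analytic1 (\<lambda>t. snd (grad (circ t)))"
proof -
  have "circ t \<in> UNIV - {0}" for t by simp
  then show "real_analytic1 (\<lambda>t. fst (grad (circ t)))" "real_analytic1 (\<lambda>t. snd (grad (circ t)))"
    unfolding circ_def
    by (auto intro!: real_analytic1_compose[OF grad_analytic(1)] real_analytic1_compose[OF grad_analytic(2)]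
        real_analytic1_cos real_analytic1_sin)
qed

lemma real_analytic1_conj_dir:
  "real_analytic1 (\<lambda>t. fst (conj_dir t))" "real_analytic1 (\<lambda>t. snd (conj_dir t))"
  unfolding conj_dir_def rot_def fst_conv snd_conv
  by (intro real_analytic1_minus real_analytic1_circ_grad)+

lemma real_analytic1_conj_dir_N: "real_analytic1 (\<lambda>t. N (conj_dir t))"
  using real_analytic1_compose[OF analytic real_analytic1_conj_dir] by simp

lemma real_analytic1_conj_dir_grad:
  "real_analytic1 (\<lambda>t. fst (grad (conj_dir t)))" "real_analytic1 (\<lambda>t. snd (grad (conj_dir t)))"
  using real_analytic1_compose[OF grad_analytic(1) real_analytic1_conj_dir]
    real_analytic1_compose[OF grad_analytic(2) real_analytic1_conj_dir] by simp_all

lemma real_analytic1_frame_inv: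
  "real_analytic1 (\<lambda>t. fst (frame_inv t \<xi>))" "real_analytic1 (\<lambda>t. snd (frame_inv t \<xi>))"
  unfolding frame_inv_def rot_def fst_scaleR snd_scaleR fst_diff snd_diff fst_conv snd_conv real_scaleR_def
  by (intro real_analytic1_mult real_analytic1_diff real_analytic1_minus real_analytic1_divide
      real_analytic1_const real_analytic1_conj_dir real_analytic1_conj_dir_grad real_analytic1_conj_dir_N,
      simp)+

text \<open>The frame is an explicit expression in \<open>N\<close>, its gradient, sine and cosine.\<close>

lemma real_analytic1_N_frame_inv: "real_analytic1 (\<lambda>t. N (frame_inv t \<xi>))"
proof (cases "\<xi> = 0")
  case True
  have "(\<lambda>t. N (frame_inv t \<xi>)) = (\<lambda>_. 0)"
    unfolding fun_eq_iff N_eq_0_iff frame_inv_eq_0 using True by simp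
  then show ?thesis using real_analytic1_const[of 0] by simp
next
  case False
  then show ?thesis using real_analytic1_compose[OF analytic real_analytic1_frame_inv[of \<xi>]] by simp
qed

end

section \<open>Norms with a transitive isometry group are Euclidean\<close>

text \<open>The triple \<open>(\<alpha>, \<beta>, \<gamma>)\<close> encodes the quadratic form \<open>\<alpha> x\<^sup>2 + 2 \<beta> x y + \<gamma> y\<^sup>2\<close>.\<close>

definition qform :: "real \<times> real \<times> real \<Rightarrow> real \<times> real \<Rightarrow> real" where
  "qform q z = fst q * (fst z)\<^sup>2 + 2 * fst (snd q) * (fst z * snd z) + snd (snd q) * (snd z)\<^sup>2"

definition qdet :: "real \<times> real \<times> real \<Rightarrow> real" where
  "qdet q = fst q * snd (snd q) - (fst (snd q))\<^sup>2"

lemma qform_compose_linear: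
  assumes "linear A"
  obtains d where "d \<ge> 0" "\<And>q. \<exists>q'. (\<forall>z. qform q' z = qform q (A z)) \<and> qdet q' = d * qdet q"
proof -
  obtain a c where ac: "A (1, 0) = (a, c)" by (cases "A (1, 0)")
  obtain b d where bd: "A (0, 1) = (b, d)" by (cases "A (0, 1)")
  have A: "A z = (fst z * a + snd z * b, fst z * c + snd z * d)" for z
  proof -
    have "z = fst z *\<^sub>R (1, 0) + snd z *\<^sub>R (0, 1)" by (cases z) simp
    then have "A z = A (fst z *\<^sub>R (1, 0) + snd z *\<^sub>R (0, 1))" by (rule arg_cong)
    also have "\<dots> = fst z *\<^sub>R A (1, 0) + snd z *\<^sub>R A (0, 1)"
      by (simp only: linear_add[OF assms] linear_scale[OF assms])
    finally show ?thesis by (simp add: ac bd)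
  qed
  have "\<exists>q'. (\<forall>z. qform q' z = qform q (A z)) \<and> qdet q' = (a * d - b * c)\<^sup>2 * qdet q" for q
  proof -
    obtain x y w where q: "q = (x, y, w)" by (cases q) auto
    define q' where "q' = (x * a\<^sup>2 + 2 * y * a * c + w * c\<^sup>2,
      x * a * b + y * (a * d + b * c) + w * c * d, x * b\<^sup>2 + 2 * y * b * d + w * d\<^sup>2)"
    have "qform q' z = qform q (A z)" for z
      unfolding qform_def A q q'_def by (simp add: algebra_simps power2_eq_square)
    moreover have "qdet q' = (a * d - b * c)\<^sup>2 * qdet q"
      unfolding qdet_def q q'_def by (simp add: algebra_simps power2_eq_square)
    ultimately show ?thesis by blast
  qed
  then show ?thesis by (intro that[of "(a * d - b * c)\<^sup>2"]) auto
qed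

text \<open>Strict concavity of the square root of the determinant on positive definite forms.\<close>

lemma qdet_midpoint_unique:
  assumes "qdet p = D" "qdet q = D" "D > 0" "qdet ((1/2) *\<^sub>R (p + q)) \<le> D"
    and "fst p \<ge> 0" "fst q \<ge> 0"
  shows "p = q"
proof -
  obtain p1 p2 p3 where p: "p = (p1, p2, p3)" by (cases p) auto
  obtain q1 q2 q3 where q: "q = (q1, q2, q3)" by (cases q) auto
  have dp: "p1 * p3 = D + p2\<^sup>2" and dq: "q1 * q3 = D + q2\<^sup>2"
    using assms(1,2) by (auto simp: qdet_def p q)
  have pos: "p1 > 0" "q1 > 0"
  proof -
    have "p1 * p3 > 0" "q1 * q3 > 0" unfolding dp dq using assms(3) by (simp_all add: add_pos_nonneg)
    moreover have "p1 \<ge> 0" "q1 \<ge> 0" using assms(5,6) by (simp_all add: p q)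
    ultimately show "p1 > 0" "q1 > 0" by (auto simp: zero_less_mult_iff)
  qed
  have "(p1 + q1) * (p3 + q3) - (p2 + q2)\<^sup>2 \<le> 4 * D"
  proof -
    have "qdet ((1/2) *\<^sub>R (p + q)) = ((p1 + q1) * (p3 + q3) - (p2 + q2)\<^sup>2) / 4"
      by (simp add: qdet_def p q power2_eq_square field_simps)
    then show ?thesis using assms(4) by simp
  qed
  then have mix: "p1 * q3 + q1 * p3 - 2 * p2 * q2 - 2 * D \<le> 0"
    using dp dq by (simp add: power2_eq_square algebra_simps)
  \<comment> \<open>Up to the positive factor \<open>p1 q1\<close>, the midpoint inequality bounds this sum of squares.\<close>
  have "D * (p1 - q1)\<^sup>2 + (p1 * q2 - q1 * p2)\<^sup>2 =
      p1\<^sup>2 * (D + q2\<^sup>2) + q1\<^sup>2 * (D + p2\<^sup>2) - 2 * p1 * q1 * p2 * q2 - 2 * D * p1 * q1"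
    by (simp add: power2_eq_square algebra_simps)
  also have "\<dots> = p1 * q1 * (p1 * q3 + q1 * p3 - 2 * p2 * q2 - 2 * D)"
    unfolding dp[symmetric] dq[symmetric] by (simp add: power2_eq_square algebra_simps)
  also have "\<dots> \<le> 0" using pos mix by (simp add: mult_nonneg_nonpos)
  finally have le: "D * (p1 - q1)\<^sup>2 + (p1 * q2 - q1 * p2)\<^sup>2 \<le> 0" .
  have "D * (p1 - q1)\<^sup>2 \<le> 0" using le zero_le_power2[of "p1 * q2 - q1 * p2"] by linarith
  then have e1: "p1 = q1" using assms(3) by (simp add: mult_le_0_iff)
  have "(p1 * q2 - q1 * p2)\<^sup>2 \<le> 0" using le e1 by simp
  then have e2: "p2 = q2" using e1 pos by simp
  have "p3 = q3" using dp dq e1 e2 pos by (metis less_irrefl mult_left_cancel)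
  then show ?thesis using e1 e2 by (simp add: p q)
qed

context analytic_plane_norm
begin

text \<open>Among the nonnegative quadratic forms below \<open>N\<^sup>2\<close> there is one of largest determinant; it is
  the Loewner ellipse, the ellipse of least area that contains the unit ball. It is unique, hence
  invariant under all linear isometries. The quotient of \<open>N\<^sup>2\<close> by this form is invariant as well, and
  is constant if the isometries are transitive on directions.\<close>

lemma transitive_isometries_imp_quadratic:
  assumes v0: "v0 \<noteq> 0"
    and trans: "\<And>v. v \<noteq> 0 \<Longrightarrow> \<exists>A c. linear A \<and> (\<forall>x. N (A x) = N x) \<and> c > 0 \<and> A v0 = c *\<^sub>R v"
  obtains q where "\<And>z. (N z)\<^sup>2 = qform q z"
proof -
  define S where "S = {q. \<forall>z. 0 \<le> qform q z \<and> qform q z \<le> (N z)\<^sup>2}"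
  have cq: "continuous_on A (\<lambda>q. qform q z)" "continuous_on A qdet" for A z
    unfolding qform_def qdet_def by (intro continuous_intros)+
  have "closed S"
    unfolding S_def by (intro closed_Collect_all closed_Collect_conj closed_Collect_le cq continuous_intros)
  moreover have "bounded S"
  proof -
    define K where "K = (N (1, 0))\<^sup>2 + (N (0, 1))\<^sup>2 + (N (1, 1))\<^sup>2"
    have "q \<in> cbox (0, - K, 0) (K, K, K)" if "q \<in> S" for q
    proof -
      have b: "0 \<le> qform q z" "qform q z \<le> (N z)\<^sup>2" for z using that unfolding S_def by blast+
      show ?thesis
        using b[of "(1, 0)"] b[of "(0, 1)"] b[of "(1, 1)"]
          zero_le_power2[of "N (1, 0)"] zero_le_power2[of "N (0, 1)"] zero_le_power2[of "N (1, 1)"]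
        by (cases q) (auto simp: qform_def K_def cbox_Pair_eq)
    qed
    then have "S \<subseteq> cbox (0, - K, 0) (K, K, K)" by blast
    then show ?thesis using bounded_cbox bounded_subset by blast
  qed
  ultimately have "compact S" by (simp add: compact_eq_bounded_closed)
  moreover have "0 \<in> S" by (auto simp: S_def qform_def)
  ultimately obtain q where q: "q \<in> S" "\<And>p. p \<in> S \<Longrightarrow> qdet p \<le> qdet q"
    using continuous_attains_sup[OF _ _ cq(2)] by (metis empty_iff)
  have D: "qdet q > 0"
  proof -
    obtain M where M: "M > 0" "\<And>z. norm z \<le> M * N z" by (rule N_lower_bound) blast
    define p where "p = (1 / M\<^sup>2, 0 :: real, 1 / M\<^sup>2)"
    have pz: "qform p z = (norm z / M)\<^sup>2" for z
      by (cases z) (simp add: p_def qform_def norm_Pair power_divide add_divide_distrib)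
    have "norm z / M \<le> N z" for z using M by (simp add: divide_le_eq mult.commute)
    then have "(norm z / M)\<^sup>2 \<le> (N z)\<^sup>2" for z using M(1) by (intro power_mono) auto
    then have "p \<in> S" unfolding S_def mem_Collect_eq pz by simp
    then have "qdet p \<le> qdet q" by (rule q(2))
    moreover have "qdet p > 0" using M(1) by (simp add: p_def qdet_def)
    ultimately show ?thesis by linarith
  qed
  have fstS: "fst p \<ge> 0" if "p \<in> S" for p
  proof -
    have "0 \<le> qform p (1, 0)" using that unfolding S_def by blast
    then show ?thesis by (simp add: qform_def)
  qed
  have inv: "qform q (A z) = qform q z" if A: "linear A" "\<And>x. N (A x) = N x" for A z
  proof -
    have "inj A"
      unfolding linear_injective_0[OF A(1)] using A(2) N_eq_0_iff by metis
    then obtain A' where A': "linear A'" "\<And>x. A' (A x) = x" "\<And>x. A (A' x) = x"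
      using linear_injective_isomorphism[OF A(1)] by blast
    have NA': "N (A' x) = N x" for x using A(2)[of "A' x"] A'(3) by simp
    have inS: "p' \<in> S" if "p \<in> S" "\<And>z. qform p' z = qform p (L z)" "\<And>x. N (L x) = N x"
      for p p' L
    proof -
      have "0 \<le> qform p (L z) \<and> qform p (L z) \<le> (N (L z))\<^sup>2" for z
        using that(1) unfolding S_def by blast
      then show ?thesis unfolding S_def mem_Collect_eq that(2,3) by blast
    qed
    obtain d where d: "d \<ge> 0" "\<And>q. \<exists>q'. (\<forall>z. qform q' z = qform q (A z)) \<and> qdet q' = d * qdet q"
      using qform_compose_linear[OF A(1)] by blast
    obtain d' where d': "d' \<ge> 0" "\<And>q. \<exists>q'. (\<forall>z. qform q' z = qform q (A' z)) \<and> qdet q' = d' * qdet q"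
      using qform_compose_linear[OF A'(1)] by blast
    obtain p where p: "\<And>z. qform p z = qform q (A z)" "qdet p = d * qdet q" using d(2) by blast
    obtain p' where p': "\<And>z. qform p' z = qform q (A' z)" "qdet p' = d' * qdet q" using d'(2) by blast
    obtain r where r: "\<And>z. qform r z = qform p (A' z)" "qdet r = d' * qdet p" using d'(2) by blast
    have pS: "p \<in> S" and p'S: "p' \<in> S" using inS q(1) p(1) p'(1) A(2) NA' by blast+
    have "qform r z = qform q z" for z using r(1) p(1) A'(3) by simp
    then have "r = q"
    proof -
      assume *: "\<And>z. qform r z = qform q z"
      show ?thesis using *[of "(1, 0)"] *[of "(0, 1)"] *[of "(1, 1)"]
        by (cases r; cases q) (auto simp: qform_def)
    qed
    \<comment> \<open>Both \<open>A\<close> and its inverse multiply determinants by a factor of at most one, by maximality, so the factor is one.\<close>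
    then have "qdet q = d' * qdet p" using r(2) by simp
    moreover have "d' \<le> 1" using q(2)[OF p'S] D p'(2) by simp
    moreover have "qdet p \<ge> 0" using p(2) d(1) D by simp
    ultimately have "qdet q \<le> qdet p" by (metis mult_left_le_one_le d'(1))
    then have eq: "qdet p = qdet q" using q(2)[OF pS] by simp
    have mid: "qform ((1/2) *\<^sub>R (p + q)) z = (qform p z + qform q z) / 2" for z
      by (simp add: qform_def algebra_simps add_divide_distrib)
    have "(1/2) *\<^sub>R (p + q) \<in> S"
      unfolding S_def mem_Collect_eq mid
    proof
      fix z
      have "0 \<le> qform p z" "qform p z \<le> (N z)\<^sup>2" "0 \<le> qform q z" "qform q z \<le> (N z)\<^sup>2"
        using pS q(1) unfolding S_def by blast+
      then show "0 \<le> (qform p z + qform q z) / 2 \<and> (qform p z + qform q z) / 2 \<le> (N z)\<^sup>2" by auto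
    qed
    then have "p = q"
      by (intro qdet_midpoint_unique[OF eq refl D] q(2) fstS pS q(1))
    then show ?thesis using p(1) by simp
  qed
  have pos: "qform q z > 0" if "z \<noteq> 0" for z
  proof -
    obtain a b c where abc: "q = (a, b, c)" by (cases q) auto
    have dd: "a * c - b\<^sup>2 > 0" using D by (simp add: abc qdet_def)
    have a: "a > 0" using fstS[OF q(1)] dd by (cases "a = 0") (auto simp: abc)
    have "a * qform q z = (a * fst z + b * snd z)\<^sup>2 + (a * c - b\<^sup>2) * (snd z)\<^sup>2"
      by (simp add: qform_def abc power2_eq_square algebra_simps)
    moreover have "\<dots> > 0"
    proof (cases "snd z = 0")
      case True
      then have "fst z \<noteq> 0" using that by (simp add: prod_eq_iff)
      then show ?thesis using True a by simp
    qed (use dd in \<open>simp add: add_nonneg_pos\<close>)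
    ultimately have "a * qform q z > 0" by presburger
    then show ?thesis using a by (simp add: zero_less_mult_iff)
  qed
  define \<kappa> where "\<kappa> = (N v0)\<^sup>2 / qform q v0"
  have "(N v)\<^sup>2 = \<kappa> * qform q v" for v
  proof (cases "v = 0")
    case True
    then show ?thesis by (simp add: qform_def)
  next
    case False
    from trans[OF this] obtain A c where A: "linear A" "\<And>x. N (A x) = N x" "c > 0" "A v0 = c *\<^sub>R v" by blast
    have "N v0 = c * N v" using A(2)[of v0] A(3,4) by (simp add: scale)
    moreover have "qform q v0 = c\<^sup>2 * qform q v"
      using inv[OF A(1,2), of v0] A(4) by (simp add: qform_def power2_eq_square algebra_simps)
    ultimately show ?thesis using A(3) pos[OF False] by (simp add: \<kappa>_def power_mult_distrib)
  qed
  then have "(N z)\<^sup>2 = qform (\<kappa> *\<^sub>R q) z" for z by (simp add: qform_def algebra_simps)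
  then show ?thesis by (rule that)
qed

section \<open>A frame that two lengths determine\<close>

definition frame :: "real \<Rightarrow> real \<times> real \<Rightarrow> real \<times> real" where
  "frame t u = (grad (circ t) \<bullet> u, grad (conj_dir t) \<bullet> u)"

lemma frame_inv_frame [simp]: "frame_inv t (frame t u) = u"
  by (rule frame_inv_unique[symmetric]) (auto simp: frame_def)

lemma linear_frame: "linear (frame t)"
  by (rule linearI) (auto simp: frame_def inner_add_right)

lemma frame_inv_cong: "circ s = circ t \<Longrightarrow> frame_inv s = frame_inv t"
  by (simp add: frame_inv_def conj_dir_def fun_eq_iff)

text \<open>If the norms in the frames did not depend on \<open>t\<close>, then \<open>frame_inv t \<circ> frame 0\<close> would be an
  isometry. It respects the first row of the frames, so by strict convexity it takes \<open>circ 0\<close> to a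
  multiple of \<open>circ t\<close>: the isometries would be transitive on directions.\<close>

lemma frame_norms_not_constant:
  assumes noneucl: "\<nexists>q. \<forall>z. (N z)\<^sup>2 = qform q z"
  shows "\<exists>\<xi> t. N (frame_inv t \<xi>) \<noteq> N (frame_inv 0 \<xi>)"
proof (rule ccontr)
  assume "\<not> ?thesis"
  then have const: "N (frame_inv t \<xi>) = N (frame_inv 0 \<xi>)" for t \<xi> by blast
  have "\<exists>A c. linear A \<and> (\<forall>x. N (A x) = N x) \<and> c > 0 \<and> A (circ 0) = c *\<^sub>R v" if v: "v \<noteq> 0" for v
  proof -
    obtain t where t: "v = norm v *\<^sub>R circ t" using circ_polar[OF v] by metis
    define A where "A = frame_inv t \<circ> frame 0"
    have iso: "N (A x) = N x" for x using const[of t "frame 0 x"] by (simp add: A_def)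
    have lin: "linear A" unfolding A_def by (intro linear_compose linear_frame linear_frame_inv)
    have "A (circ 0) \<noteq> 0" using iso[of "circ 0"] by (metis N_eq_0_iff circ_nonzero)
    moreover have "grad (circ t) \<bullet> A (circ 0) = N (A (circ 0))"
      unfolding iso by (simp add: A_def frame_inv_inner frame_def grad_self)
    ultimately obtain c where c: "c > 0" "A (circ 0) = c *\<^sub>R circ t"
      using grad_eq_N_imp_parallel[OF circ_nonzero] by metis
    have "A (circ 0) = (c / norm v) *\<^sub>R v" unfolding c(2) using v by (subst t) simp
    then show ?thesis using lin iso c(1) v by (metis divide_pos_pos zero_less_norm_iff)
  qed
  from transitive_isometries_imp_quadratic[OF circ_nonzero this] noneucl show False by metis
qed

lemma closed_N_comp_eq:
  assumes "linear f" "linear (g :: real \<times> real \<Rightarrow> real \<times> real)"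
  shows "closed {\<xi> :: real \<times> real. N (f \<xi>) = N (g \<xi>)}"
proof -
  have "continuous_on UNIV (\<lambda>\<xi>. N (h \<xi>))" if "linear h" for h :: "real \<times> real \<Rightarrow> real \<times> real"
    by (rule continuous_on_compose2[OF N_continuous_on[of UNIV] linear_continuous_on_compose])
      (use that in \<open>auto simp: linear_continuous_on linear_conv_bounded_linear\<close>)
  then show ?thesis using assms by (intro closed_Collect_eq) auto
qed

text \<open>The norms at \<open>t0\<close> of the solutions for \<open>\<xi>\<close> and \<open>\<eta>\<close> recur only at those \<open>t\<close> at which the
  norms of all solutions recur, so that passing from the frame at \<open>t0\<close> to the one at \<open>t\<close> is an
  isometry. The sign \<open>\<sigma>\<close> covers both orientations of the conjugate direction.\<close>

definition rigid_frame_point :: "real \<Rightarrow> real \<times> real \<Rightarrow> real \<times> real \<Rightarrow> bool" where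
  "rigid_frame_point t0 \<xi> \<eta> \<longleftrightarrow> (\<forall>t \<sigma> \<zeta>. \<bar>\<sigma>\<bar> = 1 \<longrightarrow>
     N (frame_inv t (flip \<sigma> \<xi>)) = N (frame_inv t0 \<xi>) \<longrightarrow>
     N (frame_inv t (flip \<sigma> \<eta>)) = N (frame_inv t0 \<eta>) \<longrightarrow>
     N (frame_inv t (flip \<sigma> \<zeta>)) = N (frame_inv t0 \<zeta>))"

text \<open>Choose \<open>\<xi>\<close> whose norm varies along the curve, in both orientations, then \<open>t0\<close> where its
  derivative is nonzero. By analyticity the norm at \<open>t0\<close> recurs finitely often, and \<open>\<eta>\<close> is chosen to
  exclude those recurrences that do not come from isometries.\<close>

lemma exists_rigid_frame_point:
  assumes noneucl: "\<nexists>q. \<forall>z. (N z)\<^sup>2 = qform q z"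
  obtains t0 \<xi> \<eta> D where "D \<noteq> 0" "((\<lambda>t. N (frame_inv t \<xi>)) has_real_derivative D) (at t0)"
    "rigid_frame_point t0 \<xi> \<eta>"
proof -
  define C where "C = {\<xi>. \<forall>t. N (frame_inv t \<xi>) = N (frame_inv 0 \<xi>)}"
  have "C \<noteq> UNIV" using frame_norms_not_constant[OF noneucl] by (auto simp: C_def)
  then have C: "\<not> U \<subseteq> C" if "open U" "U \<noteq> {}" for U
    using N_comp_linear_eq_everywhere[OF linear_frame_inv inj_frame_inv linear_frame_inv inj_frame_inv that]
    unfolding C_def by blast
  have "closed C" unfolding C_def
    by (intro closed_Collect_all closed_N_comp_eq linear_frame_inv)
  then have op: "open (- C)" by (simp add: open_Compl)
  have "continuous_on UNIV (flip (- 1))" by (simp add: linear_flip linear_continuous_on linear_conv_bounded_linear[symmetric])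
  then have "open (flip (- 1) -` (- C))" using op by (simp add: open_vimage)
  moreover have "flip (- 1) -` (- C) \<noteq> {}"
  proof -
    obtain \<xi> where "\<xi> \<notin> C" using \<open>C \<noteq> UNIV\<close> by blast
    then have "flip (- 1) \<xi> \<in> flip (- 1) -` (- C)" by (simp add: flip_flip)
    then show ?thesis by blast
  qed
  \<comment> \<open>The value of \<open>\<xi>\<close> has to work for both signs; each sign excludes a closed set without interior.\<close>
  ultimately obtain \<xi> where \<xi>: "flip (- 1) \<xi> \<notin> C" "\<xi> \<notin> C" using C by blast
  have \<xi>C: "flip \<sigma> \<xi> \<notin> C" if "\<bar>\<sigma>\<bar> = 1" for \<sigma>
    using that \<xi> by (auto simp: abs_if split: if_splits)
  have "\<exists>t0 D. D \<noteq> 0 \<and> ((\<lambda>t. N (frame_inv t \<xi>)) has_real_derivative D) (at t0)"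
  proof (rule ccontr)
    assume none: "\<not> ?thesis"
    have "((\<lambda>t. N (frame_inv t \<xi>)) has_real_derivative 0) (at t)" for t
      using real_analytic1_differentiable[OF real_analytic1_N_frame_inv, of \<xi> t] none by metis
    then have "N (frame_inv t \<xi>) = N (frame_inv 0 \<xi>)" for t
      using DERIV_isconst_all[of "\<lambda>t. N (frame_inv t \<xi>)" t 0] by blast
    then show False using \<xi>(2) by (simp add: C_def)
  qed
  then obtain t0 D where D: "D \<noteq> 0" "((\<lambda>t. N (frame_inv t \<xi>)) has_real_derivative D) (at t0)" by blast
  define Z where "Z = (\<lambda>\<sigma>. {t \<in> {0..2 * pi}. N (frame_inv t (flip \<sigma> \<xi>)) - N (frame_inv t0 \<xi>) = 0})"
  have finZ: "finite (Z \<sigma>)" if \<sigma>: "\<bar>\<sigma>\<bar> = 1" for \<sigma>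
  proof -
    obtain t1 where "N (frame_inv t1 (flip \<sigma> \<xi>)) \<noteq> N (frame_inv 0 (flip \<sigma> \<xi>))"
      using \<xi>C[OF \<sigma>] by (auto simp: C_def)
    then obtain s where "N (frame_inv s (flip \<sigma> \<xi>)) - N (frame_inv t0 \<xi>) \<noteq> 0" by (metis eq_iff_diff_eq_0)
    then show ?thesis unfolding Z_def
      by (rule real_analytic1_finite_zeros[rotated])
        (intro real_analytic1_diff real_analytic1_const real_analytic1_N_frame_inv)
  qed
  \<comment> \<open>For each of the finitely many remaining \<open>(t, \<sigma>)\<close> the vectors \<open>\<eta>\<close> that do not rule it out form a closed set, which has no interior unless it is everything.\<close>
  define B where "B = (\<lambda>(t, \<sigma>). {\<zeta>. N (frame_inv t (flip \<sigma> \<zeta>)) = N (frame_inv t0 \<zeta>)})"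
  define G where "G = {S \<in> B ` ((\<lambda>t. (t, 1)) ` Z 1 \<union> (\<lambda>t. (t, - 1)) ` Z (- 1)). S \<noteq> UNIV}"
  have "finite G" unfolding G_def using finZ[of 1] finZ[of "- 1"] by auto
  have GB: "\<exists>t \<sigma>. \<bar>\<sigma>\<bar> = 1 \<and> S = B (t, \<sigma>) \<and> S \<noteq> UNIV" if "S \<in> G" for S
    using that unfolding G_def by force
  have Gcl: "closed S" if "S \<in> G" for S
    using GB[OF that] closed_N_comp_eq[OF linear_compose[OF linear_flip linear_frame_inv] linear_frame_inv]
    unfolding B_def by (auto simp: o_def)
  have Gint: "interior S = {}" if "S \<in> G" for S
  proof (rule ccontr)
    assume ne: "interior S \<noteq> {}"
    obtain t \<sigma> where S: "\<bar>\<sigma>\<bar> = 1" "S = B (t, \<sigma>)" "S \<noteq> UNIV" using GB[OF \<open>S \<in> G\<close>] by blast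
    have "N ((frame_inv t \<circ> flip \<sigma>) \<zeta>) = N (frame_inv t0 \<zeta>)" for \<zeta>
    proof (rule N_comp_linear_eq_everywhere[OF _ _ linear_frame_inv inj_frame_inv open_interior ne])
      show "linear (frame_inv t \<circ> flip \<sigma>)" by (intro linear_compose linear_flip linear_frame_inv)
      show "inj (frame_inv t \<circ> flip \<sigma>)" by (intro inj_compose inj_frame_inv inj_flip S(1))
      fix u assume "u \<in> interior S"
      then have "u \<in> S" using interior_subset by blast
      then show "N ((frame_inv t \<circ> flip \<sigma>) u) = N (frame_inv t0 u)" by (simp add: S(2) B_def)
    qed
    then show False using S(3) by (auto simp: S(2) B_def)
  qed
  have "interior (\<Union>G) = {}" by (rule interior_finite_Union_closed_empty[OF \<open>finite G\<close> Gcl Gint])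
  then have "\<Union>G \<noteq> UNIV" by auto
  then obtain \<eta> where \<eta>: "\<eta> \<notin> \<Union>G" by blast
  have "rigid_frame_point t0 \<xi> \<eta>"
    unfolding rigid_frame_point_def
  proof (intro allI impI)
    fix t \<sigma> \<zeta> assume \<sigma>: "\<bar>\<sigma>\<bar> = 1" and 1: "N (frame_inv t (flip \<sigma> \<xi>)) = N (frame_inv t0 \<xi>)"
      and 2: "N (frame_inv t (flip \<sigma> \<eta>)) = N (frame_inv t0 \<eta>)"
    obtain s where s: "0 \<le> s" "s < 2 * pi" "circ t = norm (circ t) *\<^sub>R circ s"
      using circ_polar[OF circ_nonzero] by metis
    have "norm (circ t) = 1" by (simp add: circ_def norm_Pair)
    with s have "circ t = circ s" by simp
    then have fs: "frame_inv t = frame_inv s" by (rule frame_inv_cong)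
    have "s \<in> Z \<sigma>" using s 1 by (simp add: Z_def fs)
    then have "B (s, \<sigma>) \<in> B ` ((\<lambda>t. (t, 1)) ` Z 1 \<union> (\<lambda>t. (t, - 1)) ` Z (- 1))"
      using \<sigma> by (intro imageI) (auto simp: abs_if split: if_splits)
    moreover have "\<eta> \<in> B (s, \<sigma>)" using 2 by (simp add: B_def fs)
    ultimately have "B (s, \<sigma>) = UNIV" using \<eta> unfolding G_def by blast
    then have "\<zeta> \<in> B (s, \<sigma>)" by simp
    then show "N (frame_inv t (flip \<sigma> \<zeta>)) = N (frame_inv t0 \<zeta>)" by (simp add: B_def fs)
  qed
  with D show ?thesis by (rule that)
qed

lemma N_same_direction:
  assumes "v \<noteq> 0" "a > 0" "b > 0" "N (a *\<^sub>R v) = N (b *\<^sub>R v)"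
  shows "a *\<^sub>R v = b *\<^sub>R v"
proof -
  have "a * N v = b * N v" using assms by (simp add: scale)
  moreover have "N v \<noteq> 0" using assms(1) by simp
  ultimately show ?thesis by (metis mult_right_cancel)
qed

text \<open>The limit data determine \<open>c\<close> and \<open>b\<close> up to the parameter \<open>t\<close> and the sign \<open>\<sigma>\<close>, and \<open>d\<close> and \<open>e\<close>
  solve linear systems in that frame; the choice of \<open>\<xi>\<close> and \<open>\<eta>\<close> then says that passing from the frame
  at \<open>t0\<close> to the frame of \<open>(c, b)\<close> is an isometry \<open>A\<close>. That \<open>A\<close> takes \<open>c0\<close> and \<open>b0\<close> to \<open>c\<close> and \<open>b\<close>
  follows from strict convexity: \<open>A\<close> matches the rows of the frames, and each row attains the norm
  only in the direction of its own vector.\<close>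

lemma limit_rigid:
  fixes t0 \<xi> \<eta>
  defines "c0 \<equiv> circ t0" and "b0 \<equiv> conj_dir t0" and "d0 \<equiv> frame_inv t0 \<xi>" and "e0 \<equiv> frame_inv t0 \<eta>"
  assumes rigid: "rigid_frame_point t0 \<xi> \<eta>"
    and Nc: "N c = N c0" and Nb: "N b = N b0" and Nd: "N d = N d0" and Ne: "N e = N e0"
    and cb: "grad c \<bullet> b = grad c0 \<bullet> b0" and bd: "grad b \<bullet> d = grad b0 \<bullet> d0" and be: "grad b \<bullet> e = grad b0 \<bullet> e0"
    and cd: "grad c \<bullet> d = grad c0 \<bullet> d0" and ce: "grad c \<bullet> e = grad c0 \<bullet> e0"
  obtains A where "linear A" "\<And>x. N (A x) = N x" "A c0 = c" "A b0 = b" "A d0 = d" "A e0 = e"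
proof -
  have ne: "c0 \<noteq> 0" "b0 \<noteq> 0" by (simp_all add: c0_def b0_def)
  have ne': "c \<noteq> 0" "b \<noteq> 0" using ne Nc Nb by (metis N_eq_0_iff)+
  obtain t where t: "c = norm c *\<^sub>R circ t" using circ_polar[OF ne'(1)] by metis
  have gc: "grad c = grad (circ t)"
    using ne'(1) grad_scale[OF circ_nonzero, of "norm c" t] t by simp
  have "grad (circ t) \<bullet> b = 0"
    using cb by (simp add: gc c0_def b0_def conj_dir_def rot_inner)
  from orthogonal_imp_rot[OF grad_nonzero[OF circ_nonzero] this]
  obtain \<nu> where \<nu>: "b = \<nu> *\<^sub>R conj_dir t" unfolding conj_dir_def by blast
  then have "\<nu> \<noteq> 0" using ne'(2) by auto
  define \<sigma> where "\<sigma> = sgn \<nu>"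
  have \<sigma>: "\<bar>\<sigma>\<bar> = 1" "\<sigma> * \<sigma> = 1" using \<open>\<nu> \<noteq> 0\<close> by (auto simp: \<sigma>_def sgn_if)
  have gs: "grad (\<sigma> *\<^sub>R conj_dir t) = \<sigma> *\<^sub>R grad (conj_dir t)"
    using \<open>\<nu> \<noteq> 0\<close> by (auto simp: \<sigma>_def sgn_if grad_minus)
  have b\<sigma>: "b = \<bar>\<nu>\<bar> *\<^sub>R (\<sigma> *\<^sub>R conj_dir t)" using \<nu> by (simp add: \<sigma>_def abs_sgn mult.commute sgn_if)
  have s0: "\<sigma> *\<^sub>R conj_dir t \<noteq> 0" using \<sigma> by auto
  have gb: "grad b = \<sigma> *\<^sub>R grad (conj_dir t)"
    using b\<sigma> grad_scale[OF s0, of "\<bar>\<nu>\<bar>"] \<open>\<nu> \<noteq> 0\<close> gs by simp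
  have solve: "x = frame_inv t (flip \<sigma> \<zeta>)"
    if "grad c \<bullet> x = grad c0 \<bullet> frame_inv t0 \<zeta>" "grad b \<bullet> x = grad b0 \<bullet> frame_inv t0 \<zeta>" for x \<zeta>
  proof (rule frame_inv_unique)
    show "grad (circ t) \<bullet> x = fst (flip \<sigma> \<zeta>)"
      using that(1) by (simp add: gc c0_def frame_inv_inner flip_def)
    have "\<sigma> * (grad (conj_dir t) \<bullet> x) = snd \<zeta>"
      using that(2) by (simp add: gb b0_def frame_inv_inner)
    then have "\<sigma> * \<sigma> * (grad (conj_dir t) \<bullet> x) = \<sigma> * snd \<zeta>" by (simp add: mult.assoc)
    then show "grad (conj_dir t) \<bullet> x = snd (flip \<sigma> \<zeta>)" by (simp add: \<sigma>(2) flip_def)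
  qed
  have d: "d = frame_inv t (flip \<sigma> \<xi>)" and e: "e = frame_inv t (flip \<sigma> \<eta>)"
    using cd bd ce be by (auto intro!: solve simp: d0_def e0_def)
  have iso0: "N (frame_inv t (flip \<sigma> \<zeta>)) = N (frame_inv t0 \<zeta>)" for \<zeta>
    by (rule rigid[unfolded rigid_frame_point_def, rule_format, OF \<sigma>(1)]) (use Nd Ne in \<open>simp_all add: d e d0_def e0_def\<close>)
  define A where "A = (\<lambda>x. frame_inv t (flip \<sigma> (frame t0 x)))"
  have lin: "linear A"
    using linear_compose[OF linear_compose[OF linear_frame linear_flip] linear_frame_inv]
    unfolding A_def o_def .
  have iso: "N (A x) = N x" for x by (simp add: A_def iso0)
  have fr: "frame t0 (frame_inv t0 \<zeta>) = \<zeta>" for \<zeta>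
    by (simp add: frame_def frame_inv_inner)
  have Ane: "A c0 \<noteq> 0" "A b0 \<noteq> 0" using iso ne by (metis N_eq_0_iff)+
  have "grad (circ t) \<bullet> A c0 = N (A c0)"
    unfolding iso by (simp add: A_def frame_inv_inner flip_def frame_def c0_def grad_self)
  then obtain a where a: "a > 0" "A c0 = a *\<^sub>R circ t"
    using grad_eq_N_imp_parallel[OF circ_nonzero Ane(1)] by blast
  have "N (a *\<^sub>R circ t) = N (norm c *\<^sub>R circ t)"
    using iso[of c0] Nc unfolding a(2) using t by simp
  then have "a *\<^sub>R circ t = norm c *\<^sub>R circ t"
    by (intro N_same_direction) (use a(1) ne'(1) in auto)
  then have Ac: "A c0 = c" unfolding a(2) using t by (rule trans[OF _ sym])
  have "grad (\<sigma> *\<^sub>R conj_dir t) \<bullet> A b0 = \<sigma> * (\<sigma> * N b0)"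
    unfolding gs by (simp add: A_def frame_inv_inner flip_def frame_def b0_def grad_self)
  also have "\<dots> = N (A b0)" unfolding iso mult.assoc[symmetric] \<sigma>(2) by simp
  finally obtain a' where a': "a' > 0" "A b0 = a' *\<^sub>R (\<sigma> *\<^sub>R conj_dir t)"
    using grad_eq_N_imp_parallel[OF s0 Ane(2)] by blast
  have "N (a' *\<^sub>R (\<sigma> *\<^sub>R conj_dir t)) = N (\<bar>\<nu>\<bar> *\<^sub>R (\<sigma> *\<^sub>R conj_dir t))"
    using iso[of b0] Nb a'(2) b\<sigma> by metis
  then have Ab: "A b0 = b"
    using N_same_direction[OF s0 a'(1), of "\<bar>\<nu>\<bar>"] \<open>\<nu> \<noteq> 0\<close> a'(2) b\<sigma> by simp
  show ?thesis
    by (rule that[OF lin iso Ac Ab]) (simp_all add: A_def d0_def e0_def d e fr)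
qed

section \<open>Mean values and limits of length differences\<close>

lemma N_mean_value:
  assumes "norm w < norm z"
  obtains s where "0 < s" "s < 1" "N (z + w) - N z = grad (z + s *\<^sub>R w) \<bullet> w"
proof -
  have "((\<lambda>t. N (z + t *\<^sub>R w)) has_real_derivative grad (z + t *\<^sub>R w) \<bullet> w) (at t)"
    if "0 \<le> t" "t \<le> 1" for t
    by (rule N_along_line[OF segment_avoids_zero[OF assms that]])
  then have "\<exists>s>0. s < 1 \<and> N (z + 1 *\<^sub>R w) - N (z + 0 *\<^sub>R w) = (1 - 0) * (grad (z + s *\<^sub>R w) \<bullet> w)"
    by (intro MVT2) auto
  then show ?thesis using that by auto
qed

lemma grad_mean_value:
  assumes "norm w < norm z"
  obtains s where "0 < s" "s < 1" "(grad (z + w) - grad z) \<bullet> b = hess (z + s *\<^sub>R w) w \<bullet> b"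
proof -
  have "((\<lambda>t. grad (z + t *\<^sub>R w) \<bullet> b) has_real_derivative hess (z + t *\<^sub>R w) w \<bullet> b) (at t)"
    if "0 \<le> t" "t \<le> 1" for t
  proof -
    have ne: "z + t *\<^sub>R w \<noteq> 0" using segment_avoids_zero[OF assms that] .
    have "((\<lambda>t. z + t *\<^sub>R w) has_derivative (\<lambda>h. h *\<^sub>R w)) (at t)"
      by (auto intro!: derivative_eq_intros)
    from has_derivative_inner_left[OF hess_chain[OF this ne]]
    show ?thesis unfolding has_field_derivative_def
      by (rule has_derivative_eq_rhs)
        (auto simp: fun_eq_iff linear_scale[OF linear_hess[OF ne]])
  qed
  then have "\<exists>s>0. s < 1 \<and> grad (z + 1 *\<^sub>R w) \<bullet> b - grad (z + 0 *\<^sub>R w) \<bullet> b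
      = (1 - 0) * (hess (z + s *\<^sub>R w) w \<bullet> b)"
    by (intro MVT2) auto
  then show ?thesis using that by (auto simp: inner_diff_left)
qed

lemma grad_tendsto: "z \<longlonglongrightarrow> z0 \<Longrightarrow> z0 \<noteq> 0 \<Longrightarrow> (\<lambda>n. grad (z n)) \<longlonglongrightarrow> grad z0"
  using isCont_tendsto_compose[OF isCont_grad] by blast

lemma hess_tendsto:
  assumes "z \<longlonglongrightarrow> z0" "z0 \<noteq> 0" "w \<longlonglongrightarrow> w0"
  shows "(\<lambda>n. hess (z n) (w n)) \<longlonglongrightarrow> hess z0 w0"
  using isCont_tendsto_compose[OF hess_cont[OF assms(2)] tendsto_Pair[OF assms(1,3)]] by simp

lemma N_tendsto: "z \<longlonglongrightarrow> z0 \<Longrightarrow> (\<lambda>n. N (z n)) \<longlonglongrightarrow> N z0"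
  using N_continuous_on[of UNIV] isCont_tendsto_compose[of z0 N z sequentially]
  unfolding continuous_on_eq_continuous_at[OF open_UNIV] by blast

text \<open>By the mean value theorem the gradient at a point between \<open>c n\<close> and \<open>c' n\<close> annihilates their
  difference.\<close>

lemma equal_N_derivative:
  assumes "c \<longlonglongrightarrow> c0" "c' \<longlonglongrightarrow> c0" "c0 \<noteq> 0" "\<And>n. N (c' n) = N (c n)"
    and "(\<lambda>n. (c' n - c n) /\<^sub>R r n) \<longlonglongrightarrow> \<gamma>"
  shows "grad c0 \<bullet> \<gamma> = 0"
proof -
  have w: "(\<lambda>n. c' n - c n) \<longlonglongrightarrow> 0" using tendsto_diff[OF assms(2,1)] by simp
  have "\<exists>s. 0 \<le> s \<and> s \<le> 1 \<and> (norm (c' n - c n) < norm (c n) \<longrightarrow>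
      grad (c n + s *\<^sub>R (c' n - c n)) \<bullet> (c' n - c n) = 0)" for n
  proof (cases "norm (c' n - c n) < norm (c n)")
    case True
    from N_mean_value[OF this] show ?thesis using assms(4)[of n]
      by (metis add_diff_cancel_left' diff_add_cancel diff_self less_imp_le add.commute)
  qed (auto intro: exI[of _ 0])
  then obtain s where s: "\<And>n. 0 \<le> s n \<and> s n \<le> 1"
    "\<And>n. norm (c' n - c n) < norm (c n) \<Longrightarrow> grad (c n + s n *\<^sub>R (c' n - c n)) \<bullet> (c' n - c n) = 0"
    by metis
  have "(\<lambda>n. grad (c n + s n *\<^sub>R (c' n - c n)) \<bullet> ((c' n - c n) /\<^sub>R r n)) \<longlonglongrightarrow> grad c0 \<bullet> \<gamma>"
    by (intro tendsto_inner assms(5) grad_tendsto segment_point_tendsto[OF assms(1) w s(1)] assms(3))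
  moreover have "(\<lambda>n. grad (c n + s n *\<^sub>R (c' n - c n)) \<bullet> ((c' n - c n) /\<^sub>R r n)) \<longlonglongrightarrow> 0"
    by (rule tendsto_eventually, rule eventually_mono[OF eventually_norm_less[OF assms(1) w assms(3)]])
      (use s(2) in simp)
  ultimately show ?thesis by (rule LIMSEQ_unique)
qed

text \<open>To leading order, the distances of \<open>z\<close> from the origin and from the nearby point \<open>\<epsilon>w\<close> agree;
  the information about \<open>w\<close> is in the difference quotient.\<close>

definition slope :: "real \<Rightarrow> real \<times> real \<Rightarrow> real \<times> real \<Rightarrow> real" where
  "slope \<epsilon> z w = (N (z - \<epsilon> *\<^sub>R w) - N z) / \<epsilon>"

lemma slope_tendsto:
  assumes "z \<longlonglongrightarrow> z0" "z0 \<noteq> 0" "w \<longlonglongrightarrow> w0" "\<epsilon> \<longlonglongrightarrow> 0" "\<And>n. \<epsilon> n > 0"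
  shows "(\<lambda>n. slope (\<epsilon> n) (z n) (w n)) \<longlonglongrightarrow> - (grad z0 \<bullet> w0)"
proof -
  let ?v = "\<lambda>n. - (\<epsilon> n *\<^sub>R w n)"
  have v: "(\<lambda>n. ?v n) \<longlonglongrightarrow> 0"
    using tendsto_minus[OF tendsto_scaleR[OF assms(4,3)]] by simp
  have "\<exists>s. 0 \<le> s \<and> s \<le> 1 \<and> (norm (?v n) < norm (z n) \<longrightarrow>
      slope (\<epsilon> n) (z n) (w n) = - (grad (z n + s *\<^sub>R (?v n)) \<bullet> w n))" for n
  proof (cases "norm (?v n) < norm (z n)")
    case True
    from N_mean_value[OF this] obtain s where s: "0 < s" "s < 1"
      "N (z n + ?v n) - N (z n) = grad (z n + s *\<^sub>R (?v n)) \<bullet> (?v n)" by blast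
    then have "slope (\<epsilon> n) (z n) (w n) = - (grad (z n + s *\<^sub>R (?v n)) \<bullet> w n)"
      using assms(5)[of n] by (simp add: slope_def)
    then show ?thesis using s by (intro exI[of _ s]) auto
  qed (auto intro: exI[of _ 0])
  then obtain s where s: "\<And>n. 0 \<le> s n \<and> s n \<le> 1"
    "\<And>n. norm (?v n) < norm (z n) \<Longrightarrow>
      slope (\<epsilon> n) (z n) (w n) = - (grad (z n + s n *\<^sub>R (?v n)) \<bullet> w n)" by metis
  have lim: "(\<lambda>n. - (grad (z n + s n *\<^sub>R (?v n)) \<bullet> w n)) \<longlonglongrightarrow> - (grad z0 \<bullet> w0)"
    by (intro tendsto_minus tendsto_inner assms(3) grad_tendsto segment_point_tendsto[OF assms(1) v s(1)] assms(2))
  have "\<forall>\<^sub>F n in sequentially. - (grad (z n + s n *\<^sub>R (?v n)) \<bullet> w n) = slope (\<epsilon> n) (z n) (w n)"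
    by (rule eventually_mono[OF eventually_norm_less[OF assms(1) v assms(2)]]) (use s(2) in metis)
  from Lim_transform_eventually[OF lim this] show ?thesis .
qed

text \<open>Rolle's theorem for the difference of the two norms along the two segments. It trades equality
  of difference quotients for equality of directional derivatives, with no denominator left.\<close>

lemma equal_slope_mean_value:
  assumes "norm (\<epsilon> *\<^sub>R b) < norm c" "norm (\<epsilon> *\<^sub>R b') < norm c'" "\<epsilon> > 0"
    and "slope \<epsilon> c' b' = slope \<epsilon> c b"
  obtains s where "0 < s" "s < 1"
    "grad (c' + s *\<^sub>R (- (\<epsilon> *\<^sub>R b'))) \<bullet> b' = grad (c + s *\<^sub>R (- (\<epsilon> *\<^sub>R b))) \<bullet> b"
proof -
  let ?w = "- (\<epsilon> *\<^sub>R b)" and ?w' = "- (\<epsilon> *\<^sub>R b')"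
  define h where "h = (\<lambda>s. N (c' + s *\<^sub>R ?w') - N (c + s *\<^sub>R ?w))"
  define h' where "h' = (\<lambda>s. grad (c' + s *\<^sub>R ?w') \<bullet> ?w'
      - grad (c + s *\<^sub>R ?w) \<bullet> ?w)"
  have "(h has_real_derivative h' s) (at s)" if "0 \<le> s" "s \<le> 1" for s
    unfolding h_def h'_def
    by (intro DERIV_diff N_along_line segment_avoids_zero that) (use assms(1,2) in auto)
  then have "\<exists>s>0. s < 1 \<and> h 1 - h 0 = (1 - 0) * h' s" by (intro MVT2) auto
  then obtain s where s: "s > 0" "s < 1" "h 1 - h 0 = h' s" by auto
  have "h 1 - h 0 = \<epsilon> * slope \<epsilon> c' b' - \<epsilon> * slope \<epsilon> c b"
    using assms(3) by (simp add: h_def slope_def)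
  then have "h' s = 0" using s(3) assms(4) by simp
  then have "\<epsilon> * (grad (c' + s *\<^sub>R ?w') \<bullet> b') = \<epsilon> * (grad (c + s *\<^sub>R ?w) \<bullet> b)"
    by (auto simp: h'_def)
  then have "grad (c' + s *\<^sub>R ?w') \<bullet> b' = grad (c + s *\<^sub>R ?w) \<bullet> b"
    using assms(3) by (metis less_irrefl mult_left_cancel)
  with s(1,2) show ?thesis by (rule that)
qed

text \<open>The linearisation of \<open>grad c \<bullet> b\<close>, uniformly in \<open>\<epsilon>\<close>. Equality of slopes gives
  \<open>grad z' \<bullet> b' = grad z \<bullet> b\<close> at points \<open>z\<close> and \<open>z'\<close> near \<open>c0\<close>, and a second use of the mean value
  theorem turns the difference of the gradients into a value of the second derivative.\<close>

lemma equal_slope_derivative: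
  assumes c: "c \<longlonglongrightarrow> c0" "c' \<longlonglongrightarrow> c0" "c0 \<noteq> 0" and b: "b \<longlonglongrightarrow> b0" "b' \<longlonglongrightarrow> b0"
    and \<epsilon>: "\<epsilon> \<longlonglongrightarrow> 0" "\<And>n. \<epsilon> n > 0"
    and eq: "\<And>n. slope (\<epsilon> n) (c' n) (b' n) = slope (\<epsilon> n) (c n) (b n)"
    and \<gamma>: "(\<lambda>n. (c' n - c n) /\<^sub>R r n) \<longlonglongrightarrow> \<gamma>" and \<beta>: "(\<lambda>n. (b' n - b n) /\<^sub>R r n) \<longlonglongrightarrow> \<beta>"
  shows "grad c0 \<bullet> \<beta> + hess c0 \<gamma> \<bullet> b0 = 0"
proof -
  let ?v = "\<lambda>n. - (\<epsilon> n *\<^sub>R b n)" and ?v' = "\<lambda>n. - (\<epsilon> n *\<^sub>R b' n)"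
  have v: "(\<lambda>n. ?v n) \<longlonglongrightarrow> 0" "(\<lambda>n. ?v' n) \<longlonglongrightarrow> 0"
    using tendsto_minus[OF tendsto_scaleR[OF \<epsilon>(1) b(1)]] tendsto_minus[OF tendsto_scaleR[OF \<epsilon>(1) b(2)]]
    by simp_all
  have "\<exists>s. 0 \<le> s \<and> s \<le> 1 \<and> (norm (?v n) < norm (c n) \<longrightarrow> norm (?v' n) < norm (c' n) \<longrightarrow>
      grad (c' n + s *\<^sub>R (?v' n)) \<bullet> b' n = grad (c n + s *\<^sub>R (?v n)) \<bullet> b n)" for n
  proof (cases "norm (\<epsilon> n *\<^sub>R b n) < norm (c n) \<and> norm (\<epsilon> n *\<^sub>R b' n) < norm (c' n)")
    case True
    then show ?thesis using equal_slope_mean_value[OF _ _ \<epsilon>(2) eq, of n] by (metis less_imp_le)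
  qed (auto intro: exI[of _ 0])
  then obtain s where s: "\<And>n. 0 \<le> s n \<and> s n \<le> 1"
    "\<And>n. norm (?v n) < norm (c n) \<Longrightarrow> norm (?v' n) < norm (c' n) \<Longrightarrow>
      grad (c' n + s n *\<^sub>R (?v' n)) \<bullet> b' n = grad (c n + s n *\<^sub>R (?v n)) \<bullet> b n" by metis
  define z where "z = (\<lambda>n. c n + s n *\<^sub>R (?v n))"
  define z' where "z' = (\<lambda>n. c' n + s n *\<^sub>R (?v' n))"
  have z: "z \<longlonglongrightarrow> c0" "z' \<longlonglongrightarrow> c0" unfolding z_def z'_def
    by (intro segment_point_tendsto[OF c(1) v(1) s(1)] segment_point_tendsto[OF c(2) v(2) s(1)])+
  then have w: "(\<lambda>n. z' n - z n) \<longlonglongrightarrow> 0" using tendsto_diff[of z' c0 _ z c0] by simp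
  have "\<exists>\<tau>. 0 \<le> \<tau> \<and> \<tau> \<le> 1 \<and> (norm (z' n - z n) < norm (z n) \<longrightarrow>
      (grad (z' n) - grad (z n)) \<bullet> b n = hess (z n + \<tau> *\<^sub>R (z' n - z n)) (z' n - z n) \<bullet> b n)" for n
  proof (cases "norm (z' n - z n) < norm (z n)")
    case True
    from grad_mean_value[OF True, of "b n"] show ?thesis
      by (metis add_diff_cancel_left' diff_add_cancel less_imp_le add.commute)
  qed (auto intro: exI[of _ 0])
  then obtain \<tau> where \<tau>: "\<And>n. 0 \<le> \<tau> n \<and> \<tau> n \<le> 1"
    "\<And>n. norm (z' n - z n) < norm (z n) \<Longrightarrow>
      (grad (z' n) - grad (z n)) \<bullet> b n = hess (z n + \<tau> n *\<^sub>R (z' n - z n)) (z' n - z n) \<bullet> b n" by metis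
  define y where "y = (\<lambda>n. z n + \<tau> n *\<^sub>R (z' n - z n))"
  have y: "y \<longlonglongrightarrow> c0" unfolding y_def by (rule segment_point_tendsto[OF z(1) w \<tau>(1)])
  have u: "(\<lambda>n. (z' n - z n) /\<^sub>R r n) \<longlonglongrightarrow> \<gamma>"
  proof -
    have "(\<lambda>n. - (\<epsilon> n *\<^sub>R ((b' n - b n) /\<^sub>R r n))) \<longlonglongrightarrow> 0"
      using tendsto_minus[OF tendsto_scaleR[OF \<epsilon>(1) \<beta>]] by simp
    from segment_point_tendsto[OF \<gamma> this s(1)]
    have "(\<lambda>n. (c' n - c n) /\<^sub>R r n + s n *\<^sub>R - (\<epsilon> n *\<^sub>R ((b' n - b n) /\<^sub>R r n))) \<longlonglongrightarrow> \<gamma>" .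
    moreover have "(\<lambda>n. (c' n - c n) /\<^sub>R r n + s n *\<^sub>R - (\<epsilon> n *\<^sub>R ((b' n - b n) /\<^sub>R r n))) =
        (\<lambda>n. (z' n - z n) /\<^sub>R r n)"
      by (simp add: z_def z'_def fun_eq_iff algebra_simps)
    ultimately show ?thesis by simp
  qed
  have lim: "(\<lambda>n. grad (z' n) \<bullet> ((b' n - b n) /\<^sub>R r n) + hess (y n) ((z' n - z n) /\<^sub>R r n) \<bullet> b n)
      \<longlonglongrightarrow> grad c0 \<bullet> \<beta> + hess c0 \<gamma> \<bullet> b0"
    by (intro tendsto_add tendsto_inner grad_tendsto hess_tendsto z y u b \<beta> c(3))
  have ev: "\<forall>\<^sub>F n in sequentially. norm (?v n) < norm (c n) \<and> norm (?v' n) < norm (c' n) \<and>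
      norm (z' n - z n) < norm (z n) \<and> y n \<noteq> 0"
    by (intro eventually_conj eventually_norm_less[OF c(1) v(1) c(3)] eventually_norm_less[OF c(2) v(2) c(3)]
        eventually_norm_less[OF z(1) w c(3)] tendsto_imp_eventually_ne[OF y c(3)])
  have "(\<lambda>n. grad (z' n) \<bullet> ((b' n - b n) /\<^sub>R r n) + hess (y n) ((z' n - z n) /\<^sub>R r n) \<bullet> b n) \<longlonglongrightarrow> 0"
  proof (rule tendsto_eventually, rule eventually_mono[OF ev])
    fix n assume n: "norm (?v n) < norm (c n) \<and> norm (?v' n) < norm (c' n) \<and>
      norm (z' n - z n) < norm (z n) \<and> y n \<noteq> 0"
    have "grad (z' n) \<bullet> ((b' n - b n) /\<^sub>R r n) + hess (y n) ((z' n - z n) /\<^sub>R r n) \<bullet> b n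
      = (grad (z' n) \<bullet> (b' n - b n) + hess (y n) (z' n - z n) \<bullet> b n) /\<^sub>R r n"
      using linear_scale[OF linear_hess[of "y n"], of "inverse (r n)" "z' n - z n"] n
      by (simp only: inner_scaleR_left inner_scaleR_right distrib_left real_scaleR_def not_False_eq_True simp_thms)
    also have "hess (y n) (z' n - z n) \<bullet> b n = (grad (z' n) - grad (z n)) \<bullet> b n"
      using \<tau>(2) n by (simp add: y_def)
    also have "grad (z' n) \<bullet> (b' n - b n) + \<dots> = grad (z' n) \<bullet> b' n - grad (z n) \<bullet> b n"
      by (simp add: inner_diff_left inner_diff_right)
    also have "\<dots> = 0" using s(2)[of n] n by (simp add: z_def z'_def)
    finally show "grad (z' n) \<bullet> ((b' n - b n) /\<^sub>R r n) + hess (y n) ((z' n - z n) /\<^sub>R r n) \<bullet> b n = 0"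
      by simp
  qed
  from LIMSEQ_unique[OF lim this] show ?thesis .
qed

section \<open>Infinitesimal rigidity of the limit framework\<close>

text \<open>The gradient is constant along rays.\<close>

lemma hess_self:
  assumes "z \<noteq> 0"
  shows "hess z z = 0"
proof -
  have "((\<lambda>t. t *\<^sub>R z) has_derivative (\<lambda>h. h *\<^sub>R z)) (at 1)"
    by (auto intro!: derivative_eq_intros)
  from hess_chain[OF this] assms
  have d: "((\<lambda>t. grad (t *\<^sub>R z)) has_derivative (\<lambda>h. hess z (h *\<^sub>R z))) (at 1)" by simp
  have "((\<lambda>t. grad (t *\<^sub>R z)) has_derivative (\<lambda>h. 0)) (at 1)"
  proof (rule has_derivative_transform_within[of "\<lambda>_. grad z" _ _ _ 1])
    fix t :: real assume "dist t 1 < 1"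
    then have "t > 0" by (simp add: dist_real_def)
    then show "grad z = grad (t *\<^sub>R z)" using grad_scale[OF assms] by simp
  qed auto
  from has_derivative_unique[OF d this] have "hess z (1 *\<^sub>R z) = 0" by metis
  then show ?thesis by simp
qed

lemma frame_derivative_nonzero:
  assumes "D \<noteq> 0" "((\<lambda>t. N (frame_inv t \<xi>)) has_real_derivative D) (at t0)"
  shows "\<xi> \<noteq> 0"
proof
  assume "\<xi> = 0"
  then have "frame_inv t \<xi> = 0" for t by (simp only: frame_inv_eq_0)
  then have "(\<lambda>t. N (frame_inv t \<xi>)) = (\<lambda>_. 0)" by (simp only: N_zero)
  then have "((\<lambda>t. N (frame_inv t \<xi>)) has_real_derivative 0) (at t0)" by simp
  then show False using assms DERIV_unique by blast
qed

text \<open>The hypotheses are the equations of the limit problem linearised at the configuration of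
  parameter \<open>t0\<close>. The mixed equations say that, up to radial parts of \<open>\<gamma>\<close> and \<open>\<beta>\<close>, the motion is a
  multiple \<open>\<kappa>\<close> of the velocity of \<open>(circ t, conj_dir t, frame_inv t \<xi>)\<close> as \<open>t\<close> varies. The norm of
  the third point changes with speed \<open>\<kappa> D\<close>, so \<open>\<kappa> = 0\<close>, and the norms of the first two points
  exclude the radial parts.\<close>

lemma infinitesimally_rigid:
  fixes t0 \<xi> \<eta>
  defines "c0 \<equiv> circ t0" and "b0 \<equiv> conj_dir t0" and "d0 \<equiv> frame_inv t0 \<xi>" and "e0 \<equiv> frame_inv t0 \<eta>"
  assumes D: "D \<noteq> 0" "((\<lambda>t. N (frame_inv t \<xi>)) has_real_derivative D) (at t0)"
    and cc: "grad c0 \<bullet> \<gamma> = 0" and bb: "grad b0 \<bullet> \<beta> = 0" and dd: "grad d0 \<bullet> \<delta> = 0"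
    and cb: "grad c0 \<bullet> \<beta> + hess c0 \<gamma> \<bullet> b0 = 0"
    and bd: "grad b0 \<bullet> \<delta> + hess b0 \<beta> \<bullet> d0 = 0" and cd: "grad c0 \<bullet> \<delta> + hess c0 \<gamma> \<bullet> d0 = 0"
    and be: "grad b0 \<bullet> \<omega> + hess b0 \<beta> \<bullet> e0 = 0" and ce: "grad c0 \<bullet> \<omega> + hess c0 \<gamma> \<bullet> e0 = 0"
  shows "\<gamma> = 0" "\<beta> = 0" "\<delta> = 0" "\<omega> = 0"
proof -
  have ne: "c0 \<noteq> 0" "b0 \<noteq> 0" by (simp_all add: c0_def b0_def)
  have "\<xi> \<noteq> 0" by (rule frame_derivative_nonzero[OF D])
  then have d0: "d0 \<noteq> 0" by (simp add: d0_def)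
  define c' where "c' = rot c0"
  define m where "m = hess c0 c'"
  define k' where "k' = rot m"
  have circ': "(circ has_derivative (\<lambda>h. h *\<^sub>R c')) (at t0)"
    unfolding circ_def c'_def c0_def rot_def
    by (auto intro!: derivative_eq_intros simp: fun_eq_iff)
  have gc': "((\<lambda>t. grad (circ t)) has_derivative (\<lambda>h. h *\<^sub>R m)) (at t0)"
    using hess_chain[OF circ'] ne(1) unfolding m_def c0_def
    by (simp add: linear_scale[OF linear_hess])
  have lrot: "bounded_linear rot"
    unfolding linear_conv_bounded_linear[symmetric] by (rule linearI) (auto simp: rot_def)
  have kd: "(conj_dir has_derivative (\<lambda>h. h *\<^sub>R k')) (at t0)"
    using bounded_linear.has_derivative[OF lrot gc'] unfolding conj_dir_def k'_def
    by (simp add: linear_scale bounded_linear.linear[OF lrot])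
  have gk': "((\<lambda>t. grad (conj_dir t)) has_derivative (\<lambda>h. h *\<^sub>R hess b0 k')) (at t0)"
    using hess_chain[OF kd] ne(2) unfolding b0_def
    by (simp add: linear_scale[OF linear_hess])
  \<comment> \<open>The velocity \<open>d'\<close> of the third point; its equations are obtained by differentiating those of \<open>frame_inv_inner\<close>.\<close>
  obtain d1 where d1: "((\<lambda>t. fst (frame_inv t \<xi>)) has_real_derivative d1) (at t0)"
    using real_analytic1_differentiable[OF real_analytic1_frame_inv(1)] by blast
  obtain d2 where d2: "((\<lambda>t. snd (frame_inv t \<xi>)) has_real_derivative d2) (at t0)"
    using real_analytic1_differentiable[OF real_analytic1_frame_inv(2)] by blast
  define d' where "d' = (d1, d2)"
  have dd': "((\<lambda>t. frame_inv t \<xi>) has_derivative (\<lambda>h. h *\<^sub>R d')) (at t0)"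
    using has_derivative_Pair[OF d1[unfolded has_field_derivative_def] d2[unfolded has_field_derivative_def]]
    by (simp add: d'_def mult.commute)
  have "((\<lambda>t. N (frame_inv t \<xi>)) has_derivative (\<lambda>h. grad d0 \<bullet> (h *\<^sub>R d'))) (at t0)"
    using grad_chain[OF dd'] d0 by (simp add: d0_def)
  then have "((\<lambda>t. N (frame_inv t \<xi>)) has_real_derivative grad d0 \<bullet> d') (at t0)"
    unfolding has_field_derivative_def by (rule has_derivative_eq_rhs) auto
  then have Dd: "grad d0 \<bullet> d' = D" using D(2) DERIV_unique by blast
  have prod: "m0 \<bullet> d0 + g t0 \<bullet> d' = 0" if "(g has_derivative (\<lambda>h. h *\<^sub>R m0)) (at t0)"
    "\<And>t. g t \<bullet> frame_inv t \<xi> = k" for g m0 k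
  proof -
    have "((\<lambda>t. g t \<bullet> frame_inv t \<xi>) has_derivative (\<lambda>h. g t0 \<bullet> (h *\<^sub>R d') + (h *\<^sub>R m0) \<bullet> d0)) (at t0)"
      unfolding d0_def by (rule has_derivative_inner[OF that(1) dd'])
    moreover have "((\<lambda>t. g t \<bullet> frame_inv t \<xi>) has_derivative (\<lambda>h. 0)) (at t0)" by (simp add: that(2))
    ultimately have "(\<lambda>h. g t0 \<bullet> (h *\<^sub>R d') + (h *\<^sub>R m0) \<bullet> d0) = (\<lambda>h. 0)" by (rule has_derivative_unique)
    from fun_cong[OF this, of 1] show ?thesis by simp
  qed
  have p1: "m \<bullet> d0 + grad c0 \<bullet> d' = 0"
    using prod[OF gc' frame_inv_inner(1)] by (simp add: c0_def)
  have p2: "hess b0 k' \<bullet> d0 + grad b0 \<bullet> d' = 0"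
    using prod[OF gk' frame_inv_inner(2)] by (simp add: b0_def)
  have p3: "m \<bullet> b0 + grad c0 \<bullet> k' = 0"
    using inner_rot_swap[of m "grad c0"] by (simp add: b0_def c0_def k'_def conj_dir_def)
  \<comment> \<open>As \<open>c0\<close> is a unit vector, \<open>c'\<close> and \<open>c0\<close> are an orthonormal basis.\<close>
  define \<kappa> where "\<kappa> = \<gamma> \<bullet> c'"
  define \<mu> where "\<mu> = \<gamma> \<bullet> c0"
  have \<gamma>: "\<gamma> = \<kappa> *\<^sub>R c' + \<mu> *\<^sub>R c0"
  proof -
    obtain x y where xy: "\<gamma> = (x, y)" by (cases \<gamma>)
    have sc: "sin t0 * sin t0 + cos t0 * cos t0 = 1"
      using sin_cos_squared_add[of t0] by (simp add: power2_eq_square)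
    have "u * (cos t0 * cos t0) + u * (sin t0 * sin t0) = u" for u
      unfolding distrib_left[symmetric] using sc by (simp add: add.commute)
    then show ?thesis unfolding \<kappa>_def \<mu>_def c'_def c0_def circ_def rot_def xy
      by (simp add: algebra_simps)
  qed
  have h\<gamma>: "hess c0 \<gamma> = \<kappa> *\<^sub>R m"
    unfolding \<gamma> linear_add[OF linear_hess[OF ne(1)]] linear_scale[OF linear_hess[OF ne(1)]] hess_self[OF ne(1)]
    by (simp add: m_def)
  have "grad c0 \<bullet> (\<beta> - \<kappa> *\<^sub>R k') = 0"
  proof -
    have "grad c0 \<bullet> (\<beta> - \<kappa> *\<^sub>R k') = (grad c0 \<bullet> \<beta> + \<kappa> * (m \<bullet> b0)) - \<kappa> * (m \<bullet> b0 + grad c0 \<bullet> k')"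
      by (simp add: inner_diff_right algebra_simps)
    then show ?thesis using cb unfolding h\<gamma> p3 by simp
  qed
  from orthogonal_imp_rot[OF grad_nonzero[OF ne(1)] this] obtain \<nu> where "\<beta> - \<kappa> *\<^sub>R k' = \<nu> *\<^sub>R b0"
    unfolding b0_def conj_dir_def c0_def by blast
  then have \<beta>: "\<beta> = \<kappa> *\<^sub>R k' + \<nu> *\<^sub>R b0" by (simp add: algebra_simps)
  have h\<beta>: "hess b0 \<beta> = \<kappa> *\<^sub>R hess b0 k'"
    unfolding \<beta> linear_add[OF linear_hess[OF ne(2)]] linear_scale[OF linear_hess[OF ne(2)]] hess_self[OF ne(2)]
    by simp
  have \<delta>: "\<delta> = \<kappa> *\<^sub>R d'"
  proof (rule frame_unique[of t0])
    have "grad c0 \<bullet> \<delta> + \<kappa> * (m \<bullet> d0) = 0" using cd by (simp add: h\<gamma>)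
    moreover have "\<kappa> * (m \<bullet> d0) + \<kappa> * (grad c0 \<bullet> d') = 0" using p1 by (metis distrib_left mult_zero_right)
    ultimately show "grad (circ t0) \<bullet> \<delta> = grad (circ t0) \<bullet> (\<kappa> *\<^sub>R d')" by (simp add: c0_def)
    have "grad b0 \<bullet> \<delta> + \<kappa> * (hess b0 k' \<bullet> d0) = 0" using bd by (simp add: h\<beta>)
    moreover have "\<kappa> * (hess b0 k' \<bullet> d0) + \<kappa> * (grad b0 \<bullet> d') = 0" using p2 by (metis distrib_left mult_zero_right)
    ultimately show "grad (conj_dir t0) \<bullet> \<delta> = grad (conj_dir t0) \<bullet> (\<kappa> *\<^sub>R d')" by (simp add: b0_def)
  qed
  have \<kappa>: "\<kappa> = 0" using dd D(1) Dd by (simp add: \<delta>)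
  show "\<delta> = 0" by (simp add: \<delta> \<kappa>)
  have "\<nu> = 0" using bb ne(2) by (simp add: \<beta> \<kappa> grad_self)
  then show b: "\<beta> = 0" by (simp add: \<beta> \<kappa>)
  have "\<mu> = 0" using cc ne(1) by (simp add: \<gamma> \<kappa> grad_self)
  then show c: "\<gamma> = 0" using \<gamma> \<kappa> by simp
  show "\<omega> = 0"
    by (rule frame_unique[of t0])
      (use be ce ne in \<open>simp_all add: b c linear_0[OF linear_hess] c0_def b0_def\<close>)
qed

section \<open>Five points at widely separated scales\<close>

text \<open>The nine lengths of the configuration with points \<open>0, c, \<epsilon>b, \<epsilon>\<^sup>2d, \<epsilon>\<^sup>2e\<close>, combined and rescaled so
  that they have a nondegenerate limit as \<open>\<epsilon>\<close> tends to \<open>0\<close>.\<close>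

definition near_lengths where
  "near_lengths \<epsilon> = (\<lambda>(c, b, d, e). (N c, N b, N d, N e, slope \<epsilon> c b, slope \<epsilon> b d, slope \<epsilon> b e,
     slope (\<epsilon>\<^sup>2) c d, slope (\<epsilon>\<^sup>2) c e))"

definition map4 where
  "map4 A = (\<lambda>(c, b, d, e). (A c, A b, A d, A e))"

lemma slope_isometry:
  assumes "linear A" "\<And>x. N (A x) = N x"
  shows "slope \<epsilon> (A z) (A w) = slope \<epsilon> z w"
proof -
  have "A z - \<epsilon> *\<^sub>R A w = A (z - \<epsilon> *\<^sub>R w)" using assms(1) by (simp add: linear_diff linear_scale)
  then show ?thesis by (simp add: slope_def assms(2))
qed

lemma near_lengths_isometry:
  assumes "linear A" "\<And>x. N (A x) = N x"
  shows "near_lengths \<epsilon> (map4 A p) = near_lengths \<epsilon> p"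
  by (cases p) (simp add: near_lengths_def map4_def slope_isometry[OF assms] assms(2))

lemma linear_isometry_inverse:
  assumes "linear A" "\<And>x. N (A x) = N x"
  obtains A' where "linear A'" "\<And>x. N (A' x) = N x" "\<And>x. A' (A x) = x" "\<And>x. A (A' x) = x"
proof -
  have "inj A" unfolding linear_injective_0[OF assms(1)] using assms(2) N_eq_0_iff by metis
  then obtain A' where A': "linear A'" "\<And>x. A' (A x) = x" "\<And>x. A (A' x) = x"
    using linear_injective_isomorphism[OF assms(1)] by blast
  have "N (A' x) = N x" for x using assms(2)[of "A' x"] A'(3) by simp
  then show ?thesis using A' that by blast
qed

lemma bounded_if_same_N:
  assumes "z \<longlonglongrightarrow> z0" "\<And>n :: nat. N (w n) = N (z n)"
  shows "bounded (range w)"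
proof -
  obtain M where M: "M > 0" "\<And>z. norm z \<le> M * N z" by (rule N_lower_bound) blast
  have "convergent (\<lambda>n. N (z n))" using N_tendsto[OF assms(1)] by (rule convergentI)
  then obtain B where B: "\<And>n. norm (N (z n)) \<le> B"
    using Bseq_def convergent_imp_Bseq by metis
  have "norm (w n) \<le> M * B" for n
  proof -
    have "norm (w n) \<le> M * N (z n)" using M(2)[of "w n"] assms(2) by simp
    also have "\<dots> \<le> M * B" using B[of n] M(1) by (intro mult_left_mono) auto
    finally show ?thesis .
  qed
  then show ?thesis by (auto intro!: boundedI[of _ "M * B"])
qed

text \<open>Otherwise the normalised differences of \<open>Q n\<close> and \<open>P n\<close> would subconverge to an infinitesimal
  motion of norm one.\<close>

lemma near_lengths_locally_injective:
  fixes t0 \<xi> \<eta>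
  defines "p0 \<equiv> (circ t0, conj_dir t0, frame_inv t0 \<xi>, frame_inv t0 \<eta>)"
  assumes D: "D \<noteq> 0" "((\<lambda>t. N (frame_inv t \<xi>)) has_real_derivative D) (at t0)"
    and P: "P \<longlonglongrightarrow> p0" and Q: "Q \<longlonglongrightarrow> p0"
    and \<epsilon>: "\<epsilon> \<longlonglongrightarrow> 0" "\<And>n :: nat. \<epsilon> n > 0"
    and lens: "\<And>n. near_lengths (\<epsilon> n) (Q n) = near_lengths (\<epsilon> n) (P n)"
  shows "\<exists>n. Q n = P n"
proof (rule ccontr)
  assume "\<not> ?thesis"
  then have ne: "Q n - P n \<noteq> 0" for n by simp
  define u where "u = (\<lambda>n. (Q n - P n) /\<^sub>R norm (Q n - P n))"
  have nu: "norm (u n) = 1" for n using ne[of n] by (simp add: u_def)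
  then have "bounded (range u)" by (auto intro!: boundedI[of _ 1])
  then obtain l r where r: "strict_mono r" "(u \<circ> r) \<longlonglongrightarrow> l"
    using bounded_imp_convergent_subsequence by blast
  have "(\<lambda>n. norm ((u \<circ> r) n)) \<longlonglongrightarrow> norm l" by (rule tendsto_norm[OF r(2)])
  then have "norm l = 1" by (simp add: nu LIMSEQ_const_iff)
  define \<rho> where "\<rho> = (\<lambda>n. norm (Q (r n) - P (r n)))"
  obtain \<gamma> \<beta> \<delta> \<omega> where l: "l = (\<gamma>, \<beta>, \<delta>, \<omega>)" by (cases l) auto
  define c b d e where "c = (\<lambda>n. fst (P (r n)))" "b = (\<lambda>n. fst (snd (P (r n))))"
    "d = (\<lambda>n. fst (snd (snd (P (r n)))))" "e = (\<lambda>n. snd (snd (snd (P (r n)))))"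
  note cbde = this
  define c' b' d' e' where "c' = (\<lambda>n. fst (Q (r n)))" "b' = (\<lambda>n. fst (snd (Q (r n))))"
    "d' = (\<lambda>n. fst (snd (snd (Q (r n)))))" "e' = (\<lambda>n. snd (snd (snd (Q (r n)))))"
  note cbde' = this
  have Pr: "(\<lambda>n. P (r n)) \<longlonglongrightarrow> p0" and Qr: "(\<lambda>n. Q (r n)) \<longlonglongrightarrow> p0"
    and \<epsilon>r: "(\<lambda>n. \<epsilon> (r n)) \<longlonglongrightarrow> 0"
    using LIMSEQ_subseq_LIMSEQ[OF P r(1)] LIMSEQ_subseq_LIMSEQ[OF Q r(1)] LIMSEQ_subseq_LIMSEQ[OF \<epsilon>(1) r(1)]
    by (simp_all add: o_def)
  have \<epsilon>2: "(\<lambda>n. (\<epsilon> (r n))\<^sup>2) \<longlonglongrightarrow> 0" using tendsto_power[OF \<epsilon>r, of 2] by simp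
  have pos: "\<epsilon> (r n) > 0" "(\<epsilon> (r n))\<^sup>2 > 0" for n using \<epsilon>(2)[of "r n"] by auto
  note comps = tendsto_fst tendsto_snd tendsto_fst[OF tendsto_snd]
    tendsto_fst[OF tendsto_snd[OF tendsto_snd]] tendsto_snd[OF tendsto_snd[OF tendsto_snd]]
  have lim: "c \<longlonglongrightarrow> circ t0" "b \<longlonglongrightarrow> conj_dir t0" "d \<longlonglongrightarrow> frame_inv t0 \<xi>" "e \<longlonglongrightarrow> frame_inv t0 \<eta>"
    using comps[OF Pr] by (simp_all add: p0_def cbde)
  have lim': "c' \<longlonglongrightarrow> circ t0" "b' \<longlonglongrightarrow> conj_dir t0" "d' \<longlonglongrightarrow> frame_inv t0 \<xi>" "e' \<longlonglongrightarrow> frame_inv t0 \<eta>"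
    using comps[OF Qr] by (simp_all add: p0_def cbde')
  have dir: "(\<lambda>n. (c' n - c n) /\<^sub>R \<rho> n) \<longlonglongrightarrow> \<gamma>" "(\<lambda>n. (b' n - b n) /\<^sub>R \<rho> n) \<longlonglongrightarrow> \<beta>"
    "(\<lambda>n. (d' n - d n) /\<^sub>R \<rho> n) \<longlonglongrightarrow> \<delta>" "(\<lambda>n. (e' n - e n) /\<^sub>R \<rho> n) \<longlonglongrightarrow> \<omega>"
    using comps[OF r(2)] by (simp_all add: l u_def \<rho>_def cbde cbde' o_def)
  have eqs: "N (c' n) = N (c n)" "N (b' n) = N (b n)" "N (d' n) = N (d n)" 
    "slope (\<epsilon> (r n)) (c' n) (b' n) = slope (\<epsilon> (r n)) (c n) (b n)"
    "slope (\<epsilon> (r n)) (b' n) (d' n) = slope (\<epsilon> (r n)) (b n) (d n)"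
    "slope (\<epsilon> (r n)) (b' n) (e' n) = slope (\<epsilon> (r n)) (b n) (e n)"
    "slope ((\<epsilon> (r n))\<^sup>2) (c' n) (d' n) = slope ((\<epsilon> (r n))\<^sup>2) (c n) (d n)"
    "slope ((\<epsilon> (r n))\<^sup>2) (c' n) (e' n) = slope ((\<epsilon> (r n))\<^sup>2) (c n) (e n)" for n
    using lens[of "r n"] by (auto simp: near_lengths_def cbde cbde' case_prod_unfold)
  have d0: "frame_inv t0 \<xi> \<noteq> 0" using frame_derivative_nonzero[OF D] by simp
  have "\<gamma> = 0" "\<beta> = 0" "\<delta> = 0" "\<omega> = 0"
  proof -
    note inf = infinitesimally_rigid[OF D, of \<gamma> \<beta> \<delta> \<omega> \<eta>]
    note conds = equal_N_derivative[OF lim(1) lim'(1) circ_nonzero eqs(1) dir(1)]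
      equal_N_derivative[OF lim(2) lim'(2) conj_dir_nonzero eqs(2) dir(2)]
      equal_N_derivative[OF lim(3) lim'(3) d0 eqs(3) dir(3)]
      equal_slope_derivative[OF lim(1) lim'(1) circ_nonzero lim(2) lim'(2) \<epsilon>r pos(1) eqs(4) dir(1,2)]
      equal_slope_derivative[OF lim(2) lim'(2) conj_dir_nonzero lim(3) lim'(3) \<epsilon>r pos(1) eqs(5) dir(2,3)]
      equal_slope_derivative[OF lim(1) lim'(1) circ_nonzero lim(3) lim'(3) \<epsilon>2 pos(2) eqs(7) dir(1,3)]
      equal_slope_derivative[OF lim(2) lim'(2) conj_dir_nonzero lim(4) lim'(4) \<epsilon>r pos(1) eqs(6) dir(2,4)]
      equal_slope_derivative[OF lim(1) lim'(1) circ_nonzero lim(4) lim'(4) \<epsilon>2 pos(2) eqs(8) dir(1,4)]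
    show "\<gamma> = 0" "\<beta> = 0" "\<delta> = 0" "\<omega> = 0" using inf[OF conds] by blast+
  qed
  then have "l = 0" by (simp add: l zero_prod_def)
  then show False using \<open>norm l = 1\<close> by simp
qed

text \<open>Counterexamples at \<open>\<epsilon> = 1/(n + 1)\<close> would form sequences \<open>P\<close>, tending to the limit configuration,
  and \<open>Q\<close>, bounded because the norms agree with those of \<open>P\<close>. A limit of \<open>Q\<close> has the same limit data,
  so it is the image of the limit configuration under an isometry; undoing this isometry contradicts
  local injectivity.\<close>

lemma near_rigid:
  assumes noneucl: "\<nexists>q. \<forall>z. (N z)\<^sup>2 = qform q z"
  obtains p0 \<epsilon> where "0 < \<epsilon>" "\<epsilon> \<le> 1"
    "\<And>p q. dist p p0 < \<epsilon> \<Longrightarrow> near_lengths \<epsilon> q = near_lengths \<epsilon> p \<Longrightarrow>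
       \<exists>A. linear A \<and> (\<forall>x. N (A x) = N x) \<and> q = map4 A p"
proof -
  let ?b = "\<lambda>p. fst (snd p)" and ?d = "\<lambda>p. fst (snd (snd p))" and ?e = "\<lambda>p. snd (snd (snd p))"
  obtain t0 \<xi> \<eta> D where D: "D \<noteq> 0" "((\<lambda>t. N (frame_inv t \<xi>)) has_real_derivative D) (at t0)"
    and rigid: "rigid_frame_point t0 \<xi> \<eta>"
    using exists_rigid_frame_point[OF noneucl] by metis
  define p0 where "p0 = (circ t0, conj_dir t0, frame_inv t0 \<xi>, frame_inv t0 \<eta>)"
  define bad where "bad = (\<lambda>\<epsilon> p q. dist p p0 < \<epsilon> \<and> near_lengths \<epsilon> q = near_lengths \<epsilon> p \<and>
       \<not> (\<exists>A. linear A \<and> (\<forall>x. N (A x) = N x) \<and> q = map4 A p))"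
  have "\<exists>n :: nat. \<forall>p q. \<not> bad (inverse (real (Suc n))) p q"
  proof (rule ccontr)
    assume "\<not> ?thesis"
    then obtain P Q where PQ: "\<And>n :: nat. bad (inverse (real (Suc n))) (P n) (Q n)" by metis
    define \<epsilon> where "\<epsilon> = (\<lambda>n. inverse (real (Suc n)))"
    have \<epsilon>: "\<epsilon> \<longlonglongrightarrow> 0" "\<And>n. \<epsilon> n > 0"
      using LIMSEQ_inverse_real_of_nat by (auto simp: \<epsilon>_def)
    have lens: "near_lengths (\<epsilon> n) (Q n) = near_lengths (\<epsilon> n) (P n)"
      and near: "dist (P n) p0 < \<epsilon> n" for n
      using PQ[of n] by (simp_all add: bad_def \<epsilon>_def)
    have P: "P \<longlonglongrightarrow> p0"
      unfolding tendsto_dist_iff[of P]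
      by (rule Lim_null_comparison[OF always_eventually \<epsilon>(1)]) (use near in \<open>simp add: less_imp_le\<close>)
    note comps = tendsto_fst tendsto_snd tendsto_fst[OF tendsto_snd]
      tendsto_fst[OF tendsto_snd[OF tendsto_snd]] tendsto_snd[OF tendsto_snd[OF tendsto_snd]]
    have limP: "(\<lambda>n. fst (P n)) \<longlonglongrightarrow> circ t0" "(\<lambda>n. ?b (P n)) \<longlonglongrightarrow> conj_dir t0"
      "(\<lambda>n. ?d (P n)) \<longlonglongrightarrow> frame_inv t0 \<xi>" "(\<lambda>n. ?e (P n)) \<longlonglongrightarrow> frame_inv t0 \<eta>"
      using comps[OF P] by (simp_all add: p0_def)
    have eqs: "N (fst (Q n)) = N (fst (P n))" "N (?b (Q n)) = N (?b (P n))"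
      "N (?d (Q n)) = N (?d (P n))"
      "N (?e (Q n)) = N (?e (P n))" for n
      using lens[of n] by (auto simp: near_lengths_def case_prod_unfold)
    have "bounded (range (\<lambda>n. fst (Q n)) \<times> range (\<lambda>n. ?b (Q n)) \<times>
        range (\<lambda>n. ?d (Q n)) \<times> range (\<lambda>n. ?e (Q n)))"
      by (intro bounded_Times bounded_if_same_N[OF limP(1) eqs(1)] bounded_if_same_N[OF limP(2) eqs(2)]
          bounded_if_same_N[OF limP(3) eqs(3)] bounded_if_same_N[OF limP(4) eqs(4)])
    then have "bounded (range Q)"
      by (rule bounded_subset) (rule subsetI, elim rangeE, simp add: mem_Times_iff)
    then obtain q r where r: "strict_mono r" "(Q \<circ> r) \<longlonglongrightarrow> q"
      using bounded_imp_convergent_subsequence by blast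
    have Pr: "(\<lambda>n. P (r n)) \<longlonglongrightarrow> p0" and \<epsilon>r: "(\<lambda>n. \<epsilon> (r n)) \<longlonglongrightarrow> 0"
      using LIMSEQ_subseq_LIMSEQ[OF P r(1)] LIMSEQ_subseq_LIMSEQ[OF \<epsilon>(1) r(1)] by (simp_all add: o_def)
    have \<epsilon>2: "(\<lambda>n. (\<epsilon> (r n))\<^sup>2) \<longlonglongrightarrow> 0" using tendsto_power[OF \<epsilon>r, of 2] by simp
    have pos: "\<epsilon> (r n) > 0" "(\<epsilon> (r n))\<^sup>2 > 0" for n using \<epsilon>(2)[of "r n"] by auto
    obtain c b d e where q: "q = (c, b, d, e)" by (cases q) auto
    note pl = comps[OF Pr, unfolded p0_def fst_conv snd_conv]
    note ql = comps[OF r(2), unfolded q fst_conv snd_conv o_def]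
    have unique: "l = l'" if "f \<longlonglongrightarrow> l" "g \<longlonglongrightarrow> l'" "\<And>n. f n = g n"
      for f g :: "nat \<Rightarrow> real" and l l'
      using LIMSEQ_unique that(1,2) unfolding that(3)[abs_def] by blast
    have N_eqs: "N c = N (circ t0)" "N b = N (conj_dir t0)" "N d = N (frame_inv t0 \<xi>)" "N e = N (frame_inv t0 \<eta>)"
      by (rule unique[OF N_tendsto[OF ql(1)] N_tendsto[OF pl(1)] eqs(1)]
          unique[OF N_tendsto[OF ql(3)] N_tendsto[OF pl(3)] eqs(2)]
          unique[OF N_tendsto[OF ql(4)] N_tendsto[OF pl(4)] eqs(3)]
          unique[OF N_tendsto[OF ql(5)] N_tendsto[OF pl(5)] eqs(4)])+
    have ne: "c \<noteq> 0" "b \<noteq> 0" using N_eqs(1,2) by (metis N_eq_0_iff circ_nonzero conj_dir_nonzero)+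
    have slopes: 
      "slope (\<epsilon> n) (fst (Q n)) (?b (Q n)) = slope (\<epsilon> n) (fst (P n)) (?b (P n))"
      "slope (\<epsilon> n) (?b (Q n)) (?d (Q n)) = slope (\<epsilon> n) (?b (P n)) (?d (P n))"
      "slope (\<epsilon> n) (?b (Q n)) (?e (Q n)) = slope (\<epsilon> n) (?b (P n)) (?e (P n))"
      "slope ((\<epsilon> n)\<^sup>2) (fst (Q n)) (?d (Q n)) = slope ((\<epsilon> n)\<^sup>2) (fst (P n)) (?d (P n))"
      "slope ((\<epsilon> n)\<^sup>2) (fst (Q n)) (?e (Q n)) = slope ((\<epsilon> n)\<^sup>2) (fst (P n)) (?e (P n))" for n
      using lens[of n] by (auto simp: near_lengths_def case_prod_unfold)
    have slope_eq: "grad z \<bullet> w = grad z0 \<bullet> w0"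
      if "Z' \<longlonglongrightarrow> z" "W' \<longlonglongrightarrow> w" "Z \<longlonglongrightarrow> z0" "W \<longlonglongrightarrow> w0" "z \<noteq> 0" "z0 \<noteq> 0"
        "f \<longlonglongrightarrow> 0" "\<And>n. f n > 0" "\<And>n. slope (f n) (Z' n) (W' n) = slope (f n) (Z n) (W n)"
      for f Z Z' W W' z w z0 w0
      using unique[OF slope_tendsto[OF that(1,5,2,7,8)] slope_tendsto[OF that(3,6,4,7,8)] that(9)] by simp
    note cb = slope_eq[OF ql(1,3) pl(1,3) ne(1) circ_nonzero \<epsilon>r pos(1) slopes(1)]
    note bd = slope_eq[OF ql(3,4) pl(3,4) ne(2) conj_dir_nonzero \<epsilon>r pos(1) slopes(2)]
    note be = slope_eq[OF ql(3,5) pl(3,5) ne(2) conj_dir_nonzero \<epsilon>r pos(1) slopes(3)]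
    note cd = slope_eq[OF ql(1,4) pl(1,4) ne(1) circ_nonzero \<epsilon>2 pos(2) slopes(4)]
    note ce = slope_eq[OF ql(1,5) pl(1,5) ne(1) circ_nonzero \<epsilon>2 pos(2) slopes(5)]
    obtain A where A: "linear A" "\<And>x. N (A x) = N x" "A (circ t0) = c" "A (conj_dir t0) = b"
      "A (frame_inv t0 \<xi>) = d" "A (frame_inv t0 \<eta>) = e"
      using limit_rigid[OF rigid N_eqs cb bd be cd ce] by blast
    obtain A' where A': "linear A'" "\<And>x. N (A' x) = N x" "\<And>x. A' (A x) = x" "\<And>x. A (A' x) = x"
      using linear_isometry_inverse[OF A(1,2)] by blast
    have "map4 A' q = p0" using A'(3) by (simp add: map4_def q p0_def A(3-6)[symmetric])
    moreover have "(\<lambda>n. map4 A' (Q (r n))) \<longlonglongrightarrow> map4 A' q"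
    proof -
      have "isCont A' x" for x using A'(1) linear_continuous_at linear_conv_bounded_linear by blast
      then show ?thesis
        unfolding map4_def case_prod_unfold q fst_conv snd_conv
        by (intro tendsto_Pair isCont_tendsto_compose[of _ A'] ql)
    qed
    ultimately have lim: "(\<lambda>n. map4 A' (Q (r n))) \<longlonglongrightarrow> p0" by simp
    have "near_lengths (\<epsilon> (r n)) (map4 A' (Q (r n))) = near_lengths (\<epsilon> (r n)) (P (r n))" for n
      using lens by (simp add: near_lengths_isometry[OF A'(1,2)])
    from near_lengths_locally_injective[OF D Pr[unfolded p0_def] lim[unfolded p0_def] \<epsilon>r pos(1) this]
    obtain n where n: "map4 A' (Q (r n)) = P (r n)" by blast
    have "Q (r n) = map4 A (P (r n))"
      unfolding n[symmetric] by (cases "Q (r n)") (simp add: map4_def A'(4))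
    then show False using PQ[of "r n"] A(1,2) by (auto simp: bad_def)
  qed
  then obtain n :: nat where n: "\<And>p q. \<not> bad (inverse (real (Suc n))) p q" by blast
  show ?thesis
  proof (rule that[of "inverse (real (Suc n))" p0])
    show "inverse (real (Suc n)) \<le> 1" by (simp add: inverse_le_1_iff)
  qed (use n in \<open>auto simp: bad_def\<close>)
qed

text \<open>The rescaling that relates five points to the configurations of the previous lemma is
  continuous, and its preimage of a ball contains a box.\<close>

lemma five_points_rigid:
  assumes noneucl: "\<nexists>q. \<forall>z. (N z)\<^sup>2 = qform q z"
  obtains A B C D E where "open A" "open B" "open C" "open D" "open E"
    "A \<noteq> {}" "B \<noteq> {}" "C \<noteq> {}" "D \<noteq> {}" "E \<noteq> {}"
    "\<And>a b c d e a' b' c' d' e'. a \<in> A \<Longrightarrow> b \<in> B \<Longrightarrow> c \<in> C \<Longrightarrow> d \<in> D \<Longrightarrow> e \<in> E \<Longrightarrow>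
      N (b - a) = N (b' - a') \<Longrightarrow> N (c - a) = N (c' - a') \<Longrightarrow> N (c - b) = N (c' - b') \<Longrightarrow>
      N (d - a) = N (d' - a') \<Longrightarrow> N (b - d) = N (b' - d') \<Longrightarrow> N (c - d) = N (c' - d') \<Longrightarrow>
      N (e - a) = N (e' - a') \<Longrightarrow> N (b - e) = N (b' - e') \<Longrightarrow> N (c - e) = N (c' - e') \<Longrightarrow>
      \<exists>M. linear M \<and> (\<forall>x. N (M x) = N x) \<and>
        b' - a' = M (b - a) \<and> c' - a' = M (c - a) \<and> d' - a' = M (d - a) \<and> e' - a' = M (e - a)"
proof -
  obtain p0 \<epsilon> where \<epsilon>: "0 < \<epsilon>" "\<epsilon> \<le> 1"
    and rigid: "\<And>p q. dist p p0 < \<epsilon> \<Longrightarrow> near_lengths \<epsilon> q = near_lengths \<epsilon> p \<Longrightarrow>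
       \<exists>A. linear A \<and> (\<forall>x. N (A x) = N x) \<and> q = map4 A p"
    using near_rigid[OF noneucl] by metis
  obtain c0 b0 d0 e0 where p0: "p0 = (c0, b0, d0, e0)" by (cases p0) auto
  define rescale where "rescale = (\<lambda>(a :: real \<times> real, b :: real \<times> real, c :: real \<times> real,
        d :: real \<times> real, e :: real \<times> real).
      (c - a, (b - a) /\<^sub>R \<epsilon>, (d - a) /\<^sub>R \<epsilon>\<^sup>2, (e - a) /\<^sub>R \<epsilon>\<^sup>2))"
  have cont: "continuous_on UNIV rescale"
    unfolding rescale_def case_prod_unfold by (intro continuous_intros)
  define W where "W = rescale -` ball p0 \<epsilon>"
  have "open W" unfolding W_def by (rule open_vimage[OF open_ball cont])
  define b1 d1 e1 where pts: "b1 = \<epsilon> *\<^sub>R b0" "d1 = \<epsilon>\<^sup>2 *\<^sub>R d0" "e1 = \<epsilon>\<^sup>2 *\<^sub>R e0"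
  have "(0, b1, c0, d1, e1) \<in> W"
    using \<epsilon>(1) by (simp add: W_def rescale_def p0 pts)
  with \<open>open W\<close> obtain A B C D E where AE: "open A" "open B" "open C" "open D" "open E"
    "(0, b1, c0, d1, e1) \<in> A \<times> B \<times> C \<times> D \<times> E" "A \<times> B \<times> C \<times> D \<times> E \<subseteq> W"
  proof -
    assume W: "open W" "(0, b1, c0, d1, e1) \<in> W"
    from open_prod_elim[OF W] obtain A W1 where 1: "open A" "open W1"
      "(0, b1, c0, d1, e1) \<in> A \<times> W1" "A \<times> W1 \<subseteq> W" by metis
    from 1(3) have "(b1, c0, d1, e1) \<in> W1" by simp
    from open_prod_elim[OF 1(2) this] obtain B W2 where 2: "open B" "open W2"
      "(b1, c0, d1, e1) \<in> B \<times> W2" "B \<times> W2 \<subseteq> W1" by metis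
    from 2(3) have "(c0, d1, e1) \<in> W2" by simp
    from open_prod_elim[OF 2(2) this] obtain C W3 where 3: "open C" "open W3"
      "(c0, d1, e1) \<in> C \<times> W3" "C \<times> W3 \<subseteq> W2" by metis
    from 3(3) have "(d1, e1) \<in> W3" by simp
    from open_prod_elim[OF 3(2) this] obtain D E where 4: "open D" "open E"
      "(d1, e1) \<in> D \<times> E" "D \<times> E \<subseteq> W3" by metis
    show ?thesis
    proof (rule that[OF 1(1) 2(1) 3(1) 4(1,2)])
      show "(0, b1, c0, d1, e1) \<in> A \<times> B \<times> C \<times> D \<times> E"
        using 1(3) 2(3) 3(3) 4(3) by simp
      have "C \<times> D \<times> E \<subseteq> W2" using 3(4) 4(4) by (meson Sigma_mono order_refl order_trans)
      then have "B \<times> C \<times> D \<times> E \<subseteq> W1" using 2(4) by (meson Sigma_mono order_refl order_trans)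
      then show "A \<times> B \<times> C \<times> D \<times> E \<subseteq> W" using 1(4) by (meson Sigma_mono order_refl order_trans)
    qed
  qed
  show ?thesis
  proof (rule that[OF AE(1-5)])
    fix a b c d e a' b' c' d' e'
    assume mem: "a \<in> A" "b \<in> B" "c \<in> C" "d \<in> D" "e \<in> E"
      and eqs: "N (b - a) = N (b' - a')" "N (c - a) = N (c' - a')" "N (c - b) = N (c' - b')"
        "N (d - a) = N (d' - a')" "N (b - d) = N (b' - d')" "N (c - d) = N (c' - d')"
        "N (e - a) = N (e' - a')" "N (b - e) = N (b' - e')" "N (c - e) = N (c' - e')"
    have lens: "near_lengths \<epsilon> (rescale (a, b, c, d, e)) =
      (N (c - a), N (b - a) / \<epsilon>, N (d - a) / \<epsilon>\<^sup>2, N (e - a) / \<epsilon>\<^sup>2,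
       (N (c - b) - N (c - a)) / \<epsilon>, (N (b - d) / \<epsilon> - N (b - a) / \<epsilon>) / \<epsilon>, (N (b - e) / \<epsilon> - N (b - a) / \<epsilon>) / \<epsilon>,
       (N (c - d) - N (c - a)) / \<epsilon>\<^sup>2, (N (c - e) - N (c - a)) / \<epsilon>\<^sup>2)" for a b c d e
    proof -
      \<comment> \<open>Each rescaled length is a function of the nine distances alone.\<close>
      have 1: "(b - a) /\<^sub>R \<epsilon> - \<epsilon> *\<^sub>R ((x - a) /\<^sub>R \<epsilon>\<^sup>2) = (b - x) /\<^sub>R \<epsilon>" for x
      proof -
        have "\<epsilon> *\<^sub>R ((x - a) /\<^sub>R \<epsilon>\<^sup>2) = (x - a) /\<^sub>R \<epsilon>" using \<epsilon>(1) by (simp add: power2_eq_square)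
        then show ?thesis by (simp add: scaleR_diff_right)
      qed
      have 2: "c - a - \<epsilon> *\<^sub>R ((b - a) /\<^sub>R \<epsilon>) = c - b" "c - a - \<epsilon>\<^sup>2 *\<^sub>R ((x - a) /\<^sub>R \<epsilon>\<^sup>2) = c - x" for x
        using \<epsilon>(1) by simp_all
      show ?thesis
        unfolding rescale_def near_lengths_def slope_def prod.case 1 2
        using \<epsilon>(1) by (simp add: scale divide_inverse mult.commute)
    qed
    have "(a, b, c, d, e) \<in> W" using mem by (intro subsetD[OF AE(7)]) simp
    then have "rescale (a, b, c, d, e) \<in> ball p0 \<epsilon>" by (simp only: W_def vimage_eq)
    then have "dist (rescale (a, b, c, d, e)) p0 < \<epsilon>" by (simp add: dist_commute)
    from rigid[OF this, of "rescale (a', b', c', d', e')"]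
    obtain M where M: "linear M" "\<And>x. N (M x) = N x"
      "rescale (a', b', c', d', e') = map4 M (rescale (a, b, c, d, e))"
      unfolding lens eqs by blast
    have "(x' :: real \<times> real) = M x" if "x' /\<^sub>R k = M (x /\<^sub>R k)" "k > 0" for x' x k
    proof -
      have "x' /\<^sub>R k = M x /\<^sub>R k" using that(1) linear_scale[OF M(1)] by simp
      then show ?thesis using that(2) by simp
    qed
    moreover have "\<epsilon>\<^sup>2 > 0" using \<epsilon>(1) by simp
    ultimately show "\<exists>M. linear M \<and> (\<forall>x. N (M x) = N x) \<and>
        b' - a' = M (b - a) \<and> c' - a' = M (c - a) \<and> d' - a' = M (d - a) \<and> e' - a' = M (e - a)"
      using M \<epsilon>(1) unfolding rescale_def map4_def prod.case prod.inject by metis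
  qed (use AE(6) in auto)
qed

section \<open>Trilateration from a nearby point\<close>

text \<open>Two gradients orthogonal to the same vector are proportional. Both functionals have dual norm
  one, so they agree up to sign, and by strict convexity the base points are parallel.\<close>

lemma independent_gradients:
  assumes "v \<noteq> 0" "w \<notin> span {v}" "grad v \<bullet> u = 0" "grad w \<bullet> u = 0"
  shows "u = 0"
proof (rule ccontr)
  assume u: "u \<noteq> 0"
  have w: "w \<noteq> 0" using assms(2) span_zero by metis
  obtain k where k: "grad v = k *\<^sub>R rot u"
    using orthogonal_imp_rot[OF u] assms(3) by (metis inner_commute)
  obtain l where l: "grad w = l *\<^sub>R rot u"
    using orthogonal_imp_rot[OF u] assms(4) by (metis inner_commute)
  have ne: "k \<noteq> 0" "l \<noteq> 0" using k l grad_nonzero[OF assms(1)] grad_nonzero[OF w] by auto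
  define m where "m = k / l"
  have m: "grad v = m *\<^sub>R grad w" using k l ne by (simp add: m_def)
  have abs_le: "\<bar>grad z \<bullet> x\<bar> \<le> N x" if "z \<noteq> 0" for z x
    using grad_le[OF that, of x] grad_le[OF that, of "- x"] by simp
  have "N v = m * (grad w \<bullet> v)" using grad_self[OF assms(1)] by (simp add: m)
  then have "N v \<le> \<bar>m\<bar> * N v" using abs_le[OF w, of v]
    by (metis abs_ge_self abs_ge_zero abs_mult mult_left_mono order_trans)
  then have m1: "\<bar>m\<bar> \<ge> 1" using N_pos[OF assms(1)] by simp
  have gw: "grad v \<bullet> w = m * N w" by (simp add: m grad_self[OF w])
  then have "\<bar>m\<bar> * N w \<le> N w" using abs_le[OF assms(1), of w] by (simp add: abs_mult)
  then have "\<bar>m\<bar> \<le> 1" using N_pos[OF w] by simp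
  then have m_cases: "m = 1 \<or> m = - 1" using m1 by linarith
  then have "grad v \<bullet> (m *\<^sub>R w) = N (m *\<^sub>R w)" "m *\<^sub>R w \<noteq> 0" using gw w by (auto simp: scale)
  then obtain c where "m *\<^sub>R w = c *\<^sub>R v" using grad_eq_N_imp_parallel[OF assms(1)] by metis
  then have "w = (m * c) *\<^sub>R v" using m_cases by (metis mult.right_neutral mult_minus_left mult_minus_right mult_1 minus_minus scaleR_one scaleR_scaleR)
  then show False using assms(2) by (metis span_base span_scale singletonI)
qed

text \<open>An inverse function theorem for \<open>x \<mapsto> (N (x - b), N (x - c))\<close> that is uniform in \<open>b\<close> and \<open>c\<close>: a
  failure would produce a unit vector in the kernel of both gradients.\<close>

lemma two_circles_locally_injective:
  assumes "a0 - b0 \<noteq> 0" "a0 - c0 \<notin> span {a0 - b0}"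
  obtains \<delta> where "\<delta> > 0" "\<And>b c x y. dist b b0 < \<delta> \<Longrightarrow> dist c c0 < \<delta> \<Longrightarrow> dist x a0 < \<delta> \<Longrightarrow> dist y a0 < \<delta> \<Longrightarrow>
     N (y - b) = N (x - b) \<Longrightarrow> N (y - c) = N (x - c) \<Longrightarrow> y = x"
proof -
  define bad where "bad = (\<lambda>\<delta> b c x y. dist b b0 < \<delta> \<and> dist c c0 < \<delta> \<and> dist x a0 < \<delta> \<and> dist y a0 < \<delta> \<and>
     N (y - b) = N (x - b) \<and> N (y - c) = N (x - c) \<and> y \<noteq> x)"
  have "\<exists>n :: nat. \<forall>b c x y. \<not> bad (inverse (real (Suc n))) b c x y"
  proof (rule ccontr)
    assume "\<not> ?thesis"
    then obtain b c x y where bad: "\<And>n :: nat. bad (inverse (real (Suc n))) (b n) (c n) (x n) (y n)" by metis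
    have to_lim: "f \<longlonglongrightarrow> l" if "\<And>n. dist (f n) l < inverse (real (Suc n))" for f and l :: "real \<times> real"
      unfolding tendsto_dist_iff[of f]
      by (rule Lim_null_comparison[OF always_eventually LIMSEQ_inverse_real_of_nat])
        (use that in \<open>simp add: less_imp_le\<close>)
    have lim: "b \<longlonglongrightarrow> b0" "c \<longlonglongrightarrow> c0" "x \<longlonglongrightarrow> a0" "y \<longlonglongrightarrow> a0"
      using bad by (auto intro!: to_lim simp: bad_def)
    have ne: "y n - x n \<noteq> 0" for n using bad[of n] by (simp add: bad_def)
    define u where "u = (\<lambda>n. (y n - x n) /\<^sub>R norm (y n - x n))"
    have nu: "norm (u n) = 1" for n using ne[of n] by (simp add: u_def)
    then have "bounded (range u)" by (auto intro!: boundedI[of _ 1])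
    then obtain l r where r: "strict_mono r" "(u \<circ> r) \<longlonglongrightarrow> l"
      using bounded_imp_convergent_subsequence by blast
    have "(\<lambda>n. norm ((u \<circ> r) n)) \<longlonglongrightarrow> norm l" by (rule tendsto_norm[OF r(2)])
    then have l1: "norm l = 1" by (simp add: nu LIMSEQ_const_iff)
    have grad0: "grad (a0 - z0) \<bullet> l = 0"
      if z: "z \<longlonglongrightarrow> z0" "a0 - z0 \<noteq> 0" "\<And>n. N (y n - z n) = N (x n - z n)" for z z0
    proof (rule equal_N_derivative)
      show "(\<lambda>n. x (r n) - z (r n)) \<longlonglongrightarrow> a0 - z0" "(\<lambda>n. y (r n) - z (r n)) \<longlonglongrightarrow> a0 - z0"
        using LIMSEQ_subseq_LIMSEQ[OF _ r(1)] lim z(1) by (auto intro!: tendsto_diff simp: o_def)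
      show "(\<lambda>n. (y (r n) - z (r n) - (x (r n) - z (r n))) /\<^sub>R norm (y (r n) - x (r n))) \<longlonglongrightarrow> l"
        using r(2) by (simp add: u_def o_def)
    qed (use z in auto)
    have "a0 - c0 \<noteq> 0" using assms(2) span_zero by metis
    have "l = 0"
      by (rule independent_gradients[OF assms grad0[OF lim(1)] grad0[OF lim(2)]])
        (use assms(1) \<open>a0 - c0 \<noteq> 0\<close> bad in \<open>auto simp: bad_def\<close>)
    then show False using l1 by simp
  qed
  then obtain n :: nat where n: "\<And>b c x y. \<not> bad (inverse (real (Suc n))) b c x y" by blast
  show ?thesis
    by (rule that[of "inverse (real (Suc n))"]) (use n in \<open>auto simp: bad_def\<close>)
qed

text \<open>The point \<open>x\<close> is placed near \<open>a\<close>. Its distance to \<open>a\<close> then confines every competitor \<open>y\<close> to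
  the neighbourhood of \<open>a\<close> in which the distances to \<open>b\<close> and \<open>c\<close> are injective.\<close>

lemma trilateration_unique:
  assumes "open A" "open B" "open C" "A \<noteq> {}" "B \<noteq> {}" "C \<noteq> {}"
  obtains A' B' C' X where "open A'" "open B'" "open C'" "open X"
    "A' \<noteq> {}" "B' \<noteq> {}" "C' \<noteq> {}" "X \<noteq> {}" "A' \<subseteq> A" "B' \<subseteq> B" "C' \<subseteq> C"
    "\<And>a b c x y. a \<in> A' \<Longrightarrow> b \<in> B' \<Longrightarrow> c \<in> C' \<Longrightarrow> x \<in> X \<Longrightarrow>
      N (y - a) = N (x - a) \<Longrightarrow> N (y - b) = N (x - b) \<Longrightarrow> N (y - c) = N (x - c) \<Longrightarrow> y = x"
proof -
  have avoid: "\<exists>z\<in>S. a - z \<notin> span {v}" if S: "open S" "S \<noteq> {}" for S and a v :: "real \<times> real"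
  proof (rule ccontr)
    assume "\<not> ?thesis"
    then have sub: "(\<lambda>z. a - z) ` S \<subseteq> span {v}" by blast
    have "open ((\<lambda>z. a - z) ` S)"
    proof -
      have "(\<lambda>z. a - z) ` S = (\<lambda>z. a - z) -` S"
        by safe (simp, metis diff_diff_eq2 add_diff_cancel_left' image_eqI)
      then show ?thesis using S(1) by (simp add: open_vimage continuous_intros)
    qed
    then show False using open_not_subset_line[of "(\<lambda>z. a - z) ` S" v] S(2) sub by simp
  qed
  obtain a0 where a0: "a0 \<in> A" using assms(4) by blast
  obtain b0 where b0: "b0 \<in> B" "a0 - b0 \<notin> span {0}" using avoid[OF assms(2,5)] by blast
  obtain c0 where c0: "c0 \<in> C" "a0 - c0 \<notin> span {a0 - b0}" using avoid[OF assms(3,6)] by blast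
  have "a0 - b0 \<noteq> 0" using b0(2) span_zero by metis
  obtain \<delta> where \<delta>: "\<delta> > 0" "\<And>b c x y. dist b b0 < \<delta> \<Longrightarrow> dist c c0 < \<delta> \<Longrightarrow> dist x a0 < \<delta> \<Longrightarrow> dist y a0 < \<delta> \<Longrightarrow>
     N (y - b) = N (x - b) \<Longrightarrow> N (y - c) = N (x - c) \<Longrightarrow> y = x"
    by (rule two_circles_locally_injective[OF \<open>a0 - b0 \<noteq> 0\<close> c0(2)]) blast
  obtain M where M: "M > 0" "\<And>z. norm z \<le> M * N z" by (rule N_lower_bound) blast
  obtain K where K: "K > 0" "\<And>z. N z \<le> K * norm z" by (rule N_bound) blast
  define k where "k = 2 * M * K + 1"
  \<comment> \<open>If \<open>a\<close> and \<open>x\<close> are within \<open>\<delta>'\<close> of \<open>a0\<close>, then \<open>dist y a < 2 M K \<delta>'\<close>, so \<open>y\<close> is within \<open>k \<delta>' = \<delta>\<close> of \<open>a0\<close>.\<close>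
  define \<delta>' where "\<delta>' = \<delta> / k"
  have "k > 1" using M(1) K(1) by (simp add: k_def)
  then have \<delta>': "\<delta>' > 0" "\<delta>' \<le> \<delta>" "k * \<delta>' = \<delta>"
    using \<delta>(1) by (simp_all add: \<delta>'_def divide_le_eq)
  show ?thesis
  proof (rule that[of "A \<inter> ball a0 \<delta>'" "B \<inter> ball b0 \<delta>" "C \<inter> ball c0 \<delta>" "ball a0 \<delta>'"])
    fix a b c x y
    assume m: "a \<in> A \<inter> ball a0 \<delta>'" "b \<in> B \<inter> ball b0 \<delta>" "c \<in> C \<inter> ball c0 \<delta>" "x \<in> ball a0 \<delta>'"
      and eq: "N (y - a) = N (x - a)" "N (y - b) = N (x - b)" "N (y - c) = N (x - c)"
    have d: "dist a a0 < \<delta>'" "dist x a0 < \<delta>'" using m by (auto simp: dist_commute)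
    have "dist x a < 2 * \<delta>'" using d dist_triangle2[of x a a0] by simp
    have "norm (y - a) \<le> M * N (x - a)" using M(2)[of "y - a"] eq(1) by simp
    also have "\<dots> \<le> M * (K * norm (x - a))" using M(1) K(2) by (intro mult_left_mono) auto
    also have "\<dots> < M * (K * (2 * \<delta>'))" using M(1) K(1) \<open>dist x a < 2 * \<delta>'\<close> by (simp add: dist_norm)
    finally have "dist y a < 2 * M * K * \<delta>'" by (simp add: dist_norm algebra_simps)
    then have "dist y a0 < 2 * M * K * \<delta>' + \<delta>'" using d(1) dist_triangle[of y a0 a] by simp
    then have "dist y a0 < \<delta>" using \<delta>'(3) by (simp add: k_def algebra_simps)
    then show "y = x"
      using \<delta>(2)[of b c x y] m d \<delta>'(2) eq by (simp add: dist_commute)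
  qed (use assms a0 b0 c0 \<delta>' \<delta>(1) in \<open>auto intro: exI[of _ a0]\<close>)
qed

end

section \<open>Lateration graphs and boxes of placements\<close>

lemma lateration_graph_card_ge: "lateration_graph k V E \<Longrightarrow> k \<le> card V"
  by (induction rule: lateration_graph.induct)
    (auto simp: card_insert_if dest: lateration_graph_finite_simple(1))

text \<open>The first added vertex has exactly \<open>k\<close> vertices to choose its \<open>k\<close> neighbours from.\<close>

lemma lateration_graph_complete_Suc:
  assumes "lateration_graph k V E" "card V \<le> Suc k"
  shows "E = {e. e \<subseteq> V \<and> card e = 2}"
  using assms
proof (cases rule: lateration_graph.cases)
  case (add_vertex V' E' v S)
  have fin: "finite V'" using lateration_graph_finite_simple(1)[OF add_vertex(3)] .
  have card: "card V' = k"
    using assms(2) add_vertex(1,4) fin lateration_graph_card_ge[OF add_vertex(3)] by simp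
  then have "S = V'" using add_vertex(5,6) fin by (simp add: card_subset_eq)
  moreover have "E' = {e. e \<subseteq> V' \<and> card e = 2}"
    using add_vertex(3)
  proof (cases rule: lateration_graph.cases)
    case (add_vertex W F u T)
    then show ?thesis using card lateration_graph_card_ge[OF add_vertex(3)]
        lateration_graph_finite_simple(1)[OF add_vertex(3)] by simp
  qed
  moreover have "{e. e \<subseteq> insert v V' \<and> card e = 2} = {e. e \<subseteq> V' \<and> card e = 2} \<union> {{v, w} | w. w \<in> V'}"
  proof (intro equalityI subsetI)
    fix e assume e: "e \<in> {e. e \<subseteq> insert v V' \<and> card e = 2}"
    show "e \<in> {e. e \<subseteq> V' \<and> card e = 2} \<union> {{v, w} | w. w \<in> V'}"
    proof (cases "v \<in> e")
      case True
      from e obtain x y where "e = {x, y}" "x \<noteq> y" by (auto simp: card_2_iff)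
      then show ?thesis using e True by auto
    qed (use e in auto)
  qed (use add_vertex(4) in \<open>auto simp: card_insert_if\<close>)
  ultimately show ?thesis using add_vertex(1,2) by simp
qed

text \<open>The fifth vertex \<open>e\<close> misses exactly one vertex \<open>d\<close> of the complete graph on the first four.\<close>

lemma lateration_graph_five:
  assumes "lateration_graph 3 V E" "card V = 5"
  obtains a b c d e where "distinct [a, b, c, d, e]" "V = {a, b, c, d, e}"
    "{a, b} \<in> E" "{a, c} \<in> E" "{b, c} \<in> E" "{d, a} \<in> E" "{d, b} \<in> E" "{d, c} \<in> E"
    "{e, a} \<in> E" "{e, b} \<in> E" "{e, c} \<in> E"
  using assms(1)
proof (cases rule: lateration_graph.cases)
  case complete
  then show ?thesis using assms(2) by simp
next
  case (add_vertex V' E' e S)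
  have fin: "finite V'" using lateration_graph_finite_simple(1)[OF add_vertex(3)] .
  have card: "card V' = 4" using assms(2) add_vertex(1,4) fin by simp
  have E': "E' = {e. e \<subseteq> V' \<and> card e = 2}"
    by (rule lateration_graph_complete_Suc[OF add_vertex(3)]) (simp add: card)
  have "card (V' - S) = 1"
    using card add_vertex(5,6) fin by (simp add: card_Diff_subset finite_subset)
  then obtain d where d: "V' - S = {d}" by (auto simp: card_1_singleton_iff)
  from add_vertex(6) obtain a b c where S: "S = {a, b, c}" "a \<noteq> b" "b \<noteq> c" "a \<noteq> c"
    by (auto simp: card_3_iff)
  have V': "V' = {a, b, c, d}" using d S(1) add_vertex(5) by auto
  have "d \<notin> S" using d by auto
  show ?thesis
  proof (rule that)
    show "distinct [a, b, c, d, e]"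
      using S \<open>d \<notin> S\<close> add_vertex(4) V' by auto
    show "V = {a, b, c, d, e}" using add_vertex(1) V' by auto
  qed (use S \<open>d \<notin> S\<close> in \<open>auto simp: add_vertex(2) E' V'\<close>)
qed

definition box_globally_rigid :: "'v set \<Rightarrow> 'v set set \<Rightarrow> ('v \<Rightarrow> 'x::real_normed_vector set) \<Rightarrow> bool" where
  "box_globally_rigid V E U \<longleftrightarrow> (\<forall>v\<in>V. open (U v) \<and> U v \<noteq> {}) \<and>
     (\<forall>p. (\<forall>v\<in>V. p v \<in> U v) \<longrightarrow> globally_rigid_framework V E p)"

text \<open>The nine equations are the edges of the complete graph on five vertices without the edge \<open>d e\<close>.\<close>

definition rigid_five_box :: "'x::real_normed_vector set \<Rightarrow> 'x set \<Rightarrow> 'x set \<Rightarrow> 'x set \<Rightarrow> 'x set \<Rightarrow> bool" where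
  "rigid_five_box A B C D E \<longleftrightarrow>
     (\<forall>a\<in>A. \<forall>b\<in>B. \<forall>c\<in>C. \<forall>d\<in>D. \<forall>e\<in>E. \<forall>a' b' c' d' e'.
      norm (b - a) = norm (b' - a') \<longrightarrow> norm (c - a) = norm (c' - a') \<longrightarrow> norm (c - b) = norm (c' - b') \<longrightarrow>
      norm (d - a) = norm (d' - a') \<longrightarrow> norm (b - d) = norm (b' - d') \<longrightarrow> norm (c - d) = norm (c' - d') \<longrightarrow>
      norm (e - a) = norm (e' - a') \<longrightarrow> norm (b - e) = norm (b' - e') \<longrightarrow> norm (c - e) = norm (c' - e') \<longrightarrow>
      (\<exists>g. isometry g \<and> a' = g a \<and> b' = g b \<and> c' = g c \<and> d' = g d \<and> e' = g e))"

definition trilateration_box :: "'x::real_normed_vector set \<Rightarrow> 'x set \<Rightarrow> 'x set \<Rightarrow> 'x set \<Rightarrow> bool" where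
  "trilateration_box A B C X \<longleftrightarrow> (\<forall>a\<in>A. \<forall>b\<in>B. \<forall>c\<in>C. \<forall>x\<in>X. \<forall>y.
     norm (y - a) = norm (x - a) \<longrightarrow> norm (y - b) = norm (x - b) \<longrightarrow> norm (y - c) = norm (x - c) \<longrightarrow> y = x)"

definition trilaterable :: "'x::real_normed_vector itself \<Rightarrow> bool" where
  "trilaterable _ \<longleftrightarrow> (\<forall>A B C :: 'x set. open A \<longrightarrow> open B \<longrightarrow> open C \<longrightarrow> A \<noteq> {} \<longrightarrow> B \<noteq> {} \<longrightarrow> C \<noteq> {} \<longrightarrow>
     (\<exists>A' B' C' X. open A' \<and> open B' \<and> open C' \<and> open X \<and> A' \<noteq> {} \<and> B' \<noteq> {} \<and> C' \<noteq> {} \<and> X \<noteq> {} \<and>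
        A' \<subseteq> A \<and> B' \<subseteq> B \<and> C' \<subseteq> C \<and> trilateration_box A' B' C' X))"

lemma box_imp_globally_rigid_in:
  fixes U :: "'v \<Rightarrow> 'x::real_normed_vector set"
  assumes "finite V" "box_globally_rigid V E U"
  shows "globally_rigid_in TYPE('x) V E"
proof -
  have "PiE V U \<subseteq> {p \<in> V \<rightarrow>\<^sub>E UNIV. globally_rigid_framework V E p}"
    using assms(2) by (auto simp: box_globally_rigid_def PiE_iff)
  moreover have "openin (product_topology (\<lambda>_. euclidean :: 'x topology) V) (PiE V U)"
    using assms by (auto simp: openin_PiE_gen box_globally_rigid_def)
  ultimately have "PiE V U \<subseteq> product_topology (\<lambda>_. euclidean :: 'x topology) V interior_of
      {p \<in> V \<rightarrow>\<^sub>E UNIV. globally_rigid_framework V E p}"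
    by (rule interior_of_maximal)
  moreover have "PiE V U \<noteq> {}"
    using assms(2) by (auto simp: PiE_eq_empty_iff box_globally_rigid_def)
  ultimately show ?thesis unfolding globally_rigid_in_def by blast
qed

lemma box_globally_rigid_five:
  fixes A B C D E' :: "'x::real_normed_vector set"
  assumes dist: "distinct [a, b, c, d, e]" and V: "V = {a, b, c, d, e}"
    and E: "{a, b} \<in> E" "{a, c} \<in> E" "{b, c} \<in> E" "{d, a} \<in> E" "{d, b} \<in> E" "{d, c} \<in> E"
      "{e, a} \<in> E" "{e, b} \<in> E" "{e, c} \<in> E"
    and op: "open A" "open B" "open C" "open D" "open E'"
      "A \<noteq> {}" "B \<noteq> {}" "C \<noteq> {}" "D \<noteq> {}" "E' \<noteq> {}"
    and rigid: "rigid_five_box A B C D E'"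
  shows "box_globally_rigid V E (\<lambda>v. if v = a then A else if v = b then B else if v = c then C
      else if v = d then D else E')" (is "box_globally_rigid _ _ ?U")
  unfolding box_globally_rigid_def
proof (intro conjI allI impI)
  show "\<forall>v\<in>V. open (?U v) \<and> ?U v \<noteq> {}" using op by simp
  fix p assume p: "\<forall>v\<in>V. p v \<in> ?U v"
  have mem: "p a \<in> A" "p b \<in> B" "p c \<in> C" "p d \<in> D" "p e \<in> E'"
    using bspec[OF p, of a] bspec[OF p, of b] bspec[OF p, of c] bspec[OF p, of d] bspec[OF p, of e] dist
    by (auto simp: V)
  show "globally_rigid_framework V E p"
    unfolding globally_rigid_framework_def
  proof (intro ballI impI)
    fix q assume "equivalent_frameworks E p q"
    then have eq: "norm (p v - p w) = norm (q v - q w)" "norm (p w - p v) = norm (q w - q v)"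
      if "{v, w} \<in> E" for v w
      using that by (auto simp: equivalent_frameworks_def norm_minus_commute)
    have "\<exists>g. isometry g \<and> q a = g (p a) \<and> q b = g (p b) \<and> q c = g (p c) \<and> q d = g (p d) \<and> q e = g (p e)"
      by (rule rigid[unfolded rigid_five_box_def, rule_format, OF mem]) (intro eq E)+
    then show "congruent_frameworks V p q" by (auto simp: congruent_frameworks_def V)
  qed
qed

text \<open>An equivalent framework restricts to one on \<open>V\<close>, where it is \<open>g \<circ> p\<close> for an isometry \<open>g\<close>.
  Pulling the new point back by \<open>g\<close> gives a point with the same distances to the three neighbours as
  \<open>p v\<close>, and these determine it.\<close>

lemma box_globally_rigid_add_vertex:
  fixes U :: "'v \<Rightarrow> 'x::real_normed_vector set"
  assumes box: "box_globally_rigid V E U" and sub: "\<forall>e\<in>E. e \<subseteq> V"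
    and v: "v \<notin> V" and S: "S \<subseteq> V" "card S = 3"
    and trilat: "trilaterable TYPE('x)"
  obtains U' :: "'v \<Rightarrow> 'x set" where "box_globally_rigid (insert v V) (E \<union> {{v, w} | w. w \<in> S}) U'"
proof -
  from S(2) obtain a b c where abc: "S = {a, b, c}" "a \<noteq> b" "b \<noteq> c" "a \<noteq> c"
    by (auto simp: card_3_iff)
  have V: "a \<in> V" "b \<in> V" "c \<in> V" "v \<noteq> a" "v \<noteq> b" "v \<noteq> c" using abc(1) S(1) v by auto
  have U: "open (U w)" "U w \<noteq> {}" if "w \<in> V" for w using box that by (auto simp: box_globally_rigid_def)
  from trilat[unfolded trilaterable_def, rule_format, OF U(1)[OF V(1)] U(1)[OF V(2)] U(1)[OF V(3)] U(2)[OF V(1)] U(2)[OF V(2)] U(2)[OF V(3)]]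
  obtain A B C X where op: "open A" "open B" "open C" "open X" "A \<noteq> {}" "B \<noteq> {}" "C \<noteq> {}" "X \<noteq> {}"
    and sub': "A \<subseteq> U a" "B \<subseteq> U b" "C \<subseteq> U c"
    and unique: "trilateration_box A B C X" by metis
  define U' where "U' = U(a := A, b := B, c := C, v := X)"
  have "box_globally_rigid (insert v V) (E \<union> {{v, w} | w. w \<in> S}) U'"
    unfolding box_globally_rigid_def
  proof (intro conjI allI impI)
    show "\<forall>w\<in>insert v V. open (U' w) \<and> U' w \<noteq> {}" using U op by (auto simp: U'_def)
    fix p assume p: "\<forall>w\<in>insert v V. p w \<in> U' w"
    have pV: "\<forall>w\<in>V. p w \<in> U w"
    proof
      fix w assume w: "w \<in> V"
      then have "p w \<in> U' w" using p by blast
      then show "p w \<in> U w" using sub' w v by (auto simp: U'_def split: if_splits)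
    qed
    have mem: "p a \<in> A" "p b \<in> B" "p c \<in> C" "p v \<in> X"
      using bspec[OF p, of a] bspec[OF p, of b] bspec[OF p, of c] bspec[OF p, of v] V abc
      by (auto simp: U'_def)
    from pV box have rigid: "globally_rigid_framework V E p" by (simp add: box_globally_rigid_def)
    show "globally_rigid_framework (insert v V) (E \<union> {{v, w} | w. w \<in> S}) p"
      unfolding globally_rigid_framework_def
    proof (intro ballI impI)
      fix q assume q: "equivalent_frameworks (E \<union> {{v, w} | w. w \<in> S}) p q"
      have "equivalent_frameworks E p (restrict q V)"
        unfolding equivalent_frameworks_def
      proof (intro allI impI)
        fix x y assume xy: "{x, y} \<in> E"
        then have "x \<in> V" "y \<in> V" using sub by auto
        then show "norm (p x - p y) = norm (restrict q V x - restrict q V y)"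
          using q xy by (simp add: equivalent_frameworks_def)
      qed
      then have "congruent_frameworks V p (restrict q V)"
        using rigid by (simp add: globally_rigid_framework_def)
      then obtain g where g: "isometry g" "\<And>w. w \<in> V \<Longrightarrow> q w = g (p w)"
        by (auto simp: congruent_frameworks_def)
      obtain y where y: "g y = q v" using g(1) unfolding isometry_def by (metis surjD)
      have len: "norm (y - p s) = norm (p v - p s)" if "s \<in> S" for s
      proof -
        have "{v, s} \<in> E \<union> {{v, w} | w. w \<in> S}" using that by blast
        then have "norm (p v - p s) = norm (q v - q s)"
          using q unfolding equivalent_frameworks_def by blast
        also have "\<dots> = dist (g y) (g (p s))" using g(2) that S(1) y by (auto simp: dist_norm)
        also have "\<dots> = norm (y - p s)" using g(1) by (simp add: isometry_def dist_norm)
        finally show ?thesis by simp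
      qed
      have "y = p v" by (rule unique[unfolded trilateration_box_def, rule_format, OF mem]) (use len abc(1) in auto)
      then have "q v = g (p v)" using y by simp
      then show "congruent_frameworks (insert v V) p q"
        unfolding congruent_frameworks_def using g by blast
    qed
  qed
  then show ?thesis by (rule that)
qed

lemma lateration_graph_box_rigid:
  fixes V :: "'v set"
  assumes "lateration_graph 3 V E" "5 \<le> card V"
    and op: "open A" "open B" "open C" "open D" "open F"
      "A \<noteq> {}" "B \<noteq> {}" "C \<noteq> {}" "D \<noteq> {}" "F \<noteq> {}"
    and five: "rigid_five_box A B C D (F :: 'x::real_normed_vector set)"
    and trilat: "trilaterable TYPE('x)"
  shows "\<exists>U :: 'v \<Rightarrow> 'x set. box_globally_rigid V E U"
  using assms(1,2)
proof (induction rule: lateration_graph.induct)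
  case (complete V)
  then show ?case by simp
next
  case (add_vertex V E v S)
  have fs: "finite V" "\<forall>e\<in>E. e \<subseteq> V \<and> card e = 2"
    using lateration_graph_finite_simple[OF add_vertex(1)] by auto
  show ?case
  proof (cases "5 \<le> card V")
    case True
    then obtain U :: "'v \<Rightarrow> 'x set" where U: "box_globally_rigid V E U" using add_vertex.IH by blast
    have sub: "\<forall>e\<in>E. e \<subseteq> V" using fs(2) by blast
    obtain U' :: "'v \<Rightarrow> 'x set" where "box_globally_rigid (insert v V) (E \<union> {{v, w} | w. w \<in> S}) U'"
      by (rule box_globally_rigid_add_vertex[OF U sub add_vertex(2,3,4) trilat])
    then show ?thesis by blast
  next
    case False
    let ?F = "E \<union> {{v, w} | w. w \<in> S}"
    have "card (insert v V) = 5" using False add_vertex.prems fs(1) add_vertex(2) by simp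
    from lateration_graph_five[OF lateration_graph.add_vertex[OF add_vertex(1,2,3,4)] this]
    obtain a b c d e where g: "distinct [a, b, c, d, e]" "insert v V = {a, b, c, d, e}"
      "{a, b} \<in> ?F" "{a, c} \<in> ?F" "{b, c} \<in> ?F" "{d, a} \<in> ?F" "{d, b} \<in> ?F" "{d, c} \<in> ?F"
      "{e, a} \<in> ?F" "{e, b} \<in> ?F" "{e, c} \<in> ?F" .
    show ?thesis by (rule exI, rule box_globally_rigid_five[OF g op five])
  qed
qed

section \<open>Global rigidity of lateration graphs\<close>

lemma linear_coordinates_inverse:
  fixes L :: "real \<times> real \<Rightarrow> 'x::real_normed_vector"
  assumes "linear L" "bij L"
  shows "linear (inv L)" "\<And>x. L (inv L x) = x" "\<And>z. inv L (L z) = z"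
proof -
  show 1: "L (inv L x) = x" "inv L (L z) = z" for x z
    using assms(2) by (simp_all add: bij_is_surj surj_f_inv_f bij_is_inj inv_f_f)
  show "linear (inv L)"
  proof (rule linearI)
    fix x y c
    show "inv L (x + y) = inv L x + inv L y"
      using 1(2)[of "inv L x + inv L y"] by (simp add: linear_add[OF assms(1)] 1(1))
    show "inv L (c *\<^sub>R x) = c *\<^sub>R inv L x"
      using 1(2)[of "c *\<^sub>R inv L x"] by (simp add: linear_scale[OF assms(1)] 1(1))
  qed
qed

lemma linear_bij_eq_0:
  assumes "linear L" "bij L" "L z = 0"
  shows "z = 0"
  using injD[OF bij_is_inj[OF assms(2)], of z 0] linear_0[OF assms(1)] assms(3) by simp

lemma non_euclidean_coordinates:
  fixes L :: "real \<times> real \<Rightarrow> 'x::real_normed_vector"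
  assumes L: "linear L" "bij L" and ne: "\<not> euclidean_norm TYPE('x)"
  shows "\<nexists>q. \<forall>z. (norm (L z))\<^sup>2 = qform q z"
proof
  assume "\<exists>q. \<forall>z. (norm (L z))\<^sup>2 = qform q z"
  then obtain q where q: "\<And>z. (norm (L z))\<^sup>2 = qform q z" by blast
  note inv = linear_coordinates_inverse[OF L]
  define b where "b = (\<lambda>z w :: real \<times> real. fst q * (fst z * fst w)
      + fst (snd q) * (fst z * snd w + snd z * fst w) + snd (snd q) * (snd z * snd w))"
  define B where "B = (\<lambda>x y :: 'x. b (inv L x) (inv L y))"
  have self: "B x x = (norm x)\<^sup>2" for x
    using q[of "inv L x"] by (simp add: inv(2) B_def b_def qform_def power2_eq_square algebra_simps)
  have "bilinear B"
    unfolding bilinear_def B_def b_def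
    by (intro conjI allI linearI)
      (simp_all add: linear_add[OF inv(1)] linear_scale[OF inv(1)] algebra_simps)
  moreover have "B x y = B y x" for x y by (simp add: B_def b_def algebra_simps)
  ultimately have "inner_product B" by (simp add: inner_product_def self)
  then have "euclidean_norm TYPE('x)" unfolding euclidean_norm_def using self by (metis norm_ge_zero real_sqrt_unique)
  then show False using ne by simp
qed

text \<open>The dimension of the normed space enters only through the coordinates \<open>L\<close>, so the continuity of
  the inverse of \<open>L\<close> is obtained from the lower bound for the norm in coordinates.\<close>

lemma coordinates_continuous:
  fixes L :: "real \<times> real \<Rightarrow> 'x::real_normed_vector"
  assumes L: "linear L" "bij L" and N: "analytic_plane_norm (\<lambda>z. norm (L z)) grad hess"
  shows "open S \<Longrightarrow> open (L -` S)" "open T \<Longrightarrow> open (L ` T)"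
proof -
  note inv = linear_coordinates_inverse[OF L]
  have "continuous_on UNIV L" by (rule linear_continuous_on[OF linear_conv_bounded_linear[THEN iffD1, OF L(1)]])
  then show "open S \<Longrightarrow> open (L -` S)" by (simp add: open_vimage)
  interpret analytic_plane_norm "\<lambda>z. norm (L z)" grad hess by (rule N)
  obtain M where M: "M > 0" "\<And>z. norm z \<le> M * norm (L z)" by (rule N_lower_bound) blast
  have "norm (inv L x) \<le> norm x * M" for x using M(2)[of "inv L x"] by (simp add: inv(2) mult.commute)
  then have "bounded_linear (inv L)"
    by (intro bounded_linear_intro[of _ M]) (simp_all add: linear_add[OF inv(1)] linear_scale[OF inv(1)])
  then have "continuous_on UNIV (inv L)" by (rule linear_continuous_on)
  moreover have "L ` T = inv L -` T" by (auto simp: inv(3)) (metis inv(2) imageI)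
  ultimately show "open T \<Longrightarrow> open (L ` T)" by (simp add: open_vimage)
qed

lemma linear_isometry_from_coordinates:
  fixes L :: "real \<times> real \<Rightarrow> 'x::real_normed_vector"
  assumes L: "linear L" "bij L" and M: "linear M" "\<And>z. norm (L (M z)) = norm (L z)"
  shows "isometry (\<lambda>x. L (M (inv L x - u)) + v)"
proof -
  note inv = linear_coordinates_inverse[OF L]
  have "inj M"
    unfolding linear_injective_0[OF M(1)]
  proof (intro allI impI)
    fix z assume "M z = 0"
    then have "L z = 0" using M(2)[of z] linear_0[OF L(1)] by simp
    then show "z = 0" by (rule linear_bij_eq_0[OF L])
  qed
  then have "surj M" using M(1) by (simp add: linear_injective_imp_surjective)
  have "surj (\<lambda>x. L (M (inv L x - u)) + v)"
    unfolding surj_def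
  proof
    fix y
    obtain z where z: "M z = inv L (y - v)" using \<open>surj M\<close> by (metis surjD)
    have "y = L (M (inv L (L (z + u)) - u)) + v" by (simp add: inv(2,3) z)
    then show "\<exists>x. y = L (M (inv L x - u)) + v" by blast
  qed
  moreover have "dist (L (M (inv L x - u)) + v) (L (M (inv L y - u)) + v) = dist x y" for x y
  proof -
    have "L (M (inv L x - u)) - L (M (inv L y - u)) = L (M (inv L (x - y)))"
      by (simp add: linear_diff[OF L(1)] linear_diff[OF M(1)] linear_diff[OF inv(1)])
    then show ?thesis by (simp add: dist_norm M(2) inv(2))
  qed
  ultimately show ?thesis by (simp add: isometry_def)
qed

theorem theorem5p7:
  fixes V :: "'v set" and E :: "'v set set"
  assumes "lateration_graph 3 V E"
    and "card V \<ge> 5"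
    and "analytic_normed_plane TYPE('x::real_normed_vector)"
    and "\<not> euclidean_norm TYPE('x)"
  shows "globally_rigid_in TYPE('x) V E"
proof -
  obtain L :: "real \<times> real \<Rightarrow> 'x" where L: "linear L" "bij L"
    and an: "real_analytic_on (\<lambda>z. norm (L z)) (UNIV - {0})"
    using assms(3) unfolding analytic_normed_plane_def by blast
  note inv = linear_coordinates_inverse[OF L]
  obtain grad hess where N: "analytic_plane_norm (\<lambda>z. norm (L z)) grad hess"
  proof (rule analytic_plane_norm_exists[OF _ _ _ an])
    show "norm (L (x + y)) \<le> norm (L x) + norm (L y)" for x y
      by (simp add: linear_add[OF L(1)] norm_triangle_ineq)
    show "norm (L (r *\<^sub>R x)) = \<bar>r\<bar> * norm (L x)" for r x
      by (simp add: linear_scale[OF L(1)])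
    show "norm (L x) = 0 \<Longrightarrow> x = 0" for x using linear_bij_eq_0[OF L] by simp
  qed
  interpret analytic_plane_norm "\<lambda>z. norm (L z)" grad hess by (rule N)
  note op_vimage = coordinates_continuous(1)[OF L N] and op_image = coordinates_continuous(2)[OF L N]
  have nL: "norm (L (inv L x - inv L y)) = norm (x - y)" for x y
    by (simp add: linear_diff[OF L(1)] inv(2))
  obtain A B C D F where AF: "open A" "open B" "open C" "open D" "open F"
    "A \<noteq> {}" "B \<noteq> {}" "C \<noteq> {}" "D \<noteq> {}" "F \<noteq> {}"
    and rigid: "\<And>a b c d e a' b' c' d' e'. a \<in> A \<Longrightarrow> b \<in> B \<Longrightarrow> c \<in> C \<Longrightarrow> d \<in> D \<Longrightarrow> e \<in> F \<Longrightarrow>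
      norm (L (b - a)) = norm (L (b' - a')) \<Longrightarrow> norm (L (c - a)) = norm (L (c' - a')) \<Longrightarrow>
      norm (L (c - b)) = norm (L (c' - b')) \<Longrightarrow> norm (L (d - a)) = norm (L (d' - a')) \<Longrightarrow>
      norm (L (b - d)) = norm (L (b' - d')) \<Longrightarrow> norm (L (c - d)) = norm (L (c' - d')) \<Longrightarrow>
      norm (L (e - a)) = norm (L (e' - a')) \<Longrightarrow> norm (L (b - e)) = norm (L (b' - e')) \<Longrightarrow>
      norm (L (c - e)) = norm (L (c' - e')) \<Longrightarrow>
      \<exists>M. linear M \<and> (\<forall>x. norm (L (M x)) = norm (L x)) \<and>
        b' - a' = M (b - a) \<and> c' - a' = M (c - a) \<and> d' - a' = M (d - a) \<and> e' - a' = M (e - a)"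
    by (rule five_points_rigid[OF non_euclidean_coordinates[OF L assms(4)]]) (rule that)
  have "\<exists>U :: 'v \<Rightarrow> 'x set. box_globally_rigid V E U"
  proof (rule lateration_graph_box_rigid[OF assms(1,2)])
    show "rigid_five_box (L ` A) (L ` B) (L ` C) (L ` D) (L ` F)"
      unfolding rigid_five_box_def
    proof (intro ballI allI impI)
      fix a b c d e a' b' c' d' e' :: 'x
      assume mem: "a \<in> L ` A" "b \<in> L ` B" "c \<in> L ` C" "d \<in> L ` D" "e \<in> L ` F"
        and eqs: "norm (b - a) = norm (b' - a')" "norm (c - a) = norm (c' - a')" "norm (c - b) = norm (c' - b')"
          "norm (d - a) = norm (d' - a')" "norm (b - d) = norm (b' - d')" "norm (c - d) = norm (c' - d')"
          "norm (e - a) = norm (e' - a')" "norm (b - e) = norm (b' - e')" "norm (c - e) = norm (c' - e')"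
      have mem': "inv L a \<in> A" "inv L b \<in> B" "inv L c \<in> C" "inv L d \<in> D" "inv L e \<in> F"
        using mem by (auto simp: inv(3))
      obtain M where M: "linear M" "\<And>x. norm (L (M x)) = norm (L x)"
        "inv L b' - inv L a' = M (inv L b - inv L a)" "inv L c' - inv L a' = M (inv L c - inv L a)"
        "inv L d' - inv L a' = M (inv L d - inv L a)" "inv L e' - inv L a' = M (inv L e - inv L a)"
        using rigid[OF mem', of "inv L b'" "inv L a'" "inv L c'" "inv L d'" "inv L e'"] eqs
        unfolding nL by blast
      define g where "g = (\<lambda>x. L (M (inv L x - inv L a)) + a')"
      have "isometry g" unfolding g_def by (rule linear_isometry_from_coordinates[OF L M(1,2)])
      moreover have "a' = g a" by (simp add: g_def linear_0[OF M(1)] linear_0[OF L(1)])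
      moreover have "b' = g b" "c' = g c" "d' = g d" "e' = g e"
        unfolding g_def M(3-6)[symmetric] by (simp_all add: linear_diff[OF L(1)] inv(2))
      ultimately show "\<exists>g. isometry g \<and> a' = g a \<and> b' = g b \<and> c' = g c \<and> d' = g d \<and> e' = g e" by blast
    qed
    show "trilaterable TYPE('x)"
      unfolding trilaterable_def
    proof (intro allI impI)
      fix A B C :: "'x set"
      assume op: "open A" "open B" "open C" "A \<noteq> {}" "B \<noteq> {}" "C \<noteq> {}"
      have ne: "L -` S \<noteq> {}" if "S \<noteq> {}" for S using that inv(2) by (metis ex_in_conv vimageI)
      obtain A' B' C' X where X: "open A'" "open B'" "open C'" "open X"
        "A' \<noteq> {}" "B' \<noteq> {}" "C' \<noteq> {}" "X \<noteq> {}" "A' \<subseteq> L -` A" "B' \<subseteq> L -` B" "C' \<subseteq> L -` C"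
        and unique: "\<And>a b c x y. a \<in> A' \<Longrightarrow> b \<in> B' \<Longrightarrow> c \<in> C' \<Longrightarrow> x \<in> X \<Longrightarrow>
          norm (L (y - a)) = norm (L (x - a)) \<Longrightarrow> norm (L (y - b)) = norm (L (x - b)) \<Longrightarrow>
          norm (L (y - c)) = norm (L (x - c)) \<Longrightarrow> y = x"
        by (rule trilateration_unique[OF op_vimage[OF op(1)] op_vimage[OF op(2)] op_vimage[OF op(3)]
            ne[OF op(4)] ne[OF op(5)] ne[OF op(6)]]) (rule that)
      show "\<exists>A' B' C' X. open A' \<and> open B' \<and> open C' \<and> open X \<and> A' \<noteq> {} \<and> B' \<noteq> {} \<and> C' \<noteq> {} \<and> X \<noteq> {} \<and>
          A' \<subseteq> A \<and> B' \<subseteq> B \<and> C' \<subseteq> C \<and> trilateration_box A' B' C' X"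
        unfolding trilateration_box_def
      proof (intro exI conjI ballI allI impI)
        fix a b c x y :: 'x
        assume mem: "a \<in> L ` A'" "b \<in> L ` B'" "c \<in> L ` C'" "x \<in> L ` X"
          and eqs: "norm (y - a) = norm (x - a)" "norm (y - b) = norm (x - b)" "norm (y - c) = norm (x - c)"
        have "inv L a \<in> A'" "inv L b \<in> B'" "inv L c \<in> C'" "inv L x \<in> X"
          using mem by (auto simp: inv(3))
        from unique[OF this, of "inv L y"] have "inv L y = inv L x" unfolding nL using eqs by blast
        then show "y = x" by (metis inv(2))
      qed (use X op_image in auto)
    qed
  qed (use AF op_image in auto)
  then obtain U :: "'v \<Rightarrow> 'x set" where "box_globally_rigid V E U" ..
  then show ?thesis
    by (rule box_imp_globally_rigid_in[OF lateration_graph_finite_simple(1)[OF assms(1)]])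
qed

end
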